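(* Let $\Omega\subset\mathbb{R}^N$ be an open set. Assume that $\varphi \in C^1(H^1_0(\Omega),\mathbb{R})$, that $0$ is a strict local minimum of $\varphi$ which is not a global minimum, and define \[ \Gamma=\{ \gamma \in C([0, 1], H^1_0(\Omega)):\, \gamma(0) = 0 \text{ and } \varphi(\gamma(1)) < 0\} \] and \[ c=\inf_{\gamma \in \Gamma} \sup_{t\in [0,1]} \varphi (\gamma(t)). \] Assume that $\varphi$ satisfies the Palais–Smale condition. Let $H\subset\mathbb{R}^N$ be a closed half-space with $\sigma_H (\Omega) = \Omega$, and assume that $\varphi (u^H) \le \varphi (u)$ for every $u \in H^1_0(\Omega)$, where $u^H$ denotes the polarization of $u$ with respect to $H$. If $(\gamma_n)_{n \in \mathbb{N}}$ is a sequence in $\Gamma$ such that \[ \limsup_{n \to \infty} \sup_{t\in [0,1]} \varphi(\gamma_n(t)) \le c, \] then there exists $u \in H^1_0(\Omega)$ such that $\varphi (u) = \varphi (u^H) = c$, $\varphi' (u) = \varphi' (u^H) = 0$ and \[ \liminf_{n \to \infty} \operatorname{dist}_{H^1} (u, \gamma_n([0, 1]) ) = 0 . \]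
   Context: Functions are real-valued. $H^1_0(\Omega)$ is the usual Sobolev space with the $H^1$-norm, $H^{-1}(\Omega)$ is its dual, and $\operatorname{dist}_{H^1}(u,A)=\inf_{x\in A}\|u-x\|_{H^1}$. Palais–Smale condition: if $(u_n)_{n \in \mathbb{N}}$ is a sequence in $H^1_0(\Omega)$ such that $(\varphi(u_n))_{n \in \mathbb{N}}$ converges (in $\mathbb{R}$) and $\varphi'(u_n) \to 0$ in $H^{-1}(\Omega)$ as $n \to \infty$, then $(u_n)_{n \in \mathbb{N}}$ has a subsequence converging in $H^1_0(\Omega)$. Polarization: for a closed half-space $H\subset\mathbb{R}^N$, $\sigma_H$ denotes the reflection of $\mathbb{R}^N$ with respect to the hyperplane $\partial H$. If $\sigma_H(\Omega)=\Omega$, the polarization $u^H:\Omega\to\mathbb{R}$ of $u:\Omega\to\mathbb{R}$ is defined by \[ u^H = \begin{cases} \max \{u, u \circ \sigma_H\} & \text{on } \Omega\cap H,\\ \min \{u, u \circ \sigma_H\} & \text{on } \Omega \setminus H. \end{cases} \] The map $u\mapsto u^H$ sends $H^1_0(\Omega)$ to itself. *)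

theory Defs
  imports "HOL-Analysis.Analysis"
begin

section \<open>Test functions\<close>

definition partial_deriv :: "'n::finite \<Rightarrow> (real^'n \<Rightarrow> real) \<Rightarrow> real^'n \<Rightarrow> real" where
  "partial_deriv i f x = frechet_derivative f (at x) (axis i 1)"

primrec C_k :: "nat \<Rightarrow> (real^'n::finite \<Rightarrow> real) \<Rightarrow> bool" where
  "C_k 0 f \<longleftrightarrow> continuous_on UNIV f"
| "C_k (Suc k) f \<longleftrightarrow> (\<forall>x. f differentiable (at x)) \<and> (\<forall>i. C_k k (partial_deriv i f))"

text \<open>Elements of \<open>C\<^sub>c\<^sup>\<infinity>(\<Omega>)\<close> are represented by their extension by zero to the whole space.\<close>

definition test_functions :: "(real^'n::finite) set \<Rightarrow> (real^'n \<Rightarrow> real) set" where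
  "test_functions \<Omega> = {\<eta>. (\<forall>k. C_k k \<eta>) \<and>
     compact (closure {x. \<eta> x \<noteq> 0}) \<and> closure {x. \<eta> x \<noteq> 0} \<subseteq> \<Omega>}"


section \<open>The Sobolev space and its dual\<close>

text \<open>
  A type cannot depend on the set \<open>\<Omega>\<close>, so Sobolev functions are represented by functions on the
  whole of \<open>\<real>\<^sup>N\<close> whose values outside \<open>\<Omega>\<close> are irrelevant, and two functions represent the same
  element when they agree almost everywhere on \<open>\<Omega>\<close>.  Accordingly \<open>h1_norm \<Omega>\<close> is a seminorm on
  representatives.  A functional that is continuous for it takes the same value on all
  representatives of one element.
\<close>

definition is_weak_gradient ::
  "(real^'n::finite) set \<Rightarrow> (real^'n \<Rightarrow> real) \<Rightarrow> (real^'n \<Rightarrow> real^'n) \<Rightarrow> bool" where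
  "is_weak_gradient \<Omega> u G \<longleftrightarrow>
     G \<in> borel_measurable (lebesgue_on \<Omega>) \<and>
     integrable (lebesgue_on \<Omega>) (\<lambda>x. (norm (G x))\<^sup>2) \<and>
     (\<forall>\<eta>\<in>test_functions \<Omega>. \<forall>i.
        (LINT x|lebesgue_on \<Omega>. u x * partial_deriv i \<eta> x) =
        - (LINT x|lebesgue_on \<Omega>. G x $ i * \<eta> x))"

definition h1_space :: "(real^'n::finite) set \<Rightarrow> (real^'n \<Rightarrow> real) set" where
  "h1_space \<Omega> = {u. u \<in> borel_measurable (lebesgue_on \<Omega>) \<and>
     integrable (lebesgue_on \<Omega>) (\<lambda>x. (u x)\<^sup>2) \<and> (\<exists>G. is_weak_gradient \<Omega> u G)}"

text \<open>The weak gradient is unique up to a null set.\<close>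

definition weak_gradient ::
  "(real^'n::finite) set \<Rightarrow> (real^'n \<Rightarrow> real) \<Rightarrow> real^'n \<Rightarrow> real^'n" where
  "weak_gradient \<Omega> u = (SOME G. is_weak_gradient \<Omega> u G)"

definition h1_norm :: "(real^'n::finite) set \<Rightarrow> (real^'n \<Rightarrow> real) \<Rightarrow> real" where
  "h1_norm \<Omega> u = sqrt ((LINT x|lebesgue_on \<Omega>. (u x)\<^sup>2) +
                       (LINT x|lebesgue_on \<Omega>. (norm (weak_gradient \<Omega> u x))\<^sup>2))"

definition h10_space :: "(real^'n::finite) set \<Rightarrow> (real^'n \<Rightarrow> real) set" where
  "h10_space \<Omega> = {u \<in> h1_space \<Omega>.
     \<exists>\<eta> :: nat \<Rightarrow> real^'n \<Rightarrow> real. (\<forall>k. \<eta> k \<in> test_functions \<Omega>) \<and>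
       (\<lambda>k. h1_norm \<Omega> (u - \<eta> k)) \<longlonglongrightarrow> 0}"

definition h1_dist_set ::
  "(real^'n::finite) set \<Rightarrow> (real^'n \<Rightarrow> real) \<Rightarrow> (real^'n \<Rightarrow> real) set \<Rightarrow> real" where
  "h1_dist_set \<Omega> u A = (INF x\<in>A. h1_norm \<Omega> (u - x))"

definition hm1_space :: "(real^'n::finite) set \<Rightarrow> ((real^'n \<Rightarrow> real) \<Rightarrow> real) set" where
  "hm1_space \<Omega> = {L.
     (\<forall>u\<in>h10_space \<Omega>. \<forall>v\<in>h10_space \<Omega>. \<forall>a b.
        L (\<lambda>x. a * u x + b * v x) = a * L u + b * L v) \<and>
     (\<exists>C. \<forall>u\<in>h10_space \<Omega>. \<bar>L u\<bar> \<le> C * h1_norm \<Omega> u)}"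

definition hm1_norm :: "(real^'n::finite) set \<Rightarrow> ((real^'n \<Rightarrow> real) \<Rightarrow> real) \<Rightarrow> real" where
  "hm1_norm \<Omega> L = (SUP h\<in>{h \<in> h10_space \<Omega>. h1_norm \<Omega> h \<le> 1}. \<bar>L h\<bar>)"


section \<open>Functionals on the Sobolev space\<close>

definition has_h10_derivative ::
  "(real^'n::finite) set \<Rightarrow> ((real^'n \<Rightarrow> real) \<Rightarrow> real) \<Rightarrow> ((real^'n \<Rightarrow> real) \<Rightarrow> real) \<Rightarrow>
   (real^'n \<Rightarrow> real) \<Rightarrow> bool" where
  "has_h10_derivative \<Omega> \<phi> L u \<longleftrightarrow> L \<in> hm1_space \<Omega> \<and>
     (\<forall>\<epsilon>>0. \<exists>\<delta>>0. \<forall>v\<in>h10_space \<Omega>. h1_norm \<Omega> (v - u) < \<delta> \<longrightarrow>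
        \<bar>\<phi> v - \<phi> u - L (v - u)\<bar> \<le> \<epsilon> * h1_norm \<Omega> (v - u))"

text \<open>\<open>\<phi>\<close> is continuously (Frechet) differentiable on \<open>H\<^sup>1\<^sub>0(\<Omega>)\<close> with derivative \<open>\<phi>'\<close>, which is
  determined by \<open>\<phi>\<close> on \<open>H\<^sup>1\<^sub>0(\<Omega>)\<close>.\<close>

definition C1_on_h10 ::
  "(real^'n::finite) set \<Rightarrow> ((real^'n \<Rightarrow> real) \<Rightarrow> real) \<Rightarrow>
   ((real^'n \<Rightarrow> real) \<Rightarrow> (real^'n \<Rightarrow> real) \<Rightarrow> real) \<Rightarrow> bool" where
  "C1_on_h10 \<Omega> \<phi> \<phi>' \<longleftrightarrow>
     (\<forall>u\<in>h10_space \<Omega>. has_h10_derivative \<Omega> \<phi> (\<phi>' u) u) \<and>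
     (\<forall>u\<in>h10_space \<Omega>. \<forall>\<epsilon>>0. \<exists>\<delta>>0. \<forall>v\<in>h10_space \<Omega>.
        h1_norm \<Omega> (v - u) < \<delta> \<longrightarrow> hm1_norm \<Omega> (\<phi>' v - \<phi>' u) < \<epsilon>)"

definition palais_smale ::
  "(real^'n::finite) set \<Rightarrow> ((real^'n \<Rightarrow> real) \<Rightarrow> real) \<Rightarrow>
   ((real^'n \<Rightarrow> real) \<Rightarrow> (real^'n \<Rightarrow> real) \<Rightarrow> real) \<Rightarrow> bool" where
  "palais_smale \<Omega> \<phi> \<phi>' \<longleftrightarrow>
     (\<forall>u :: nat \<Rightarrow> real^'n \<Rightarrow> real.
        (\<forall>n. u n \<in> h10_space \<Omega>) \<and> convergent (\<lambda>n. \<phi> (u n)) \<and>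
        (\<lambda>n. hm1_norm \<Omega> (\<phi>' (u n))) \<longlonglongrightarrow> 0 \<longrightarrow>
        (\<exists>r v. strict_mono r \<and> v \<in> h10_space \<Omega> \<and>
           (\<lambda>n. h1_norm \<Omega> (u (r n) - v)) \<longlonglongrightarrow> 0))"

text \<open>Strictness is required for \<open>h1_norm \<Omega> v > 0\<close>, that is, for \<open>v\<close> not almost everywhere zero.\<close>

definition strict_local_min_at_0 ::
  "(real^'n::finite) set \<Rightarrow> ((real^'n \<Rightarrow> real) \<Rightarrow> real) \<Rightarrow> bool" where
  "strict_local_min_at_0 \<Omega> \<phi> \<longleftrightarrow>
     (\<exists>r>0. \<forall>v\<in>h10_space \<Omega>. 0 < h1_norm \<Omega> v \<and> h1_norm \<Omega> v < r \<longrightarrow> \<phi> (\<lambda>_. 0) < \<phi> v)"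

definition global_min_at_0 ::
  "(real^'n::finite) set \<Rightarrow> ((real^'n \<Rightarrow> real) \<Rightarrow> real) \<Rightarrow> bool" where
  "global_min_at_0 \<Omega> \<phi> \<longleftrightarrow> (\<forall>v\<in>h10_space \<Omega>. \<phi> (\<lambda>_. 0) \<le> \<phi> v)"


section \<open>Mountain pass level\<close>

text \<open>Paths are functions on \<open>\<real>\<close> of which only the restriction to \<open>[0,1]\<close> matters.\<close>

definition mp_paths ::
  "(real^'n::finite) set \<Rightarrow> ((real^'n \<Rightarrow> real) \<Rightarrow> real) \<Rightarrow> (real \<Rightarrow> real^'n \<Rightarrow> real) set" where
  "mp_paths \<Omega> \<phi> = {\<gamma>. (\<forall>t\<in>{0..1}. \<gamma> t \<in> h10_space \<Omega>) \<and>
     (\<forall>t\<in>{0..1}. ((\<lambda>s. h1_norm \<Omega> (\<gamma> s - \<gamma> t)) \<longlongrightarrow> 0) (at t within {0..1})) \<and>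
     (AE x in lebesgue_on \<Omega>. \<gamma> 0 x = 0) \<and> \<phi> (\<gamma> 1) < 0}"

text \<open>For continuous \<open>\<phi>\<close> the suprema are over nonempty bounded sets and are bounded below by
  \<open>\<phi> 0\<close>, so the real-valued level is the usual one as soon as \<open>mp_paths \<Omega> \<phi>\<close> is nonempty.\<close>

definition mp_level :: "(real^'n::finite) set \<Rightarrow> ((real^'n \<Rightarrow> real) \<Rightarrow> real) \<Rightarrow> real" where
  "mp_level \<Omega> \<phi> = (INF \<gamma>\<in>mp_paths \<Omega> \<phi>. SUP t\<in>{0..1}. \<phi> (\<gamma> t))"


section \<open>Polarization\<close>

definition closed_half_space :: "(real^'n::finite) set \<Rightarrow> bool" where
  "closed_half_space H \<longleftrightarrow> (\<exists>a b. a \<noteq> 0 \<and> H = {x. a \<bullet> x \<le> b})"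

text \<open>\<open>closest_point (frontier H)\<close> is the orthogonal projection onto the bounding hyperplane.\<close>

definition reflect :: "(real^'n::finite) set \<Rightarrow> real^'n \<Rightarrow> real^'n" where
  "reflect H x = 2 *\<^sub>R closest_point (frontier H) x - x"

lemma reflect_half_space:
  fixes a :: "real^'n::finite"
  assumes "a \<noteq> 0"
  shows "reflect {x. a \<bullet> x \<le> b} x = x - (2 * ((a \<bullet> x - b) / (a \<bullet> a))) *\<^sub>R a"
proof -
  define k where "k = (a \<bullet> x - b) / (a \<bullet> a)"
  define p where "p = x - k *\<^sub>R a"
  have "k * (a \<bullet> a) = a \<bullet> x - b"
    using assms unfolding k_def by (metis inner_eq_zero_iff nonzero_eq_divide_eq)
  then have p: "a \<bullet> p = b"
    unfolding p_def by (simp only: inner_diff_right inner_scaleR_right)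
  have "dist x p \<le> dist x z" if z: "a \<bullet> z = b" for z
  proof -
    have "(x - p) \<bullet> (p - z) = k * (a \<bullet> p - a \<bullet> z)"
      by (simp only: p_def diff_diff_eq2 add_diff_cancel_left' inner_scaleR_left inner_diff_right
          right_diff_distrib)
    then have "orthogonal (x - p) (p - z)"
      using p z by (simp add: orthogonal_def)
    then have "(norm ((x - p) + (p - z)))\<^sup>2 = (norm (x - p))\<^sup>2 + (norm (p - z))\<^sup>2"
      by (rule norm_add_Pythagorean)
    then have "(norm (x - z))\<^sup>2 = (norm (x - p))\<^sup>2 + (norm (p - z))\<^sup>2"
      by simp
    then have "(norm (x - p))\<^sup>2 \<le> (norm (x - z))\<^sup>2"
      by simp
    then show ?thesis
      unfolding dist_norm by (rule power2_le_imp_le) simp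
  qed
  then have "p = closest_point {x. a \<bullet> x = b} x"
    using p by (intro closest_point_unique) (auto simp: convex_hyperplane closed_hyperplane)
  then have "reflect {x. a \<bullet> x \<le> b} x = 2 *\<^sub>R p - x"
    using assms by (simp only: reflect_def frontier_halfspace_le simp_thms)
  also have "\<dots> = x - (2 * k) *\<^sub>R a"
    by (simp only: p_def scaleR_diff_right scaleR_scaleR) (simp add: scaleR_2)
  finally show ?thesis
    unfolding k_def .
qed

text \<open>When \<open>\<Omega>\<close> is invariant under the reflection, the values on \<open>\<Omega>\<close> depend only on the values
  of \<open>u\<close> on \<open>\<Omega>\<close>.\<close>

definition polarization ::
  "(real^'n::finite) set \<Rightarrow> (real^'n \<Rightarrow> real) \<Rightarrow> real^'n \<Rightarrow> real" where
  "polarization H u x =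
     (if x \<in> H then max (u x) (u (reflect H x)) else min (u x) (u (reflect H x)))"

end

(*
If c = phi 0, the point u = 0 does the job, so let c > phi 0. A path whose maximum is at most c + e^2
is deformed, by a perturbation of uniform size 2e, into one along which phi is nowhere larger and at
every parameter t either phi has dropped to c - e^2 or the original point lies within 3e of an almost
critical point at a level e^2-close to c. The deformed path comes from Ekeland's principle on the
space of paths that lie below the original one, applied to the supremum of phi over the other
parameters t: at an almost minimizer, a descent direction assembled from hat functions would lower
this supremum too fast. No flow is needed.

Deform gamma_n, polarize the result, and deform again. The last path must exceed c - e^2 at some t.
As polarization does not increase phi, the deformed gamma_n exceeds c - e^2 at the same t, so both
gamma_n(t) and the polarized point are close to almost critical points. The Palais-Smale condition
yields a limit u, and continuity of the polarization identifies the second limit as the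
polarization of u.

Continuity of the polarization in H^1_0: with w = u - u o sigma, the polarization of u is
(u + u o sigma + S |w|) / 2 where S = 1 on H and S = -1 off H. The jump of S is harmless because w
vanishes on the hyperplane: S f(w) is a test function whenever w is an odd test function and f is
smooth and vanishes near 0. Passing to the limit gives the gradient S sgn(w) grad w, which depends
continuously on w since grad w = 0 almost everywhere on {w = 0}.
*)

theory Submission
  imports Defs "HOL-Library.Function_Algebras"
begin

section \<open>Deformation of paths in a seminormed space\<close>

text \<open>The continuity of the polarization is proved by dominated convergence along subsequences
  and comes without a modulus, so no estimate at a fixed \<open>e\<close> can be carried across it.
  Hence the deformed point on each path is recorded together with the two almost critical points,
  and continuity is used only at the limit \<open>u\<close>. Both deformations have to act pointwise
  in \<open>t\<close>: a high value of the last path at \<open>t\<close> forces high values of all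
  earlier paths at the same \<open>t\<close>. This is why the competitors in Ekeland's principle are
  confined to paths lying below the given one. Levels are measured in \<open>e\<^sup>2\<close> and
  distances in \<open>e\<close> because the gap \<open>2 * e\<^sup>2\<close> divided by the weight
  \<open>e\<close> is the displacement \<open>2 * e\<close>. The radius \<open>3 * e\<close> exceeds
  it, so that a point of the deformed path may itself serve as the almost critical point. Since
  functions only represent elements of H^1_0, the first part works with a seminorm: limits are
  determined only up to seminorm zero, and \<open>\<phi>\<close> is shown not to notice.\<close>

lemma ekeland_variational_principle:
  fixes d :: "'a \<Rightarrow> 'a \<Rightarrow> real" and F :: "'a \<Rightarrow> real"
  assumes x0: "x0 \<in> X" and e: "e > 0"
    and d_nonneg: "\<And>x y. x \<in> X \<Longrightarrow> y \<in> X \<Longrightarrow> 0 \<le> d x y"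
    and d_refl: "\<And>x. x \<in> X \<Longrightarrow> d x x = 0"
    and d_tri: "\<And>x y z. x \<in> X \<Longrightarrow> y \<in> X \<Longrightarrow> z \<in> X \<Longrightarrow> d x z \<le> d x y + d y z"
    and complete: "\<And>s. (\<And>n. s n \<in> X) \<Longrightarrow>
        (\<And>r. r > 0 \<Longrightarrow> \<exists>N. \<forall>m\<ge>N. \<forall>n\<ge>m. d (s m) (s n) < r) \<Longrightarrow>
        \<exists>l\<in>X. (\<lambda>n. d (s n) l) \<longlonglongrightarrow> 0"
    and lsc: "\<And>s l a. (\<And>n. s n \<in> X) \<Longrightarrow> l \<in> X \<Longrightarrow> (\<lambda>n. d (s n) l) \<longlonglongrightarrow> 0 \<Longrightarrow>
        (\<And>n. F (s n) \<le> a) \<Longrightarrow> F l \<le> a"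
    and bdd: "\<And>x. x \<in> X \<Longrightarrow> b \<le> F x"
  shows "\<exists>x\<in>X. F x + e * d x0 x \<le> F x0 \<and> (\<forall>y\<in>X. F x \<le> F y + e * d x y)"
proof -
  \<comment> \<open>\<open>S x\<close> collects the points that improve \<open>F\<close> by at least
    \<open>e\<close> per unit of distance from \<open>x\<close>. These sets shrink along the
    iteration, in which \<open>s (Suc n)\<close> nearly minimizes \<open>F\<close> on
    \<open>S (s n)\<close>. The limit belongs to all of them, and so does any \<open>y\<close> that
    would contradict its minimality.\<close>
  define S where "S x = {y\<in>X. F y + e * d x y \<le> F x}" for x
  have S_refl: "x \<in> S x" if "x \<in> X" for x using that d_refl by (simp add: S_def)
  have bddS: "bdd_below (F ` S x)" for x by (rule bdd_belowI2[of _ b]) (auto simp: S_def bdd)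
  have step: "\<exists>y. y \<in> S x \<and> F y \<le> (INF z\<in>S x. F z) + (1/2)^n" if "x \<in> X" for x and n :: nat
  proof -
    have "S x \<noteq> {}" using S_refl[OF that] by auto
    moreover have "(INF z\<in>S x. F z) < (INF z\<in>S x. F z) + (1/2)^n" by simp
    ultimately obtain y where "y \<in> S x" "F y < (INF z\<in>S x. F z) + (1/2)^n"
      using cINF_less_iff[OF _ bddS, of x] by blast
    then show ?thesis by (auto intro: less_imp_le)
  qed
  have "\<exists>s. \<forall>n. (s n \<in> X \<and> (n = 0 \<longrightarrow> s n = x0)) \<and>
      (s (Suc n) \<in> S (s n) \<and> F (s (Suc n)) \<le> (INF z\<in>S (s n). F z) + (1/2)^n)"
    by (rule dependent_nat_choice[where P="\<lambda>n x. x \<in> X \<and> (n = 0 \<longrightarrow> x = x0)"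
        and Q="\<lambda>n x y. y \<in> S x \<and> F y \<le> (INF z\<in>S x. F z) + (1/2)^n"])
      (use x0 step in \<open>auto simp: S_def\<close>)
  then obtain s where sX: "\<And>n. s n \<in> X" and s0: "s 0 = x0"
    and sS: "\<And>n. s (Suc n) \<in> S (s n)"
    and sF: "\<And>n. F (s (Suc n)) \<le> (INF z\<in>S (s n). F z) + (1/2)^n" by blast
  have S_trans: "z \<in> S x" if "y \<in> S x" "z \<in> S y" "x \<in> X" for x y z
  proof -
    have "e * d x z \<le> e * d x y + e * d y z"
      using d_tri[of x y z] that e by (simp add: S_def flip: distrib_left)
    with that show ?thesis by (auto simp: S_def)
  qed
  have chain: "s n \<in> S (s m)" if "m \<le> n" for m n
    using that by (induction n rule: dec_induct) (auto intro: S_refl sX S_trans sS)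
  have dle: "e * d (s m) (s n) \<le> F (s m) - F (s n)" if "m \<le> n" for m n
    using chain[OF that] by (simp add: S_def)
  have "decseq (\<lambda>n. F (s n))"
    unfolding decseq_def
  proof (intro allI impI)
    fix m n :: nat assume "m \<le> n"
    with dle[OF this] d_nonneg[OF sX sX, of m n] e show "F (s n) \<le> F (s m)"
      by (smt (verit) mult_nonneg_nonneg)
  qed
  then obtain L where L: "(\<lambda>n. F (s n)) \<longlonglongrightarrow> L" "\<And>n. L \<le> F (s n)"
    using decseq_convergent[of "\<lambda>n. F (s n)" b] bdd sX by auto
  have "\<exists>N. \<forall>m\<ge>N. \<forall>n\<ge>m. d (s m) (s n) < r" if "r > 0" for r
  proof -
    have "\<forall>\<^sub>F n in sequentially. F (s n) < L + e * r"
      using L(1) that e by (intro order_tendstoD(2)[of _ L]) auto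
    then obtain N where N: "\<And>n. n \<ge> N \<Longrightarrow> F (s n) < L + e * r"
      by (auto simp: eventually_sequentially)
    have "d (s m) (s n) < r" if "m \<ge> N" "n \<ge> m" for m n
    proof -
      have "e * d (s m) (s n) < e * r" using dle[OF that(2)] N[OF that(1)] L(2)[of n] by linarith
      then show ?thesis using e by simp
    qed
    then show ?thesis by blast
  qed
  from complete[of s, OF sX this] obtain l where l: "l \<in> X" "(\<lambda>n. d (s n) l) \<longlonglongrightarrow> 0"
    by blast
  have lS: "l \<in> S (s m)" for m
  proof -
    have dm: "F (s n) \<le> F (s m) - e * (d (s m) l - d (s n) l)" if "n \<ge> m" for n
    proof -
      have "e * d (s m) l \<le> e * d (s m) (s n) + e * d (s n) l"
        using d_tri[of "s m" "s n" l] sX l e by (simp flip: distrib_left)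
      then show ?thesis using dle[OF that] by (simp add: algebra_simps)
    qed
    \<comment> \<open>\<open>lsc\<close> asks for a bound that does not vary with \<open>n\<close>,
      whereas the one in \<open>dm\<close> contains \<open>d (s n) l\<close>. The slack
      \<open>r\<close> absorbs that term once it is below \<open>r / e\<close>.\<close>
    have "F l \<le> F (s m) - e * d (s m) l + r" if "r > 0" for r
    proof -
      have "\<forall>\<^sub>F n in sequentially. d (s n) l < r / e"
        using l(2) that e by (intro order_tendstoD(2)[of _ 0]) auto
      then obtain N where N: "\<And>n. n \<ge> N \<Longrightarrow> d (s n) l < r / e"
        by (auto simp: eventually_sequentially)
      show ?thesis
      proof (rule lsc[of "\<lambda>n. s (n + max N m)"])
        show "(\<lambda>n. d (s (n + max N m)) l) \<longlonglongrightarrow> 0" using l(2) by (rule LIMSEQ_ignore_initial_segment)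
        fix n
        have "e * d (s (n + max N m)) l < r"
          using N[of "n + max N m"] e by (simp add: field_simps)
        moreover have "F (s (n + max N m)) \<le> F (s m) - e * (d (s m) l - d (s (n + max N m)) l)"
          by (rule dm) simp
        ultimately show "F (s (n + max N m)) \<le> F (s m) - e * d (s m) l + r"
          by (simp add: algebra_simps)
      qed (use sX l in auto)
    qed
    then have "F l \<le> F (s m) - e * d (s m) l" by (rule field_le_epsilon)
    then show ?thesis using l by (simp add: S_def)
  qed
  \<comment> \<open>A violator \<open>y\<close> lies in every \<open>S (s n)\<close>, so
    \<open>F y\<close> is at least the infimum there, which \<open>s (Suc n)\<close> attains up to
    \<open>(1/2)^n\<close>. In the limit \<open>F l \<le> F y\<close>, against
    \<open>F y < F l\<close>.\<close>
  have "F l \<le> F y + e * d l y" if y: "y \<in> X" for y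
  proof (rule ccontr)
    assume "\<not> ?thesis"
    then have yl: "y \<in> S l" "F y < F l" using y e d_nonneg[OF l(1) y]
      by (auto simp: S_def) (smt (verit) mult_nonneg_nonneg)
    have "F l \<le> F y + (1/2)^n" for n
    proof -
      have "y \<in> S (s n)" using S_trans[OF lS yl(1)] sX by blast
      then have "(INF z\<in>S (s n). F z) \<le> F y" by (rule cINF_lower[OF bddS])
      moreover have "F l \<le> F (s (Suc n))"
        using lS[of "Suc n"] d_nonneg[OF sX l(1), of "Suc n"] e
        by (simp add: S_def) (smt (verit) mult_nonneg_nonneg)
      ultimately show ?thesis using sF[of n] by linarith
    qed
    moreover have "(\<lambda>n. F y + (1/2)^n) \<longlonglongrightarrow> F y + 0"
      by (intro tendsto_intros) simp
    ultimately have "F l \<le> F y" using LIMSEQ_le_const by fastforce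
    then show False using yl by simp
  qed
  moreover have "F l + e * d x0 l \<le> F x0" using lS[of 0] s0 by (simp add: S_def)
  ultimately show ?thesis using l by blast
qed

text \<open>Beyond the last node only the last hat can be nonzero, which is the auxiliary fact
  \<open>above\<close>; one further node adds exactly the missing amount \<open>x - m\<close>.
  Rescaled by \<open>m\<close>, these hats become a partition of unity on the unit interval.\<close>

lemma sum_hat_functions_eq_1:
  fixes x :: real
  assumes "0 \<le> x" "x \<le> real m"
  shows "(\<Sum>i\<le>m. max 0 (1 - \<bar>x - real i\<bar>)) = 1"
proof -
  have above: "(\<Sum>i\<le>m. max 0 (1 - \<bar>x - real i\<bar>)) = max 0 (1 - (x - real m))" if "real m \<le> x" for m
  proof -
    have "(\<Sum>i<m. max 0 (1 - \<bar>x - real i\<bar>)) = 0"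
    proof (rule sum.neutral, intro ballI)
      fix i assume "i \<in> {..<m}"
      then have "real i + 1 \<le> real m" by auto
      then show "max 0 (1 - \<bar>x - real i\<bar>) = 0" using that by simp
    qed
    then show ?thesis using that by (simp add: lessThan_Suc_atMost[symmetric])
  qed
  from assms show ?thesis
  proof (induction m)
    case 0 then show ?case by simp
  next
    case (Suc m)
    show ?case
    proof (cases "x \<le> real m")
      case True then show ?thesis using Suc by simp
    next
      case False
      then show ?thesis using above[of m] Suc by simp
    qed
  qed
qed

text \<open>Compactness in the style of a Lebesgue number. The local scale \<open>d\<close> also
  serves as the radius of the neighbourhood, so once a finite subcover is chosen, monotonicity of
  \<open>Q\<close> in the scale permits the passage to the minimum.\<close>

lemma uniform_on_unit_interval:
  fixes Q :: "real \<Rightarrow> real \<Rightarrow> bool"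
  assumes loc: "\<And>r. r \<in> {0..1} \<Longrightarrow> \<exists>d>0. \<forall>t\<in>{0..1}. \<bar>t - r\<bar> < d \<longrightarrow> Q d t"
    and anti: "\<And>d d' t. Q d t \<Longrightarrow> 0 < d' \<Longrightarrow> d' \<le> d \<Longrightarrow> Q d' t"
  shows "\<exists>d>0. \<forall>t\<in>{0..1}. Q d t"
proof -
  obtain D where D: "\<And>r. r \<in> {0..1} \<Longrightarrow> D r > 0 \<and> (\<forall>t\<in>{0..1}. \<bar>t - r\<bar> < D r \<longrightarrow> Q (D r) t)"
    using loc by metis
  have "compact {0..1::real}" by simp
  moreover have "{0..1::real} \<subseteq> (\<Union>r\<in>{0..1}. ball r (D r))" using D by fastforce
  ultimately obtain R where R: "R \<subseteq> {0..1}" "finite R" "{0..1} \<subseteq> (\<Union>r\<in>R. ball r (D r))"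
    by (metis (no_types, lifting) compactE_image open_ball)
  then have ne: "R \<noteq> {}" by auto
  define d where "d = Min (D ` R)"
  have "d > 0" using R ne D by (auto simp: d_def)
  moreover have "Q d t" if t: "t \<in> {0..1}" for t
  proof -
    obtain r where "r \<in> R" "\<bar>t - r\<bar> < D r" using R t by (force simp: dist_real_def)
    then show ?thesis
      using anti[of "D r" t d] D[of r] R t \<open>d > 0\<close> by (auto simp: d_def)
  qed
  ultimately show ?thesis by blast
qed

text \<open>The abstract form of H^1_0: the carrier type consists of all functions, \<open>V\<close>
  singles out the Sobolev functions, and \<open>p\<close> may vanish off zero because almost
  everywhere equal functions represent the same element. Limits are therefore asked to exist, not to
  be unique.\<close>

locale complete_seminormed_subspace = vector_space scale
  for scale :: "real \<Rightarrow> 'a::ab_group_add \<Rightarrow> 'a" (infixr "\<cdot>" 75) +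
  fixes V :: "'a set" and p :: "'a \<Rightarrow> real"
  assumes subspace: "subspace V"
    and p_add: "u \<in> V \<Longrightarrow> v \<in> V \<Longrightarrow> p (u + v) \<le> p u + p v"
    and p_scale: "u \<in> V \<Longrightarrow> p (a \<cdot> u) = \<bar>a\<bar> * p u"
    and complete: "(\<And>n. s n \<in> V) \<Longrightarrow>
        (\<And>r. r > 0 \<Longrightarrow> \<exists>N. \<forall>m\<ge>N. \<forall>n\<ge>m. p (s m - s n) < r) \<Longrightarrow>
        \<exists>l\<in>V. (\<lambda>n. p (s n - l)) \<longlonglongrightarrow> 0"
begin

lemma V_0 [simp]: "0 \<in> V"
  and V_add [intro, simp]: "u \<in> V \<Longrightarrow> v \<in> V \<Longrightarrow> u + v \<in> V"
  and V_diff [intro, simp]: "u \<in> V \<Longrightarrow> v \<in> V \<Longrightarrow> u - v \<in> V"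
  and V_scale [intro, simp]: "u \<in> V \<Longrightarrow> a \<cdot> u \<in> V"
  and V_sum: "(\<And>i. i \<in> I \<Longrightarrow> f i \<in> V) \<Longrightarrow> (\<Sum>i\<in>I. f i) \<in> V"
  using subspace by (auto simp: subspace_0 subspace_add subspace_diff subspace_scale subspace_sum)

lemma p_0 [simp]: "p 0 = 0"
  using p_scale[of 0 0] by simp

lemma p_minus: "u \<in> V \<Longrightarrow> p (- u) = p u"
  using p_scale[of u "-1"] by simp

lemma p_diff_commute: "u \<in> V \<Longrightarrow> v \<in> V \<Longrightarrow> p (u - v) = p (v - u)"
  using p_minus[of "u - v"] by simp

lemma p_nonneg [simp]: "u \<in> V \<Longrightarrow> 0 \<le> p u"
  using p_add[of u "- u"] p_minus[of u] V_scale[of u "-1"] by simp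

lemma p_diff_triangle: "u \<in> V \<Longrightarrow> v \<in> V \<Longrightarrow> w \<in> V \<Longrightarrow> p (u - w) \<le> p (u - v) + p (v - w)"
  using p_add[of "u - v" "v - w"] by simp

lemma p_sum: "finite I \<Longrightarrow> (\<And>i. i \<in> I \<Longrightarrow> f i \<in> V) \<Longrightarrow> p (\<Sum>i\<in>I. f i) \<le> (\<Sum>i\<in>I. p (f i))"
proof (induction I rule: finite_induct)
  case (insert i I)
  then show ?case using p_add[of "f i" "\<Sum>i\<in>I. f i"] V_sum[of I f] by auto
qed simp

lemma p_limit_triangle:
  assumes "(\<lambda>x. p (f x - u)) \<longlonglongrightarrow> 0" "\<And>n. f n \<in> V" "u \<in> V" "w \<in> V" "\<And>n. p (f n - w) \<le> r"
  shows "p (u - w) \<le> r"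
proof (rule LIMSEQ_le_const)
  show "(\<lambda>n. p (f n - u) + r) \<longlonglongrightarrow> r" using tendsto_add[OF assms(1) tendsto_const, of r] by simp
  have "p (u - w) \<le> p (f n - u) + r" for n
    using p_diff_triangle[of u "f n" w] p_diff_commute[of u "f n"] assms by (smt (verit))
  then show "\<exists>N. \<forall>n\<ge>N. p (u - w) \<le> p (f n - u) + r" by blast
qed

section \<open>Paths and their uniform distance\<close>

definition path_in :: "(real \<Rightarrow> 'a) \<Rightarrow> bool" where
  "path_in \<gamma> \<longleftrightarrow> (\<forall>t\<in>{0..1}. \<gamma> t \<in> V) \<and>
     (\<forall>t\<in>{0..1}. ((\<lambda>s. p (\<gamma> s - \<gamma> t)) \<longlongrightarrow> 0) (at t within {0..1}))"

lemma path_in_V: "path_in \<gamma> \<Longrightarrow> t \<in> {0..1} \<Longrightarrow> \<gamma> t \<in> V"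
  by (simp add: path_in_def)

lemma path_in_iff:
  "path_in \<gamma> \<longleftrightarrow> (\<forall>t\<in>{0..1}. \<gamma> t \<in> V) \<and>
     (\<forall>t\<in>{0..1}. \<forall>e>0. \<exists>d>0. \<forall>s\<in>{0..1}. \<bar>s - t\<bar> < d \<longrightarrow> p (\<gamma> s - \<gamma> t) < e)"
proof -
  have "((\<lambda>s. p (\<gamma> s - \<gamma> t)) \<longlongrightarrow> 0) (at t within {0..1}) \<longleftrightarrow>
      (\<forall>e>0. \<exists>d>0. \<forall>s\<in>{0..1}. \<bar>s - t\<bar> < d \<longrightarrow> p (\<gamma> s - \<gamma> t) < e)"
    if V: "\<forall>t\<in>{0..1}. \<gamma> t \<in> V" and t: "t \<in> {0..1}" for t
  proof -
    have "(s \<noteq> t \<and> dist s t < d \<longrightarrow> dist (p (\<gamma> s - \<gamma> t)) 0 < e) \<longleftrightarrow>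
        (\<bar>s - t\<bar> < d \<longrightarrow> p (\<gamma> s - \<gamma> t) < e)" if "s \<in> {0..1}" "e > 0" for s d e
      using V t that by (cases "s = t") (auto simp: dist_real_def)
    then show ?thesis unfolding tendsto_iff eventually_at
      by (intro all_cong1 imp_cong[OF refl] ex_cong1 conj_cong[OF refl] ball_cong[OF refl]) blast
  qed
  then show ?thesis unfolding path_in_def by blast
qed

lemma path_in_p_diff_continuous:
  assumes "path_in \<beta>" "path_in \<gamma>"
  shows "continuous_on {0..1} (\<lambda>t. p (\<beta> t - \<gamma> t))"
  unfolding continuous_on_def
proof
  fix t :: real assume t: "t \<in> {0..1}"
  show "((\<lambda>s. p (\<beta> s - \<gamma> s)) \<longlongrightarrow> p (\<beta> t - \<gamma> t)) (at t within {0..1})"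
  proof (rule LIM_zero_cancel)
    show "((\<lambda>s. p (\<beta> s - \<gamma> s) - p (\<beta> t - \<gamma> t)) \<longlongrightarrow> 0) (at t within {0..1})"
    proof (rule Lim_null_comparison)
      show "((\<lambda>s. p (\<beta> s - \<beta> t) + p (\<gamma> s - \<gamma> t)) \<longlongrightarrow> 0) (at t within {0..1})"
        using assms t by (intro tendsto_add_zero) (auto simp: path_in_def)
      show "\<forall>\<^sub>F s in at t within {0..1}. norm (p (\<beta> s - \<gamma> s) - p (\<beta> t - \<gamma> t))
          \<le> p (\<beta> s - \<beta> t) + p (\<gamma> s - \<gamma> t)"
        unfolding eventually_at_filter
      proof (intro always_eventually allI impI)
        fix s assume s: "s \<in> {0..1::real}"
        have [simp]: "\<beta> s \<in> V" "\<gamma> s \<in> V" "\<beta> t \<in> V" "\<gamma> t \<in> V" using assms s t by (auto intro: path_in_V)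
        have "p (\<beta> s - \<gamma> s) \<le> p (\<beta> s - \<beta> t) + p (\<beta> t - \<gamma> t) + p (\<gamma> s - \<gamma> t)"
          using p_diff_triangle[of "\<beta> s" "\<beta> t" "\<gamma> s"] p_diff_triangle[of "\<beta> t" "\<gamma> t" "\<gamma> s"]
            p_diff_commute[of "\<gamma> s" "\<gamma> t"] by simp
        moreover have "p (\<beta> t - \<gamma> t) \<le> p (\<beta> s - \<beta> t) + p (\<beta> s - \<gamma> s) + p (\<gamma> s - \<gamma> t)"
          using p_diff_triangle[of "\<beta> t" "\<beta> s" "\<gamma> t"] p_diff_triangle[of "\<beta> s" "\<gamma> s" "\<gamma> t"]
            p_diff_commute[of "\<beta> s" "\<beta> t"] by simp
        ultimately show "norm (p (\<beta> s - \<gamma> s) - p (\<beta> t - \<gamma> t)) \<le> p (\<beta> s - \<beta> t) + p (\<gamma> s - \<gamma> t)"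
          by simp
      qed
    qed
  qed
qed

definition path_dist :: "(real \<Rightarrow> 'a) \<Rightarrow> (real \<Rightarrow> 'a) \<Rightarrow> real" where
  "path_dist \<beta> \<gamma> = (SUP t\<in>{0..1}. p (\<beta> t - \<gamma> t))"

lemma path_dist_upper:
  assumes "path_in \<beta>" "path_in \<gamma>" "t \<in> {0..1}"
  shows "p (\<beta> t - \<gamma> t) \<le> path_dist \<beta> \<gamma>"
proof -
  have "compact ((\<lambda>t. p (\<beta> t - \<gamma> t)) ` {0..1})"
    using path_in_p_diff_continuous[OF assms(1,2)] by (intro compact_continuous_image) auto
  then show ?thesis unfolding path_dist_def
    by (intro cSUP_upper assms(3)) (rule bounded_imp_bdd_above[OF compact_imp_bounded])
qed

lemma path_dist_le:
  assumes "\<And>t. t \<in> {0..1} \<Longrightarrow> p (\<beta> t - \<gamma> t) \<le> r"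
  shows "path_dist \<beta> \<gamma> \<le> r"
  unfolding path_dist_def by (rule cSUP_least) (use assms in auto)

lemma path_dist_nonneg: "path_in \<beta> \<Longrightarrow> path_in \<gamma> \<Longrightarrow> 0 \<le> path_dist \<beta> \<gamma>"
  by (rule order_trans[OF p_nonneg path_dist_upper[of \<beta> \<gamma> 0]])
    (auto intro!: V_diff path_in_V[of \<beta>] path_in_V[of \<gamma>])

lemma path_dist_refl: "path_dist \<beta> \<beta> = 0"
  by (simp add: path_dist_def)

lemma path_dist_triangle:
  assumes "path_in \<alpha>" "path_in \<beta>" "path_in \<gamma>"
  shows "path_dist \<alpha> \<gamma> \<le> path_dist \<alpha> \<beta> + path_dist \<beta> \<gamma>"
proof (rule path_dist_le)
  fix t :: real assume t: "t \<in> {0..1}"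
  show "p (\<alpha> t - \<gamma> t) \<le> path_dist \<alpha> \<beta> + path_dist \<beta> \<gamma>"
    using p_diff_triangle[of "\<alpha> t" "\<beta> t" "\<gamma> t"] path_dist_upper[OF assms(1,2) t]
      path_dist_upper[OF assms(2,3) t] assms[THEN path_in_V, OF t] by linarith
qed

text \<open>The pointwise limits \<open>l t\<close> are chosen freely modulo seminorm zero. This
  cannot spoil continuity: the uniform Cauchy estimate passes to the limit, and a three-term
  estimate through one fixed \<open>s N\<close> controls \<open>l\<close>.\<close>

lemma path_dist_complete:
  assumes path: "\<And>n. path_in (s n)"
    and Cauchy: "\<And>r. r > 0 \<Longrightarrow> \<exists>N. \<forall>m\<ge>N. \<forall>n\<ge>m. path_dist (s m) (s n) < r"
  shows "\<exists>l. path_in l \<and> (\<lambda>n. path_dist (s n) l) \<longlonglongrightarrow> 0"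
proof -
  note V = path_in_V[OF path]
  have "\<exists>l\<in>V. (\<lambda>n. p (s n t - l)) \<longlonglongrightarrow> 0" if t: "t \<in> {0..1}" for t
  proof (rule complete)
    show "\<exists>N. \<forall>m\<ge>N. \<forall>n\<ge>m. p (s m t - s n t) < r" if "r > 0" for r
      using Cauchy[OF that] path_dist_upper[OF path path t] by (meson order_le_less_trans)
  qed (rule V[OF t])
  then obtain l where l: "\<And>t. t \<in> {0..1} \<Longrightarrow> l t \<in> V"
    "\<And>t. t \<in> {0..1} \<Longrightarrow> (\<lambda>n. p (s n t - l t)) \<longlonglongrightarrow> 0" by metis
  have unif: "\<exists>N. \<forall>n\<ge>N. \<forall>t\<in>{0..1}. p (s n t - l t) \<le> r" if r: "r > 0" for r
  proof -
    obtain N where N: "\<And>m n. m \<ge> N \<Longrightarrow> n \<ge> m \<Longrightarrow> path_dist (s m) (s n) < r"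
      using Cauchy[OF r] by blast
    have "p (s m t - l t) \<le> r" if m: "m \<ge> N" and t: "t \<in> {0..1}" for m t
    proof -
      have "p (l t - s m t) \<le> r"
      proof (rule p_limit_triangle)
        show "(\<lambda>n. p (s (n + m) t - l t)) \<longlonglongrightarrow> 0"
          using l(2)[OF t] by (rule LIMSEQ_ignore_initial_segment)
        fix n show "p (s (n + m) t - s m t) \<le> r"
          using N[OF m, of "n + m"] path_dist_upper[OF path path t, of m "n + m"]
            p_diff_commute[OF V V, OF t t, of m "n + m"] by simp
      qed (use V l t in auto)
      then show ?thesis using p_diff_commute[OF V l(1), OF t t] by simp
    qed
    then show ?thesis by blast
  qed
  have "path_in l"
    unfolding path_in_iff
  proof (intro conjI ballI allI impI)
    fix t e :: real assume t: "t \<in> {0..1}" and e: "e > 0"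
    have "e / 4 > 0" using e by simp
    then obtain N where N: "\<And>t. t \<in> {0..1} \<Longrightarrow> p (s N t - l t) \<le> e / 4" using unif by blast
    obtain d where d: "d > 0" "\<And>r. r \<in> {0..1} \<Longrightarrow> \<bar>r - t\<bar> < d \<Longrightarrow> p (s N r - s N t) < e / 4"
      using path[of N] t e unfolding path_in_iff by (metis zero_less_divide_iff zero_less_numeral)
    have "p (l r - l t) < e" if r: "r \<in> {0..1}" "\<bar>r - t\<bar> < d" for r
    proof -
      note [simp] = l(1)[OF t] l(1)[OF r(1)] V[OF t] V[OF r(1)]
      have "p (l r - l t) \<le> p (s N r - l r) + p (s N r - l t)"
        using p_diff_triangle[of "l r" "s N r" "l t"] p_diff_commute[of "l r" "s N r"] by simp
      also have "p (s N r - l t) \<le> p (s N r - s N t) + p (s N t - l t)"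
        by (rule p_diff_triangle) auto
      finally show ?thesis using N[OF t] N[OF r(1)] d(2)[OF r] e by simp
    qed
    then show "\<exists>d>0. \<forall>s\<in>{0..1}. \<bar>s - t\<bar> < d \<longrightarrow> p (l s - l t) < e" using d by blast
  qed (use l in auto)
  moreover have "(\<lambda>n. path_dist (s n) l) \<longlonglongrightarrow> 0"
  proof (rule LIMSEQ_I)
    fix r :: real assume "r > 0"
    then have "r / 2 > 0" by simp
    then obtain N where N: "\<And>n t. n \<ge> N \<Longrightarrow> t \<in> {0..1} \<Longrightarrow> p (s n t - l t) \<le> r / 2"
      using unif by blast
    have "norm (path_dist (s n) l - 0) < r" if "n \<ge> N" for n
      using path_dist_le[of "s n" l "r / 2"] N[OF that] path_dist_nonneg[OF path \<open>path_in l\<close>, of n] \<open>r > 0\<close>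
      by simp
    then show "\<exists>no. \<forall>n\<ge>no. norm (path_dist (s n) l - 0) < r" by blast
  qed
  ultimately show ?thesis by blast
qed

end

section \<open>C^1 functionals along paths, up to the deformation of paths\<close>

locale C1_functional = complete_seminormed_subspace scale V p
  for scale :: "real \<Rightarrow> 'a::ab_group_add \<Rightarrow> 'a" (infixr "\<cdot>" 75) and V p +
  fixes \<phi> :: "'a \<Rightarrow> real" and D :: "'a \<Rightarrow> 'a \<Rightarrow> real"
  assumes D_lincomb: "u \<in> V \<Longrightarrow> h \<in> V \<Longrightarrow> k \<in> V \<Longrightarrow> D u (a \<cdot> h + b \<cdot> k) = a * D u h + b * D u k"
    and D_bounded: "u \<in> V \<Longrightarrow> \<exists>C. \<forall>h\<in>V. \<bar>D u h\<bar> \<le> C * p h"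
    and D_derivative: "u \<in> V \<Longrightarrow> e > 0 \<Longrightarrow>
        \<exists>d>0. \<forall>v\<in>V. p (v - u) < d \<longrightarrow> \<bar>\<phi> v - \<phi> u - D u (v - u)\<bar> \<le> e * p (v - u)"
    and D_continuous: "u \<in> V \<Longrightarrow> e > 0 \<Longrightarrow>
        \<exists>d>0. \<forall>v\<in>V. p (v - u) < d \<longrightarrow> (\<forall>h\<in>V. \<bar>D v h - D u h\<bar> \<le> e * p h)"
begin

lemma D_scale: "u \<in> V \<Longrightarrow> h \<in> V \<Longrightarrow> D u (a \<cdot> h) = a * D u h"
  using D_lincomb[of u h 0 a 0] by simp

lemma D_add: "u \<in> V \<Longrightarrow> h \<in> V \<Longrightarrow> k \<in> V \<Longrightarrow> D u (h + k) = D u h + D u k"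
  using D_lincomb[of u h k 1 1] by simp

lemma D_0: "u \<in> V \<Longrightarrow> D u 0 = 0"
  using D_scale[of u 0 0] by simp

lemma D_sum: "finite I \<Longrightarrow> u \<in> V \<Longrightarrow> (\<And>i. i \<in> I \<Longrightarrow> f i \<in> V) \<Longrightarrow> D u (\<Sum>i\<in>I. f i) = (\<Sum>i\<in>I. D u (f i))"
proof (induction I rule: finite_induct)
  case empty then show ?case by (simp add: D_0)
next
  case (insert i I)
  then show ?case using D_add[of u "f i" "\<Sum>i\<in>I. f i"] V_sum[of I f] by auto
qed

text \<open>The mean value theorem on the segment from \<open>v\<close> to \<open>w\<close>, which
  stays in the convex ball where \<open>D\<close> is within \<open>e\<close> of \<open>D u\<close>.
  Both endpoints may vary, so one radius serves all nearby base points; differentiability at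
  \<open>u\<close> alone would not give that.\<close>

lemma strictly_differentiable:
  assumes u: "u \<in> V" and e: "e > 0"
  shows "\<exists>d>0. \<forall>v\<in>V. \<forall>w\<in>V. p (v - u) < d \<longrightarrow> p (w - u) < d \<longrightarrow>
      \<bar>\<phi> w - \<phi> v - D u (w - v)\<bar> \<le> e * p (w - v)"
proof -
  obtain d where d: "d > 0"
    and Dd: "\<And>v h. v \<in> V \<Longrightarrow> p (v - u) < d \<Longrightarrow> h \<in> V \<Longrightarrow> \<bar>D v h - D u h\<bar> \<le> e * p h"
    using D_continuous[OF u e] by metis
  have "\<bar>\<phi> w - \<phi> v - D u (w - v)\<bar> \<le> e * p (w - v)"
    if v: "v \<in> V" "p (v - u) < d" and w: "w \<in> V" "p (w - u) < d" for v w
  proof -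
    define z where "z t = v + t \<cdot> (w - v)" for t
    have zV: "z t \<in> V" for t using v w by (simp add: z_def)
    have pz: "p (z t - u) < d" if "0 \<le> t" "t \<le> 1" for t
    proof -
      have "z t - u = (1 - t) \<cdot> (v - u) + t \<cdot> (w - u)"
        by (simp add: z_def scale_left_diff_distrib scale_right_diff_distrib algebra_simps)
      then have "p (z t - u) \<le> (1 - t) * p (v - u) + t * p (w - u)"
        using p_add[of "(1 - t) \<cdot> (v - u)" "t \<cdot> (w - u)"] u v w that by (simp add: p_scale)
      also have "\<dots> \<le> (1 - t) * max (p (v - u)) (p (w - u)) + t * max (p (v - u)) (p (w - u))"
        using that by (intro add_mono mult_left_mono) auto
      also have "\<dots> < d" using v w by (simp add: algebra_simps)
      finally show ?thesis .
    qed
    have der: "((\<lambda>t. \<phi> (z t)) has_real_derivative D (z t) (w - v)) (at t)" for t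
      unfolding has_field_derivative_def has_derivative_at_alt
    proof (intro conjI allI impI)
      show "bounded_linear ((*) (D (z t) (w - v)))" by (rule bounded_linear_mult_right)
      fix r :: real assume r: "r > 0"
      \<comment> \<open>The added 1 keeps the divisor positive when \<open>p (w - v) = 0\<close>,
        which a seminorm allows even for \<open>w \<noteq> v\<close>.\<close>
      define P where "P = p (w - v) + 1"
      have "0 \<le> p (w - v)" using v w by simp
      then have P: "P > 0" "p (w - v) \<le> P" by (simp_all add: P_def)
      obtain \<delta> where \<delta>: "\<delta> > 0" "\<And>y. y \<in> V \<Longrightarrow> p (y - z t) < \<delta> \<Longrightarrow>
          \<bar>\<phi> y - \<phi> (z t) - D (z t) (y - z t)\<bar> \<le> (r / P) * p (y - z t)"
        using D_derivative[OF zV, of "r / P" t] r P by auto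
      show "\<exists>\<delta>>0. \<forall>y. norm (y - t) < \<delta> \<longrightarrow>
          norm (\<phi> (z y) - \<phi> (z t) - D (z t) (w - v) * (y - t)) \<le> r * norm (y - t)"
      proof (intro exI conjI allI impI)
        show "\<delta> / P > 0" using \<delta> P by simp
        fix y assume y: "norm (y - t) < \<delta> / P"
        have zz: "z y - z t = (y - t) \<cdot> (w - v)" by (simp add: z_def scale_left_diff_distrib)
        have pzz: "p (z y - z t) = \<bar>y - t\<bar> * p (w - v)" using v w by (simp add: zz p_scale)
        have le: "\<bar>y - t\<bar> * p (w - v) \<le> \<bar>y - t\<bar> * P" using P by (intro mult_left_mono) auto
        also have "\<dots> < \<delta>" using y P by (simp add: field_simps)
        finally have "\<bar>\<phi> (z y) - \<phi> (z t) - D (z t) (z y - z t)\<bar> \<le> (r / P) * p (z y - z t)"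
          by (intro \<delta>(2) zV) (simp add: pzz)
        also have "\<dots> \<le> (r / P) * (\<bar>y - t\<bar> * P)" using le r P unfolding pzz by (intro mult_left_mono) auto
        also have "\<dots> = r * \<bar>y - t\<bar>" using P by simp
        finally show "norm (\<phi> (z y) - \<phi> (z t) - D (z t) (w - v) * (y - t)) \<le> r * norm (y - t)"
          using v w zV[of t] by (simp add: zz D_scale mult.commute)
      qed
    qed
    obtain \<xi> where \<xi>: "0 < \<xi>" "\<xi> < 1" "\<phi> (z 1) - \<phi> (z 0) = (1 - 0) * D (z \<xi>) (w - v)"
      using MVT2[of 0 1 "\<lambda>t. \<phi> (z t)" "\<lambda>t. D (z t) (w - v)"] der by auto
    then have "\<phi> w - \<phi> v = D (z \<xi>) (w - v)" by (simp add: z_def)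
    then show ?thesis using Dd[OF zV pz, of \<xi> "w - v"] \<xi> v w by simp
  qed
  then show ?thesis using d by blast
qed

lemma \<phi>_continuous:
  assumes u: "u \<in> V" and e: "e > 0"
  shows "\<exists>d>0. \<forall>v\<in>V. p (v - u) < d \<longrightarrow> \<bar>\<phi> v - \<phi> u\<bar> < e"
proof -
  obtain C where C: "\<And>h. h \<in> V \<Longrightarrow> \<bar>D u h\<bar> \<le> C * p h" using D_bounded[OF u] by blast
  obtain d where d: "d > 0" "\<And>v. v \<in> V \<Longrightarrow> p (v - u) < d \<Longrightarrow> \<bar>\<phi> v - \<phi> u - D u (v - u)\<bar> \<le> 1 * p (v - u)"
    using D_derivative[OF u, of 1] by auto
  define K where "K = 1 + \<bar>C\<bar>"
  have K: "K > 0" "1 + C \<le> K" by (auto simp: K_def)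
  have "\<bar>\<phi> v - \<phi> u\<bar> < e" if v: "v \<in> V" "p (v - u) < min d (e / K)" for v
  proof -
    have "\<bar>\<phi> v - \<phi> u\<bar> \<le> (1 + C) * p (v - u)"
      using C[of "v - u"] d(2)[of v] v u by (simp add: algebra_simps)
    also have "\<dots> \<le> K * p (v - u)" using K v u by (intro mult_right_mono) auto
    also have "\<dots> < e" using v K by (simp add: field_simps)
    finally show ?thesis .
  qed
  moreover have "min d (e / K) > 0" using d K e by simp
  ultimately show ?thesis by blast
qed

lemma \<phi>_tendsto:
  assumes "(\<lambda>n. p (s n - u)) \<longlonglongrightarrow> 0" "\<And>n. s n \<in> V" "u \<in> V"
  shows "(\<lambda>n. \<phi> (s n)) \<longlonglongrightarrow> \<phi> u"
proof (rule LIMSEQ_I)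
  fix r :: real assume "r > 0"
  then obtain d where d: "d > 0" "\<And>v. v \<in> V \<Longrightarrow> p (v - u) < d \<Longrightarrow> \<bar>\<phi> v - \<phi> u\<bar> < r"
    using \<phi>_continuous[OF assms(3)] by metis
  have "\<forall>\<^sub>F n in sequentially. p (s n - u) < d" using assms(1) d(1) by (rule order_tendstoD(2))
  then show "\<exists>no. \<forall>n\<ge>no. norm (\<phi> (s n) - \<phi> u) < r"
    using d(2) assms(2) unfolding eventually_sequentially by force
qed

text \<open>Continuity with respect to the seminorm makes \<open>\<phi>\<close> blind to the choice
  of a representative: the constant sequence \<open>v\<close> converges to \<open>u\<close>.\<close>

lemma \<phi>_cong: "u \<in> V \<Longrightarrow> v \<in> V \<Longrightarrow> p (v - u) = 0 \<Longrightarrow> \<phi> v = \<phi> u"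
  using \<phi>_tendsto[of "\<lambda>_. v" u] by (simp add: LIMSEQ_const_iff)

lemma \<phi>_path_continuous:
  assumes "path_in \<gamma>"
  shows "continuous_on {0..1} (\<lambda>t. \<phi> (\<gamma> t))"
  unfolding continuous_on_iff
proof (intro ballI allI impI)
  fix t e :: real assume t: "t \<in> {0..1}" and e: "e > 0"
  obtain d where d: "d > 0" "\<And>v. v \<in> V \<Longrightarrow> p (v - \<gamma> t) < d \<Longrightarrow> \<bar>\<phi> v - \<phi> (\<gamma> t)\<bar> < e"
    using \<phi>_continuous[OF path_in_V[OF assms t] e] by metis
  obtain \<delta> where "\<delta> > 0" "\<And>s. s \<in> {0..1} \<Longrightarrow> \<bar>s - t\<bar> < \<delta> \<Longrightarrow> p (\<gamma> s - \<gamma> t) < d"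
    using assms t d(1) unfolding path_in_iff by metis
  then show "\<exists>d>0. \<forall>s\<in>{0..1}. dist s t < d \<longrightarrow> dist (\<phi> (\<gamma> s)) (\<phi> (\<gamma> t)) < e"
    using d(2) path_in_V[OF assms] unfolding dist_real_def by blast
qed

text \<open>Strict differentiability and continuity of \<open>D\<close> at \<open>\<gamma> r\<close>
  hold uniformly near that point, and compactness of the interval removes the dependence on
  \<open>r\<close>. Half of \<open>e\<close> is spent on comparing with
  \<open>D (\<gamma> r)\<close>, the other half on replacing it by
  \<open>D (\<gamma> t)\<close>.\<close>

lemma uniform_along_path:
  assumes \<gamma>: "path_in \<gamma>" and e: "e > 0"
  shows "\<exists>d>0. \<forall>t\<in>{0..1}.
      (\<forall>h\<in>V. p h < d \<longrightarrow> \<bar>\<phi> (\<gamma> t + h) - \<phi> (\<gamma> t) - D (\<gamma> t) h\<bar> \<le> e * p h) \<and>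
      (\<forall>s\<in>{0..1}. \<bar>s - t\<bar> < d \<longrightarrow> (\<forall>h\<in>V. \<bar>D (\<gamma> s) h - D (\<gamma> t) h\<bar> \<le> e * p h))"
proof (rule uniform_on_unit_interval, goal_cases)
  case (1 r)
  note rV = path_in_V[OF \<gamma> 1]
  obtain d1 where d1: "d1 > 0" "\<And>v w. v \<in> V \<Longrightarrow> w \<in> V \<Longrightarrow> p (v - \<gamma> r) < d1 \<Longrightarrow> p (w - \<gamma> r) < d1 \<Longrightarrow>
      \<bar>\<phi> w - \<phi> v - D (\<gamma> r) (w - v)\<bar> \<le> (e/2) * p (w - v)"
    using strictly_differentiable[OF rV, of "e/2"] e by (metis half_gt_zero)
  obtain d2 where d2: "d2 > 0" "\<And>v h. v \<in> V \<Longrightarrow> p (v - \<gamma> r) < d2 \<Longrightarrow> h \<in> V \<Longrightarrow>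
      \<bar>D v h - D (\<gamma> r) h\<bar> \<le> (e/2) * p h"
    using D_continuous[OF rV, of "e/2"] e by (metis half_gt_zero)
  have "min (d1/2) d2 > 0" using d1 d2 by simp
  then obtain d3 where d3: "d3 > 0" "\<And>s. s \<in> {0..1} \<Longrightarrow> \<bar>s - r\<bar> < d3 \<Longrightarrow> p (\<gamma> s - \<gamma> r) < min (d1/2) d2"
    using \<gamma> 1 unfolding path_in_iff by metis
  show ?case
  \<comment> \<open>The halves leave room for two displacements: from \<open>r\<close> to
    \<open>t\<close> to \<open>s\<close> in the parameter, and from \<open>\<gamma> r\<close> to
    \<open>\<gamma> t\<close> to \<open>\<gamma> t + h\<close> in the space.\<close>
  proof (intro exI[of _ "min (d3/2) (d1/2)"] conjI ballI impI)
    show "min (d3/2) (d1/2) > 0" using d1 d3 by simp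
    fix t assume t: "t \<in> {0..1}" "\<bar>t - r\<bar> < min (d3/2) (d1/2)"
    have tV: "\<gamma> t \<in> V" using \<gamma> t by (simp add: path_in_V)
    have pt: "p (\<gamma> t - \<gamma> r) < d1/2" "p (\<gamma> t - \<gamma> r) < d2" using d3 t by force+
    fix h assume h: "h \<in> V"
    {
      assume ph: "p h < min (d3/2) (d1/2)"
      have "p (\<gamma> t + h - \<gamma> r) \<le> p (\<gamma> t - \<gamma> r) + p h"
        using p_add[of "\<gamma> t - \<gamma> r" h] tV rV h by (simp add: algebra_simps)
      then have "p (\<gamma> t + h - \<gamma> r) < d1" using pt ph by simp
      then have "\<bar>\<phi> (\<gamma> t + h) - \<phi> (\<gamma> t) - D (\<gamma> r) h\<bar> \<le> (e/2) * p h"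
        using d1(2)[of "\<gamma> t" "\<gamma> t + h"] tV h pt d1(1) by simp
      then show "\<bar>\<phi> (\<gamma> t + h) - \<phi> (\<gamma> t) - D (\<gamma> t) h\<bar> \<le> e * p h"
        using d2(2)[OF tV pt(2) h] by linarith
    }
    fix s assume s: "s \<in> {0..1}" "\<bar>s - t\<bar> < min (d3/2) (d1/2)"
    have sV: "\<gamma> s \<in> V" using \<gamma> s by (simp add: path_in_V)
    have "\<bar>s - r\<bar> < d3" using s t by linarith
    then have "p (\<gamma> s - \<gamma> r) < d2" using d3(2)[OF s(1)] by simp
    then show "\<bar>D (\<gamma> s) h - D (\<gamma> t) h\<bar> \<le> e * p h"
      using d2(2)[OF tV pt(2) h] d2(2)[OF sV _ h] by linarith
  qed
next
  case (2 d d' t) then show ?case by fastforce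
qed

lemma D_tendsto:
  assumes "(\<lambda>n. p (s n - u)) \<longlonglongrightarrow> 0" "\<And>n. s n \<in> V" "u \<in> V" "h \<in> V"
  shows "(\<lambda>n. D (s n) h) \<longlonglongrightarrow> D u h"
proof (rule LIMSEQ_I)
  fix r :: real assume r: "r > 0"
  define P where "P = p h + 1"
  have P: "P > 0" "p h < P" using p_nonneg[OF assms(4)] unfolding P_def by linarith+
  obtain d where d: "d > 0" "\<And>v h. v \<in> V \<Longrightarrow> p (v - u) < d \<Longrightarrow> h \<in> V \<Longrightarrow> \<bar>D v h - D u h\<bar> \<le> (r / P) * p h"
    using D_continuous[OF assms(3), of "r / P"] r P(1) by (metis divide_pos_pos)
  have "\<forall>\<^sub>F n in sequentially. p (s n - u) < d" using assms(1) d(1) by (rule order_tendstoD(2))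
  then have "\<forall>\<^sub>F n in sequentially. \<bar>D (s n) h - D u h\<bar> < r"
  proof eventually_elim
    case (elim n)
    have "\<bar>D (s n) h - D u h\<bar> \<le> (r / P) * p h" by (rule d(2)[OF assms(2) elim assms(4)])
    also have "\<dots> < (r / P) * P" using r P by (intro mult_strict_left_mono) auto
    finally show ?case using P by simp
  qed
  then show "\<exists>no. \<forall>n\<ge>no. norm (D (s n) h - D u h) < r" by (simp add: eventually_sequentially)
qed

lemma D_eq_0_limit:
  assumes "(\<lambda>n. p (s n - u)) \<longlonglongrightarrow> 0" "\<And>n. s n \<in> V" "u \<in> V" "h \<in> V"
    and "\<And>n. \<bar>D (s n) h\<bar> \<le> e n * p h" "e \<longlonglongrightarrow> 0"
  shows "D u h = 0"
proof -
  have "(\<lambda>n. D (s n) h) \<longlonglongrightarrow> 0"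
  proof (rule Lim_null_comparison)
    show "\<forall>\<^sub>F n in sequentially. norm (D (s n) h) \<le> e n * p h" using assms(5) by simp
    show "(\<lambda>n. e n * p h) \<longlonglongrightarrow> 0" by (rule tendsto_mult_left_zero[OF assms(6)])
  qed
  then show ?thesis using D_tendsto[OF assms(1-4)] LIMSEQ_unique by blast
qed

lemma local_min_D_eq_0:
  assumes r: "r > 0" "\<And>v. v \<in> V \<Longrightarrow> p v < r \<Longrightarrow> \<phi> 0 \<le> \<phi> v" and h: "h \<in> V"
  shows "D 0 h = 0"
proof -
  have nonneg: "0 \<le> D 0 k" if k: "k \<in> V" for k
  proof (rule ccontr)
    assume neg: "\<not> 0 \<le> D 0 k"
    define P where "P = p k + 1"
    have P: "P > 0" "p k < P" "0 \<le> p k" using p_nonneg[OF k] unfolding P_def by linarith+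
    \<comment> \<open>With this tolerance the remainder consumes at most half of the descent rate
      \<open>- D 0 k\<close>, so a small step along \<open>k\<close> strictly lowers
      \<open>\<phi>\<close>.\<close>
    define e where "e = - D 0 k / (2 * P)"
    have e: "e > 0" using neg P by (simp add: e_def field_simps)
    obtain d where d: "d > 0" "\<And>v. v \<in> V \<Longrightarrow> p (v - 0) < d \<Longrightarrow> \<bar>\<phi> v - \<phi> 0 - D 0 (v - 0)\<bar> \<le> e * p (v - 0)"
      using D_derivative[OF V_0 e] by blast
    define t where "t = min d r / (2 * P)"
    have t: "t > 0" using d(1) r(1) P by (simp add: t_def)
    have pt: "p (t \<cdot> k) = t * p k" using t k by (simp add: p_scale)
    have "t * p k \<le> t * P" using t P by (intro mult_left_mono) auto
    also have "\<dots> = min d r / 2" using P by (simp add: t_def)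
    also have "\<dots> < min d r" using d(1) r(1) by (simp add: min_def)
    finally have lt: "p (t \<cdot> k) < d" "p (t \<cdot> k) < r" by (simp_all add: pt)
    have "\<phi> (t \<cdot> k) - \<phi> 0 \<le> D 0 (t \<cdot> k) + e * p (t \<cdot> k)"
      using d(2)[of "t \<cdot> k"] lt(1) k by simp
    also have "\<dots> = t * (D 0 k + e * p k)" using k by (simp add: D_scale pt algebra_simps)
    also have "\<dots> < 0"
    proof -
      have "e * p k \<le> e * P" using e P by (intro mult_left_mono) auto
      also have "\<dots> = - D 0 k / 2" using P by (simp add: e_def)
      finally have "D 0 k + e * p k < 0" using neg by linarith
      then show ?thesis using t by (simp add: mult_pos_neg)
    qed
    finally show False using r(2)[of "t \<cdot> k"] lt(2) k by simp
  qed
  have "D 0 ((-1) \<cdot> h) = - D 0 h" by (simp only: D_scale[OF V_0 h])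
  then show ?thesis using nonneg[OF h] nonneg[OF V_scale[OF h, of "-1"]] by linarith
qed

text \<open>Finitely many directions \<open>w (T i)\<close>, blended by hat functions into a
  continuous field \<open>k\<close>, take the place of a pseudo-gradient. The rate
  \<open>3 * e\<close> drops to \<open>5/2 * e\<close> because a direction chosen at
  \<open>T i\<close> is used at nearby parameters, and to \<open>2 * e\<close> through the remainder
  of the first-order expansion. The margin \<open>\<tau>\<close> keeps the starting point
  fixed.\<close>

lemma descend_along_path:
  assumes \<beta>: "path_in \<beta>" and e: "e > 0" and C: "C \<subseteq> {0..1}"
    and steep: "\<And>t. t \<in> C \<Longrightarrow> \<exists>w\<in>V. p w \<le> 1 \<and> D (\<beta> t) w < - (3 * e)"
    and away: "\<tau> > 0" "\<And>t. t \<in> C \<Longrightarrow> \<tau> \<le> t"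
  shows "\<exists>h0>0. \<forall>h. 0 < h \<and> h < h0 \<longrightarrow> (\<exists>\<beta>'. path_in \<beta>' \<and> \<beta>' 0 = \<beta> 0 \<and>
      (\<forall>t\<in>{0..1}. p (\<beta>' t - \<beta> t) \<le> h \<and> \<phi> (\<beta>' t) \<le> \<phi> (\<beta> t) \<and>
         (t \<in> C \<longrightarrow> \<phi> (\<beta>' t) \<le> \<phi> (\<beta> t) - 2 * e * h)))"
proof -
  obtain d where d: "d > 0"
    and inc: "\<And>t h. t \<in> {0..1} \<Longrightarrow> h \<in> V \<Longrightarrow> p h < d \<Longrightarrow>
        \<bar>\<phi> (\<beta> t + h) - \<phi> (\<beta> t) - D (\<beta> t) h\<bar> \<le> (e/2) * p h"
    and osc: "\<And>t s h. t \<in> {0..1} \<Longrightarrow> s \<in> {0..1} \<Longrightarrow> \<bar>s - t\<bar> < d \<Longrightarrow> h \<in> V \<Longrightarrow>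
        \<bar>D (\<beta> s) h - D (\<beta> t) h\<bar> \<le> (e/2) * p h"
    using uniform_along_path[OF \<beta>, of "e/2"] e by (metis half_gt_zero)
  obtain w where w: "\<And>t. t \<in> C \<Longrightarrow> w t \<in> V \<and> p (w t) \<le> 1 \<and> D (\<beta> t) (w t) < - (3 * e)"
    using steep by metis
  \<comment> \<open>The mesh \<open>1 / m\<close> meets two demands: \<open>2 / m < d\<close>, as
    \<open>t\<close> and \<open>T i\<close> may lie on different sides of a node at distance
    \<open>1 / m\<close>, and \<open>1 / m < \<tau>\<close>, so that node 0 has no point of
    \<open>C\<close> nearby.\<close>
  obtain m :: nat where "max (2 / d) (1 / \<tau>) < real m" using reals_Archimedean2 by blast
  then have md: "2 / d < m" and m\<tau>: "1 / \<tau> < m" by auto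
  have m: "real m > 0" using m\<tau> away(1) by (smt (verit) divide_pos_pos)
  have md: "2 / m < d" using md m d by (simp add: field_simps)
  have m\<tau>: "1 / m < \<tau>" using m\<tau> m away(1) by (simp add: field_simps)
  \<comment> \<open>Only hats whose open support meets \<open>C\<close> carry a direction. Omitting
    the others lets the total weight \<open>\<kappa>\<close> fall below 1 off \<open>C\<close>,
    which merely weakens the descent there.\<close>
  define bad where "bad i \<longleftrightarrow> (\<exists>t\<in>C. \<bar>t - real i / m\<bar> < 1 / m)" for i :: nat
  define T where "T i = (SOME t. t \<in> C \<and> \<bar>t - real i / m\<bar> < 1 / m)" for i :: nat
  have T: "T i \<in> C" "\<bar>T i - real i / m\<bar> < 1 / m" if "bad i" for i
    using someI_ex[of "\<lambda>t. t \<in> C \<and> \<bar>t - real i / m\<bar> < 1 / m"] that unfolding bad_def T_def by auto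
  define \<rho> where "\<rho> i t = max 0 (1 - \<bar>m * t - real i\<bar>)" for i :: nat and t :: real
  have \<rho>: "\<rho> i t \<ge> 0" for i t by (simp add: \<rho>_def)
  have \<rho>_pos: "\<bar>t - real i / m\<bar> < 1 / m" if "\<rho> i t > 0" for i t
  proof -
    have "\<bar>m * t - real i\<bar> < 1" using that by (auto simp: \<rho>_def)
    moreover have "m * t - real i = m * (t - real i / m)" using m by (simp add: field_simps)
    ultimately have "m * \<bar>t - real i / m\<bar> < 1" using m by (simp add: abs_mult)
    then show ?thesis using m by (simp add: field_simps)
  qed
  have \<rho>_sum: "(\<Sum>i\<le>m. \<rho> i t) = 1" if "t \<in> {0..1}" for t
    unfolding \<rho>_def using that m by (intro sum_hat_functions_eq_1) auto
  have \<rho>_cont: "continuous_on UNIV (\<rho> i)" for i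
    unfolding \<rho>_def by (intro continuous_intros)
  define B where "B = {i. i \<le> m \<and> bad i}"
  have finB: "finite B" unfolding B_def by auto
  define \<kappa> where "\<kappa> t = (\<Sum>i\<in>B. \<rho> i t)" for t
  define k where "k t = (\<Sum>i\<in>B. \<rho> i t \<cdot> w (T i))" for t
  have wV: "w (T i) \<in> V" "p (w (T i)) \<le> 1" if "i \<in> B" for i
    using w[OF T(1)] that by (auto simp: B_def)
  have kV: "k t \<in> V" for t unfolding k_def by (intro V_sum V_scale wV)
  have \<kappa>_nonneg: "0 \<le> \<kappa> t" for t unfolding \<kappa>_def by (intro sum_nonneg \<rho>)
  have \<kappa>_le: "\<kappa> t \<le> 1" if "t \<in> {0..1}" for t
    unfolding \<kappa>_def \<rho>_sum[OF that, symmetric] by (intro sum_mono2) (auto simp: B_def \<rho>)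
  \<comment> \<open>A hat that is positive at \<open>t \<in> C\<close> belongs to a bad node, with
    \<open>t\<close> itself as witness, so no weight is lost on \<open>C\<close>.\<close>
  have \<kappa>_C: "\<kappa> t = 1" if t: "t \<in> C" for t
  proof -
    have "\<kappa> t = (\<Sum>i\<le>m. \<rho> i t)"
      unfolding \<kappa>_def
    proof (rule sum.mono_neutral_left)
      show "\<forall>i\<in>{..m} - B. \<rho> i t = 0"
      proof
        fix i assume "i \<in> {..m} - B"
        then have "\<not> bad i" by (auto simp: B_def)
        then show "\<rho> i t = 0" using \<rho>_pos[of i t] t \<rho>[of i t] unfolding bad_def by fastforce
      qed
    qed (auto simp: B_def)
    then show ?thesis using \<rho>_sum t C by auto
  qed
  have pk: "p (k t) \<le> \<kappa> t" for t
  proof -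
    have "p (k t) \<le> (\<Sum>i\<in>B. p (\<rho> i t \<cdot> w (T i)))"
      unfolding k_def by (intro p_sum finB V_scale wV)
    also have "\<dots> \<le> \<kappa> t" unfolding \<kappa>_def
    proof (rule sum_mono)
      fix i assume i: "i \<in> B"
      then show "p (\<rho> i t \<cdot> w (T i)) \<le> \<rho> i t"
        using wV[OF i] \<rho>[of i t] by (simp add: p_scale mult_left_le)
    qed
    finally show ?thesis .
  qed
  have Dk: "D (\<beta> t) (k t) \<le> - (5/2 * e) * \<kappa> t" if t: "t \<in> {0..1}" for t
  proof -
    have "D (\<beta> t) (k t) = (\<Sum>i\<in>B. \<rho> i t * D (\<beta> t) (w (T i)))"
      unfolding k_def using path_in_V[OF \<beta> t] wV finB by (subst D_sum) (auto simp: D_scale intro!: sum.cong)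
    also have "\<dots> \<le> (\<Sum>i\<in>B. \<rho> i t * (- (5/2 * e)))"
    proof (rule sum_mono)
      fix i assume i: "i \<in> B"
      show "\<rho> i t * D (\<beta> t) (w (T i)) \<le> \<rho> i t * (- (5/2 * e))"
      proof (cases "\<rho> i t = 0")
        case False
        then have "\<rho> i t > 0" using \<rho>[of i t] by simp
        then have close: "\<bar>t - real i / m\<bar> < 1 / m" by (rule \<rho>_pos)
        have bad: "bad i" using i by (simp add: B_def)
        have "\<bar>t - T i\<bar> < d" using close T(2)[OF bad] md by linarith
        then have "\<bar>D (\<beta> t) (w (T i)) - D (\<beta> (T i)) (w (T i))\<bar> \<le> (e/2) * p (w (T i))"
          using T(1)[OF bad] C t wV[OF i] by (intro osc) auto
        also have "\<dots> \<le> (e/2) * 1" using wV[OF i] e by (intro mult_left_mono) auto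
        finally have "D (\<beta> t) (w (T i)) \<le> - (5/2 * e)" 
          using w[OF T(1)[OF bad], THEN conjunct2, THEN conjunct2] by linarith
        then show ?thesis using \<rho>[of i t] by (intro mult_left_mono)
      qed simp
    qed
    also have "\<dots> = - (5/2 * e) * \<kappa> t" unfolding \<kappa>_def sum_distrib_left by (intro sum.cong) auto
    finally show ?thesis .
  qed
  have k_path: "path_in (\<lambda>t. \<beta> t + h \<cdot> k t)" for h
    unfolding path_in_def
  proof (intro conjI ballI)
    fix t :: real assume t: "t \<in> {0..1}"
    show "\<beta> t + h \<cdot> k t \<in> V" using path_in_V[OF \<beta> t] kV by simp
    show "((\<lambda>s. p (\<beta> s + h \<cdot> k s - (\<beta> t + h \<cdot> k t))) \<longlongrightarrow> 0) (at t within {0..1})"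
    proof (rule Lim_null_comparison)
      define M where "M = (\<lambda>s. p (\<beta> s - \<beta> t) + \<bar>h\<bar> * (\<Sum>i\<in>B. \<bar>\<rho> i s - \<rho> i t\<bar>))"
      have "((\<lambda>s. \<rho> i s) \<longlongrightarrow> \<rho> i t) (at t within {0..1})" for i
        using \<rho>_cont[of i] continuous_on_subset[of UNIV "\<rho> i" "{0..1}"] t by (auto simp: continuous_on_def)
      then have "((\<lambda>s. \<bar>\<rho> i s - \<rho> i t\<bar>) \<longlongrightarrow> 0) (at t within {0..1})" for i
        by (intro tendsto_rabs_zero) (simp add: LIM_zero)
      then show "(M \<longlongrightarrow> 0) (at t within {0..1})"
        unfolding M_def using \<beta> t
        by (intro tendsto_add_zero tendsto_mult_right_zero tendsto_null_sum) (auto simp: path_in_def)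
      show "\<forall>\<^sub>F s in at t within {0..1}. norm (p (\<beta> s + h \<cdot> k s - (\<beta> t + h \<cdot> k t))) \<le> M s"
        unfolding eventually_at_filter
      proof (intro always_eventually allI impI)
        fix s :: real assume s: "s \<in> {0..1}"
        have V: "\<beta> s \<in> V" "\<beta> t \<in> V" using \<beta> s t by (auto intro: path_in_V)
        have "k s - k t = (\<Sum>i\<in>B. (\<rho> i s - \<rho> i t) \<cdot> w (T i))"
          unfolding k_def by (simp add: scale_left_diff_distrib sum_subtractf)
        then have "p (k s - k t) \<le> (\<Sum>i\<in>B. p ((\<rho> i s - \<rho> i t) \<cdot> w (T i)))"
          using p_sum[OF finB, of "\<lambda>i. (\<rho> i s - \<rho> i t) \<cdot> w (T i)"] wV by simp
        also have "\<dots> \<le> (\<Sum>i\<in>B. \<bar>\<rho> i s - \<rho> i t\<bar>)"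
          by (intro sum_mono) (use wV in \<open>auto simp: p_scale mult_left_le\<close>)
        finally have pk: "p (k s - k t) \<le> (\<Sum>i\<in>B. \<bar>\<rho> i s - \<rho> i t\<bar>)" .
        have eq: "\<beta> s + h \<cdot> k s - (\<beta> t + h \<cdot> k t) = (\<beta> s - \<beta> t) + h \<cdot> (k s - k t)"
          by (simp add: scale_right_diff_distrib)
        have "p (\<beta> s + h \<cdot> k s - (\<beta> t + h \<cdot> k t)) \<le> p (\<beta> s - \<beta> t) + \<bar>h\<bar> * p (k s - k t)"
          unfolding eq using p_add[of "\<beta> s - \<beta> t" "h \<cdot> (k s - k t)"] V kV by (simp add: p_scale)
        also have "\<dots> \<le> M s" unfolding M_def using pk by (intro add_left_mono mult_left_mono) auto
        finally show "norm (p (\<beta> s + h \<cdot> k s - (\<beta> t + h \<cdot> k t))) \<le> M s"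
          using V kV by simp
      qed
    qed
  qed
  have "\<exists>\<beta>'. path_in \<beta>' \<and> \<beta>' 0 = \<beta> 0 \<and>
      (\<forall>t\<in>{0..1}. p (\<beta>' t - \<beta> t) \<le> h \<and> \<phi> (\<beta>' t) \<le> \<phi> (\<beta> t) \<and>
         (t \<in> C \<longrightarrow> \<phi> (\<beta>' t) \<le> \<phi> (\<beta> t) - 2 * e * h))" if h: "0 < h" "h < d" for h
  proof (intro exI conjI ballI impI)
    show "path_in (\<lambda>t. \<beta> t + h \<cdot> k t)" by (rule k_path)
    \<comment> \<open>Among all hats only that of node 0 is nonzero at parameter 0, and node 0 is
      not bad because \<open>1 / m < \<tau>\<close>.\<close>
    have "\<rho> i 0 = 0" if "i \<in> B" for i
    proof (rule ccontr)
      assume "\<rho> i 0 \<noteq> 0"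
      then have i0: "i = 0" using m by (auto simp: \<rho>_def max_def split: if_splits)
      have "bad i" using that by (simp add: B_def)
      from T[OF this] i0 away(2)[of "T i"] m\<tau> show False by auto
    qed
    then have "k 0 = 0" unfolding k_def by (intro sum.neutral) simp
    then show "\<beta> 0 + h \<cdot> k 0 = \<beta> 0" by simp
    fix t :: real assume t: "t \<in> {0..1}"
    have phk: "p (h \<cdot> k t) \<le> h * \<kappa> t" using pk[of t] kV h by (simp add: p_scale)
    also have "\<dots> \<le> h" using \<kappa>_le[OF t] h by (simp add: mult_left_le)
    finally show "p (\<beta> t + h \<cdot> k t - \<beta> t) \<le> h" by simp
    then have "\<bar>\<phi> (\<beta> t + h \<cdot> k t) - \<phi> (\<beta> t) - D (\<beta> t) (h \<cdot> k t)\<bar> \<le> (e/2) * p (h \<cdot> k t)"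
      using h kV t by (intro inc) auto
    also have "\<dots> \<le> (e/2) * (h * \<kappa> t)" using phk e by (intro mult_left_mono) auto
    finally have "\<phi> (\<beta> t + h \<cdot> k t) \<le> \<phi> (\<beta> t) + h * D (\<beta> t) (k t) + (e/2) * (h * \<kappa> t)"
      using kV path_in_V[OF \<beta> t] unfolding abs_le_iff by (simp add: D_scale)
    also have "h * D (\<beta> t) (k t) \<le> h * (- (5/2 * e) * \<kappa> t)" using Dk[OF t] h by (intro mult_left_mono) auto
    finally have main: "\<phi> (\<beta> t + h \<cdot> k t) \<le> \<phi> (\<beta> t) - 2 * e * h * \<kappa> t" by (simp add: algebra_simps)
    moreover have "0 \<le> 2 * e * h * \<kappa> t" using e h \<kappa>_nonneg[of t] by simp
    ultimately show "\<phi> (\<beta> t + h \<cdot> k t) \<le> \<phi> (\<beta> t)" by simp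
    show "\<phi> (\<beta> t + h \<cdot> k t) \<le> \<phi> (\<beta> t) - 2 * e * h" if "t \<in> C" using main \<kappa>_C[OF that] by simp
  qed
  then show ?thesis using d by blast
qed

text \<open>\<open>F \<gamma>\<close> exceeds the least possible value \<open>c - e\<^sup>2\<close>
  by at most \<open>2 * e\<^sup>2\<close>, so Ekeland's principle with weight \<open>e\<close>
  bounds the displacement by \<open>2 * e\<close>. Were \<open>F \<beta>\<close> still above that
  value, a step of size \<open>h\<close> would lower it by \<open>2 * e * h\<close>, while
  minimality allows a drop of at most \<open>e * h\<close>. The radius \<open>3 * e\<close> admits
  \<open>\<beta> t\<close> as a candidate in \<open>near\<close>; hence, where \<open>near\<close>
  fails and the level is above the floor, the derivative at \<open>\<beta> t\<close> is
  steep.\<close>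

lemma path_deformation:
  assumes \<gamma>: "path_in \<gamma>" and e: "e > 0"
    and upper: "\<And>t. t \<in> {0..1} \<Longrightarrow> \<phi> (\<gamma> t) \<le> c + e\<^sup>2" and start: "\<phi> (\<gamma> 0) < c - e\<^sup>2"
  shows "\<exists>\<beta>. path_in \<beta> \<and> p (\<beta> 0 - \<gamma> 0) = 0 \<and>
    (\<forall>t\<in>{0..1}. \<phi> (\<beta> t) \<le> \<phi> (\<gamma> t) \<and> p (\<beta> t - \<gamma> t) \<le> 2 * e \<and>
      (\<phi> (\<beta> t) \<le> c - e\<^sup>2 \<or> (\<exists>v\<in>V. p (v - \<gamma> t) < 3 * e \<and> c - e\<^sup>2 \<le> \<phi> v \<and> \<phi> v \<le> c + e\<^sup>2 \<and>
         (\<forall>h\<in>V. \<bar>D v h\<bar> \<le> 3 * e * p h))))"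
proof -
  define near where "near t \<longleftrightarrow> (\<exists>v\<in>V. p (v - \<gamma> t) < 3 * e \<and> c - e\<^sup>2 \<le> \<phi> v \<and> \<phi> v \<le> c + e\<^sup>2 \<and>
         (\<forall>h\<in>V. \<bar>D v h\<bar> \<le> 3 * e * p h))" for t
  define X where "X = {\<beta>. path_in \<beta> \<and> p (\<beta> 0 - \<gamma> 0) = 0 \<and> (\<forall>t\<in>{0..1}. \<phi> (\<beta> t) \<le> \<phi> (\<gamma> t))}"
  \<comment> \<open>Clipping at \<open>c - e\<^sup>2\<close> bounds \<open>F\<close> below. Giving
    that floor to every near parameter removes it from the supremum without asking any regularity of
    the set of such parameters. \<open>F\<close> stays lower semicontinuous, since each
    \<open>f \<beta> t\<close> depends continuously on \<open>\<beta> t\<close>.\<close>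
  define f where "f \<beta> t = (if near t then c - e\<^sup>2 else max (c - e\<^sup>2) (\<phi> (\<beta> t)))" for \<beta> t
  define F where "F \<beta> = (SUP t\<in>{0..1}. f \<beta> t)" for \<beta>
  have X_path: "path_in \<beta>" if "\<beta> \<in> X" for \<beta> using that by (simp add: X_def)
  have f_le: "f \<beta> t \<le> c + e\<^sup>2" if "\<beta> \<in> X" "t \<in> {0..1}" for \<beta> t
    using that upper[of t] unfolding X_def f_def by fastforce
  have F_upper: "f \<beta> t \<le> F \<beta>" if "\<beta> \<in> X" "t \<in> {0..1}" for \<beta> t
    unfolding F_def by (intro cSUP_upper that bdd_aboveI2[of _ _ "c + e\<^sup>2"] f_le)
  have F_least: "F \<beta> \<le> a" if "\<And>t. t \<in> {0..1} \<Longrightarrow> f \<beta> t \<le> a" for \<beta> a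
    unfolding F_def by (intro cSUP_least that) auto
  have F_bdd: "c - e\<^sup>2 \<le> F \<beta>" if "\<beta> \<in> X" for \<beta>
    using F_upper[OF that, of 0] by (auto simp: f_def split: if_splits)
  have \<gamma>X: "\<gamma> \<in> X" using \<gamma> by (simp add: X_def)
  have V0: "\<beta> 0 \<in> V" if "\<beta> \<in> X" for \<beta> using X_path[OF that] by (auto intro: path_in_V[of \<beta>])
  have pointwise: "(\<lambda>n. p (s n t - l t)) \<longlonglongrightarrow> 0"
    if s: "\<And>n. s n \<in> X" and l: "path_in l" and lim: "(\<lambda>n. path_dist (s n) l) \<longlonglongrightarrow> 0" and t: "t \<in> {0..1}"
    for s l t
  proof (rule tendsto_sandwich[OF _ _ tendsto_const lim])
    show "\<forall>\<^sub>F n in sequentially. 0 \<le> p (s n t - l t)"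
      using path_in_V[OF X_path[OF s] t] path_in_V[OF l t] by (intro always_eventually allI p_nonneg V_diff)
    show "\<forall>\<^sub>F n in sequentially. p (s n t - l t) \<le> path_dist (s n) l"
      using path_dist_upper[OF X_path[OF s] l t] by (intro always_eventually allI)
  qed
  have "\<exists>\<beta>\<in>X. F \<beta> + e * path_dist \<gamma> \<beta> \<le> F \<gamma> \<and> (\<forall>\<beta>'\<in>X. F \<beta> \<le> F \<beta>' + e * path_dist \<beta> \<beta>')"
  proof (rule ekeland_variational_principle[where b="c - e\<^sup>2"])
    show "\<exists>l\<in>X. (\<lambda>n. path_dist (s n) l) \<longlonglongrightarrow> 0"
      if s: "\<And>n. s n \<in> X" and C: "\<And>r. r > 0 \<Longrightarrow> \<exists>N. \<forall>m\<ge>N. \<forall>n\<ge>m. path_dist (s m) (s n) < r" for s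
    proof -
      obtain l where l: "path_in l" "(\<lambda>n. path_dist (s n) l) \<longlonglongrightarrow> 0"
        using path_dist_complete[of s, OF X_path[OF s] C] by blast
      note lim = pointwise[of s, OF s l]
      have lV: "l 0 \<in> V" "\<gamma> 0 \<in> V" using l \<gamma> by (auto intro: path_in_V[of l] path_in_V[of \<gamma>])
      have "p (l 0 - \<gamma> 0) \<le> 0"
        by (rule p_limit_triangle[OF lim]) (use lV s V0 in \<open>auto simp: X_def\<close>)
      then have "p (l 0 - \<gamma> 0) = 0" using lV by (simp add: order_antisym)
      moreover have "\<phi> (l t) \<le> \<phi> (\<gamma> t)" if t: "t \<in> {0..1}" for t
        by (rule LIMSEQ_le_const2[OF \<phi>_tendsto[OF lim[OF t]]])
          (use s l t path_in_V[OF X_path[OF s]] in \<open>auto simp: X_def intro: path_in_V\<close>)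
      ultimately show ?thesis using l by (auto simp: X_def)
    qed
    show "F l \<le> a" if s: "\<And>n. s n \<in> X" and lX: "l \<in> X" and lim: "(\<lambda>n. path_dist (s n) l) \<longlonglongrightarrow> 0"
      and le: "\<And>n. F (s n) \<le> a" for s l a
    proof (rule F_least)
      fix t :: real assume t: "t \<in> {0..1}"
      have fa: "f (s n) t \<le> a" for n using F_upper[OF s t] le order_trans by blast
      have "\<phi> (l t) \<le> a" if "\<not> near t"
        by (rule LIMSEQ_le_const2[OF \<phi>_tendsto[OF pointwise[of s, OF s X_path[OF lX] lim t]]])
          (use fa that path_in_V[OF X_path t] s lX in \<open>auto simp: f_def\<close>)
      then show "f l t \<le> a" using fa[of 0] by (auto simp: f_def split: if_splits)
    qed
  qed (use e \<gamma>X X_path F_bdd path_dist_nonneg path_dist_refl path_dist_triangle in auto)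
  then obtain \<beta> where \<beta>X: "\<beta> \<in> X" and Fdist: "F \<beta> + e * path_dist \<gamma> \<beta> \<le> F \<gamma>"
    and minimal: "\<And>\<beta>'. \<beta>' \<in> X \<Longrightarrow> F \<beta> \<le> F \<beta>' + e * path_dist \<beta> \<beta>'" by blast
  note \<beta> = X_path[OF \<beta>X]
  have "e * path_dist \<gamma> \<beta> \<le> e * (2 * e)"
    using Fdist F_bdd[OF \<beta>X] F_least[of \<gamma> "c + e\<^sup>2"] f_le[OF \<gamma>X] by (simp add: power2_eq_square)
  then have dist: "path_dist \<gamma> \<beta> \<le> 2 * e" using e by simp
  have close: "p (\<gamma> t - \<beta> t) \<le> 2 * e" if "t \<in> {0..1}" for t
    using path_dist_upper[OF \<gamma> \<beta> that] dist by simp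
  have \<phi>\<beta>0: "\<phi> (\<beta> 0) = \<phi> (\<gamma> 0)" using \<beta>X V0[OF \<beta>X] V0[OF \<gamma>X] by (intro \<phi>_cong) (auto simp: X_def)
  have "F \<beta> \<le> c - e\<^sup>2"
  proof (rule ccontr)
    assume "\<not> ?thesis"
    then have big: "F \<beta> > c - e\<^sup>2" by simp
    \<comment> \<open>Half of the excess over the floor: parameters in \<open>C\<close> come within
      \<open>\<theta>\<close> of the supremum yet stay above the floor, while all others have room
      at least \<open>\<theta>\<close>, enough for the gain \<open>2 * e * h\<close>.\<close>
    define \<theta> where "\<theta> = (F \<beta> - (c - e\<^sup>2)) / 2"
    have \<theta>: "\<theta> > 0" "c - e\<^sup>2 < F \<beta> - \<theta>" using big by (auto simp: \<theta>_def field_simps)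
    define C where "C = {t\<in>{0..1}. \<not> near t \<and> F \<beta> - \<theta> \<le> \<phi> (\<beta> t)}"
    \<comment> \<open>Near parameter 0 the path is below the floor, hence outside \<open>C\<close>.
      This supplies the margin that \<open>descend_along_path\<close> demands.\<close>
    obtain \<tau> where \<tau>: "\<tau> > 0" "\<And>t. t \<in> {0..1} \<Longrightarrow> \<bar>t\<bar> < \<tau> \<Longrightarrow> \<phi> (\<beta> t) < c - e\<^sup>2"
    proof -
      have "continuous_on {0..1} (\<lambda>t. \<phi> (\<beta> t))" by (rule \<phi>_path_continuous[OF \<beta>])
      moreover have "c - e\<^sup>2 - \<phi> (\<beta> 0) > 0" using start \<phi>\<beta>0 by simp
      ultimately obtain \<tau> where \<tau>: "\<tau> > 0"
        "\<And>t. t \<in> {0..1} \<Longrightarrow> dist t 0 < \<tau> \<Longrightarrow> dist (\<phi> (\<beta> t)) (\<phi> (\<beta> 0)) < c - e\<^sup>2 - \<phi> (\<beta> 0)"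
        unfolding continuous_on_iff by (meson atLeastAtMost_iff order_refl zero_le_one)
      show thesis
      proof (rule that[OF \<tau>(1)])
        fix t :: real assume "t \<in> {0..1}" "\<bar>t\<bar> < \<tau>"
        then show "\<phi> (\<beta> t) < c - e\<^sup>2" using \<tau>(2)[of t] unfolding dist_real_def by linarith
      qed
    qed
    have steep: "\<exists>w\<in>V. p w \<le> 1 \<and> D (\<beta> t) w < - (3 * e)" if t: "t \<in> C" for t
    proof -
      have t01: "t \<in> {0..1}" using t by (simp add: C_def)
      have \<beta>V: "\<beta> t \<in> V" "\<gamma> t \<in> V" using \<beta> \<gamma> t01 by (auto intro: path_in_V)
      have "p (\<beta> t - \<gamma> t) < 3 * e" using close[OF t01] p_diff_commute[OF \<beta>V] e by simp
      moreover have "c - e\<^sup>2 \<le> \<phi> (\<beta> t)" using t \<theta> by (simp add: C_def)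
      moreover have "\<phi> (\<beta> t) \<le> c + e\<^sup>2" using \<beta>X upper[OF t01] t01 by (force simp: X_def)
      ultimately have "\<not> (\<forall>h\<in>V. \<bar>D (\<beta> t) h\<bar> \<le> 3 * e * p h)"
        using t \<beta>V unfolding C_def near_def by blast
      then obtain h where h: "h \<in> V" "\<bar>D (\<beta> t) h\<bar> > 3 * e * p h" by force
      have ph: "p h > 0"
      proof (rule ccontr)
        assume "\<not> p h > 0"
        then have "p h = 0" using h by (simp add: order_antisym)
        then show False using D_bounded[OF \<beta>V(1)] h by fastforce
      qed
      \<comment> \<open>Normalization together with the sign that makes the derivative negative;
        dividing is legitimate because \<open>p h = 0\<close> would force
        \<open>D (\<beta> t) h = 0\<close> by boundedness.\<close>
      define a where "a = - sgn (D (\<beta> t) h) / p h"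
      define w where "w = a \<cdot> h"
      have "D (\<beta> t) h \<noteq> 0" using h ph e by (auto simp: mult_less_0_iff)
      then have "\<bar>a\<bar> = 1 / p h" using ph by (simp add: a_def abs_divide abs_sgn_eq)
      then have "p w = 1" using ph h by (simp add: w_def p_scale)
      moreover have "D (\<beta> t) w = - \<bar>D (\<beta> t) h\<bar> / p h"
        unfolding w_def D_scale[OF \<beta>V(1) h(1)] by (simp add: a_def abs_sgn mult.commute)
      moreover have "- \<bar>D (\<beta> t) h\<bar> / p h < - (3 * e)" using h ph by (simp add: field_simps)
      ultimately show ?thesis using h by (intro bexI[of _ w]) (auto simp: w_def)
    qed
    have "\<exists>h0>0. \<forall>h. 0 < h \<and> h < h0 \<longrightarrow> (\<exists>\<beta>'. path_in \<beta>' \<and> \<beta>' 0 = \<beta> 0 \<and>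
      (\<forall>t\<in>{0..1}. p (\<beta>' t - \<beta> t) \<le> h \<and> \<phi> (\<beta>' t) \<le> \<phi> (\<beta> t) \<and>
         (t \<in> C \<longrightarrow> \<phi> (\<beta>' t) \<le> \<phi> (\<beta> t) - 2 * e * h)))"
    proof (rule descend_along_path[OF \<beta> e _ steep \<tau>(1)])
      fix t assume t: "t \<in> C"
      show "\<tau> \<le> t"
      proof (rule ccontr)
        assume "\<not> \<tau> \<le> t"
        then have "\<phi> (\<beta> t) < c - e\<^sup>2" using \<tau>(2)[of t] t by (auto simp: C_def)
        then show False using t \<theta> by (simp add: C_def)
      qed
    qed (auto simp: C_def)
    then obtain h0 where h0: "h0 > 0" "\<And>h. 0 < h \<Longrightarrow> h < h0 \<Longrightarrow> \<exists>\<beta>'. path_in \<beta>' \<and> \<beta>' 0 = \<beta> 0 \<and>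
      (\<forall>t\<in>{0..1}. p (\<beta>' t - \<beta> t) \<le> h \<and> \<phi> (\<beta>' t) \<le> \<phi> (\<beta> t) \<and>
         (t \<in> C \<longrightarrow> \<phi> (\<beta>' t) \<le> \<phi> (\<beta> t) - 2 * e * h))" by blast
    define h where "h = min (h0 / 2) (\<theta> / (2 * e))"
    have h: "0 < h" "h < h0" using h0(1) \<theta> e by (auto simp: h_def)
    have "h \<le> \<theta> / (2 * e)" by (simp add: h_def)
    then have h\<theta>: "2 * e * h \<le> \<theta>" using e by (simp add: field_simps)
    obtain \<beta>' where \<beta>': "path_in \<beta>'" "\<beta>' 0 = \<beta> 0"
      and \<beta>'t: "\<And>t. t \<in> {0..1} \<Longrightarrow> p (\<beta>' t - \<beta> t) \<le> h \<and> \<phi> (\<beta>' t) \<le> \<phi> (\<beta> t)"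
      and \<beta>'C: "\<And>t. t \<in> C \<Longrightarrow> \<phi> (\<beta>' t) \<le> \<phi> (\<beta> t) - 2 * e * h"
      using h0(2)[OF h] unfolding C_def by blast
    have \<beta>'X: "\<beta>' \<in> X" using \<beta>' \<beta>'t \<beta>X unfolding X_def by force
    have "F \<beta>' \<le> F \<beta> - 2 * e * h"
    proof (rule F_least)
      fix t :: real assume t: "t \<in> {0..1}"
      have base: "c - e\<^sup>2 \<le> F \<beta> - 2 * e * h" using \<theta> h\<theta> by simp
      show "f \<beta>' t \<le> F \<beta> - 2 * e * h"
      proof (cases "near t")
        case True then show ?thesis using base by (simp add: f_def)
      next
        case False
        have "\<phi> (\<beta>' t) \<le> F \<beta> - 2 * e * h"
        proof (cases "t \<in> C")
          case True
          then show ?thesis using \<beta>'C[OF True] F_upper[OF \<beta>X t] False by (simp add: f_def)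
        next
          case nC: False
          then have "\<phi> (\<beta> t) < F \<beta> - \<theta>" using t False by (simp add: C_def)
          then show ?thesis using \<beta>'t[OF t] h\<theta> by simp
        qed
        then show ?thesis using base False by (simp add: f_def)
      qed
    qed
    moreover have "path_dist \<beta> \<beta>' \<le> h"
    proof (rule path_dist_le)
      fix t :: real assume t: "t \<in> {0..1}"
      then show "p (\<beta> t - \<beta>' t) \<le> h"
        using \<beta>'t[OF t] p_diff_commute[OF path_in_V[OF \<beta> t] path_in_V[OF \<beta>'(1) t]] by simp
    qed
    then have "e * path_dist \<beta> \<beta>' \<le> e * h" using e by simp
    ultimately have "2 * (e * h) \<le> e * h" using minimal[OF \<beta>'X] by linarith
    then show False using e h by simp
  qed
  then have f\<beta>: "f \<beta> t \<le> c - e\<^sup>2" if "t \<in> {0..1}" for t using F_upper[OF \<beta>X that] by simp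
  show ?thesis
  proof (intro exI[of _ \<beta>] conjI ballI)
    fix t :: real assume t: "t \<in> {0..1}"
    show "\<phi> (\<beta> t) \<le> \<phi> (\<gamma> t)" using \<beta>X t by (simp add: X_def)
    show "p (\<beta> t - \<gamma> t) \<le> 2 * e"
      using close[OF t] p_diff_commute[OF path_in_V[OF \<beta> t] path_in_V[OF \<gamma> t]] by simp
    show "\<phi> (\<beta> t) \<le> c - e\<^sup>2 \<or> (\<exists>v\<in>V. p (v - \<gamma> t) < 3 * e \<and> c - e\<^sup>2 \<le> \<phi> v \<and> \<phi> v \<le> c + e\<^sup>2 \<and>
         (\<forall>h\<in>V. \<bar>D v h\<bar> \<le> 3 * e * p h))"
      using f\<beta>[OF t] unfolding f_def near_def by (auto split: if_splits)
  qed (use \<beta> \<beta>X in \<open>auto simp: X_def\<close>)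
qed

end

section \<open>Square integrable functions\<close>

definition L2 :: "'a measure \<Rightarrow> ('a \<Rightarrow> 'b::euclidean_space) set" where
  "L2 M = {f. f \<in> borel_measurable M \<and> integrable M (\<lambda>x. (norm (f x))\<^sup>2)}"

definition l2norm :: "'a measure \<Rightarrow> ('a \<Rightarrow> 'b::euclidean_space) \<Rightarrow> real" where
  "l2norm M f = sqrt (LINT x|M. (norm (f x))\<^sup>2)"

lemma L2_measurable [measurable_dest]: "f \<in> L2 M \<Longrightarrow> f \<in> borel_measurable M"
  and L2_integrable: "f \<in> L2 M \<Longrightarrow> integrable M (\<lambda>x. (norm (f x))\<^sup>2)"
  by (simp_all add: L2_def)

lemma l2norm_nonneg [simp]: "0 \<le> l2norm M f"
  by (simp add: l2norm_def)

lemma l2norm_power2: "(l2norm M f)\<^sup>2 = (LINT x|M. (norm (f x))\<^sup>2)"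
  by (simp add: l2norm_def)

lemma L2_bound:
  assumes "g \<in> L2 M" "f \<in> borel_measurable M" "AE x in M. norm (f x) \<le> K * norm (g x)"
  shows "f \<in> L2 M"
proof -
  have "integrable M (\<lambda>x. (norm (f x))\<^sup>2)"
  proof (rule Bochner_Integration.integrable_bound)
    show "integrable M (\<lambda>x. K\<^sup>2 * (norm (g x))\<^sup>2)" using L2_integrable[OF assms(1)] by simp
    show "AE x in M. norm ((norm (f x))\<^sup>2) \<le> norm (K\<^sup>2 * (norm (g x))\<^sup>2)"
      using assms(3)
    proof eventually_elim
      case (elim x)
      then have "(norm (f x))\<^sup>2 \<le> (K * norm (g x))\<^sup>2" by (intro power_mono) auto
      then show ?case by (simp add: power_mult_distrib)
    qed
  qed (use assms(2) in measurable)
  then show ?thesis using assms by (simp add: L2_def)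
qed

lemma l2norm_mono:
  assumes "g \<in> L2 M" "f \<in> borel_measurable M" "AE x in M. norm (f x) \<le> norm (g x)"
  shows "l2norm M f \<le> l2norm M g"
  unfolding l2norm_def
proof (rule real_sqrt_le_mono, rule integral_mono_AE)
  have "f \<in> L2 M" using L2_bound[OF assms(1,2), of 1] assms(3) by simp
  then show "integrable M (\<lambda>x. (norm (f x))\<^sup>2)" by (rule L2_integrable)
  show "AE x in M. (norm (f x))\<^sup>2 \<le> (norm (g x))\<^sup>2"
    using assms(3) by eventually_elim (auto intro: power_mono)
qed (rule L2_integrable[OF assms(1)])

lemma L2_zero [simp]: "(\<lambda>x. 0) \<in> L2 M"
  by (simp add: L2_def)

lemma L2_scaleR: "f \<in> L2 M \<Longrightarrow> (\<lambda>x. a *\<^sub>R f x) \<in> L2 M"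
  by (rule L2_bound[of f _ _ "\<bar>a\<bar>"]) auto

lemma L2_add:
  assumes [measurable]: "f \<in> L2 M" "g \<in> L2 M"
  shows "(\<lambda>x. f x + g x) \<in> L2 M"
proof -
  have "integrable M (\<lambda>x. (norm (f x + g x))\<^sup>2)"
  proof (rule Bochner_Integration.integrable_bound)
    show "integrable M (\<lambda>x. 2 * (norm (f x))\<^sup>2 + 2 * (norm (g x))\<^sup>2)"
      using L2_integrable[OF assms(1)] L2_integrable[OF assms(2)] by simp
    show "AE x in M. norm ((norm (f x + g x))\<^sup>2) \<le> norm (2 * (norm (f x))\<^sup>2 + 2 * (norm (g x))\<^sup>2)"
    proof (intro always_eventually allI)
      fix x
      have "(norm (f x + g x))\<^sup>2 \<le> (norm (f x) + norm (g x))\<^sup>2"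
        by (intro power_mono norm_triangle_ineq) simp
      also have "\<dots> \<le> 2 * (norm (f x))\<^sup>2 + 2 * (norm (g x))\<^sup>2"
        using zero_le_power2[of "norm (f x) - norm (g x)"] by (simp add: power2_eq_square algebra_simps)
      finally show "norm ((norm (f x + g x))\<^sup>2) \<le> norm (2 * (norm (f x))\<^sup>2 + 2 * (norm (g x))\<^sup>2)"
        by simp
    qed
  qed measurable
  then show ?thesis by (simp add: L2_def)
qed

lemma L2_diff:
  assumes "f \<in> L2 M" "g \<in> L2 M"
  shows "(\<lambda>x. f x - g x) \<in> L2 M"
  using L2_add[OF assms(1) L2_scaleR[OF assms(2), of "-1"]] by simp

lemma L2_norm: "f \<in> L2 M \<Longrightarrow> (\<lambda>x. norm (f x)) \<in> L2 M"
  by (rule L2_bound[of f _ _ 1]) auto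

lemma l2norm_scaleR:
  "l2norm M (\<lambda>x. a *\<^sub>R f x) = \<bar>a\<bar> * l2norm M f"
  by (simp add: l2norm_def power_mult_distrib real_sqrt_mult)

lemma l2norm_minus_commute: "l2norm M (\<lambda>x. f x - g x) = l2norm M (\<lambda>x. g x - f x)"
  by (simp add: l2norm_def norm_minus_commute)

lemma l2norm_eq_0_iff:
  assumes "f \<in> L2 M"
  shows "l2norm M f = 0 \<longleftrightarrow> (AE x in M. f x = 0)"
  unfolding l2norm_def real_sqrt_eq_0_iff
  using integral_nonneg_eq_0_iff_AE[OF L2_integrable[OF assms]] by simp

lemma L2_mult_integrable:
  assumes [measurable]: "f \<in> L2 M" "g \<in> L2 M"
  shows "integrable M (\<lambda>x. norm (f x) * norm (g x))"
proof (rule Bochner_Integration.integrable_bound)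
  show "integrable M (\<lambda>x. (norm (f x))\<^sup>2 + (norm (g x))\<^sup>2)"
    using L2_integrable[OF assms(1)] L2_integrable[OF assms(2)] by simp
  show "AE x in M. norm (norm (f x) * norm (g x)) \<le> norm ((norm (f x))\<^sup>2 + (norm (g x))\<^sup>2)"
  proof (intro always_eventually allI)
    fix x
    have "2 * (norm (f x) * norm (g x)) \<le> (norm (f x))\<^sup>2 + (norm (g x))\<^sup>2"
      using zero_le_power2[of "norm (f x) - norm (g x)"] by (simp add: power2_eq_square algebra_simps)
    moreover have "0 \<le> norm (f x) * norm (g x)" by simp
    ultimately have "norm (f x) * norm (g x) \<le> (norm (f x))\<^sup>2 + (norm (g x))\<^sup>2" by linarith
    then show "norm (norm (f x) * norm (g x)) \<le> norm ((norm (f x))\<^sup>2 + (norm (g x))\<^sup>2)" by simp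
  qed
qed measurable

text \<open>Young's inequality with the weights \<open>b / (2 * a)\<close> and
  \<open>a / (2 * b)\<close>, for which each square contributes exactly \<open>a * b / 2\<close>. If
  one norm vanishes, the product is zero almost everywhere.\<close>

lemma L2_Cauchy_Schwarz:
  assumes [measurable]: "f \<in> L2 M" "g \<in> L2 M"
  shows "(LINT x|M. norm (f x) * norm (g x)) \<le> l2norm M f * l2norm M g"
proof (cases "l2norm M f = 0 \<or> l2norm M g = 0")
  case True
  then have "AE x in M. norm (f x) * norm (g x) = 0"
    using l2norm_eq_0_iff[OF assms(1)] l2norm_eq_0_iff[OF assms(2)] by auto
  then have "(LINT x|M. norm (f x) * norm (g x)) = 0" by (rule integral_eq_zero_AE)
  then show ?thesis by simp
next
  case False
  define a b where "a = l2norm M f" and "b = l2norm M g"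
  have ab: "a > 0" "b > 0" using False by (auto simp: a_def b_def order_less_le)
  have "(LINT x|M. norm (f x) * norm (g x)) \<le>
      (LINT x|M. (b / (2 * a)) * (norm (f x))\<^sup>2 + (a / (2 * b)) * (norm (g x))\<^sup>2)"
  proof (rule integral_mono)
    show "integrable M (\<lambda>x. (b / (2 * a)) * (norm (f x))\<^sup>2 + (a / (2 * b)) * (norm (g x))\<^sup>2)"
      using L2_integrable[OF assms(1)] L2_integrable[OF assms(2)] by simp
    fix x
    have "0 \<le> (b * norm (f x) - a * norm (g x))\<^sup>2 / (2 * a * b)" using ab by simp
    also have "\<dots> = (b / (2 * a)) * (norm (f x))\<^sup>2 + (a / (2 * b)) * (norm (g x))\<^sup>2 - norm (f x) * norm (g x)"
      using ab by (simp add: power2_eq_square field_simps)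
    finally show "norm (f x) * norm (g x) \<le> (b / (2 * a)) * (norm (f x))\<^sup>2 + (a / (2 * b)) * (norm (g x))\<^sup>2"
      by simp
  qed (rule L2_mult_integrable[OF assms])
  also have "\<dots> = (b / (2 * a)) * a\<^sup>2 + (a / (2 * b)) * b\<^sup>2"
    unfolding a_def b_def l2norm_power2
    using L2_integrable[OF assms(1)] L2_integrable[OF assms(2)] by simp
  also have "\<dots> = a * b" using ab by (simp add: power2_eq_square)
  finally show ?thesis by (simp add: a_def b_def)
qed

lemma l2norm_triangle:
  assumes [measurable]: "f \<in> L2 M" "g \<in> L2 M"
  shows "l2norm M (\<lambda>x. f x + g x) \<le> l2norm M f + l2norm M g"
proof (rule power2_le_imp_le)
  have "(l2norm M (\<lambda>x. f x + g x))\<^sup>2 \<le>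
      (LINT x|M. (norm (f x))\<^sup>2 + (norm (g x))\<^sup>2 + 2 * (norm (f x) * norm (g x)))"
    unfolding l2norm_power2
  proof (rule integral_mono)
    fix x
    have "(norm (f x + g x))\<^sup>2 \<le> (norm (f x) + norm (g x))\<^sup>2"
      by (intro power_mono norm_triangle_ineq) simp
    then show "(norm (f x + g x))\<^sup>2 \<le> (norm (f x))\<^sup>2 + (norm (g x))\<^sup>2 + 2 * (norm (f x) * norm (g x))"
      by (simp add: power2_eq_square algebra_simps)
  qed (use L2_integrable[OF L2_add[OF assms]] L2_integrable[OF assms(1)] L2_integrable[OF assms(2)]
      L2_mult_integrable[OF assms] in auto)
  also have "\<dots> = (l2norm M f)\<^sup>2 + (l2norm M g)\<^sup>2 + 2 * (LINT x|M. norm (f x) * norm (g x))"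
    unfolding l2norm_power2
    using L2_integrable[OF assms(1)] L2_integrable[OF assms(2)] L2_mult_integrable[OF assms] by simp
  also have "\<dots> \<le> (l2norm M f + l2norm M g)\<^sup>2"
    using L2_Cauchy_Schwarz[OF assms] by (simp add: power2_eq_square algebra_simps)
  finally show "(l2norm M (\<lambda>x. f x + g x))\<^sup>2 \<le> (l2norm M f + l2norm M g)\<^sup>2" .
qed simp

lemma l2norm_diff_triangle:
  assumes "f \<in> L2 M" "g \<in> L2 M" "h \<in> L2 M"
  shows "l2norm M (\<lambda>x. f x - h x) \<le> l2norm M (\<lambda>x. f x - g x) + l2norm M (\<lambda>x. g x - h x)"
  using l2norm_triangle[OF L2_diff[OF assms(1,2)] L2_diff[OF assms(2,3)]] by simp

section \<open>Convergence and completeness in L^2\<close>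

lemma tendsto_zero_subseq:
  fixes a :: "nat \<Rightarrow> real"
  assumes "\<And>r :: nat \<Rightarrow> nat. strict_mono r \<Longrightarrow> \<exists>q. strict_mono (q :: nat \<Rightarrow> nat) \<and> (\<lambda>n. a (r (q n))) \<longlonglongrightarrow> 0"
  shows "a \<longlonglongrightarrow> 0"
proof (rule ccontr)
  assume "\<not> a \<longlonglongrightarrow> 0"
  then obtain e where e: "e > 0" "\<forall>N. \<exists>n\<ge>N. e \<le> \<bar>a n\<bar>"
    unfolding lim_sequentially dist_real_def by (force simp: not_less)
  then have inf: "infinite {n. e \<le> \<bar>a n\<bar>}" by (auto simp: infinite_nat_iff_unbounded_le)
  define r where "r = enumerate {n. e \<le> \<bar>a n\<bar>}"
  have r: "strict_mono r" "\<And>n. e \<le> \<bar>a (r n)\<bar>"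
    using strict_mono_enumerate[OF inf] enumerate_in_set[OF inf] by (auto simp: r_def)
  obtain q where "(\<lambda>n. a (r (q n))) \<longlonglongrightarrow> 0" using assms[OF r(1)] by blast
  then have "\<forall>\<^sub>F n in sequentially. \<bar>a (r (q n))\<bar> < e" using e(1) by (auto simp: tendsto_iff)
  then show False using r(2) by (auto simp: eventually_sequentially not_less[symmetric])
qed

lemma l2norm_AE_subseq:
  assumes s: "\<And>n. s n \<in> L2 M" and l: "l \<in> L2 M" and lim: "(\<lambda>n. l2norm M (\<lambda>x. s n x - l x)) \<longlonglongrightarrow> 0"
  shows "\<exists>r. strict_mono r \<and> (AE x in M. (\<lambda>n. s (r n) x) \<longlonglongrightarrow> l x)"
proof -
  have "\<exists>r. strict_mono r \<and> (AE x in M. (\<lambda>n. (norm (s (r n) x - l x))\<^sup>2) \<longlonglongrightarrow> 0)"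
  proof (rule tendsto_L1_AE_subseq[where u="\<lambda>n x. (norm (s n x - l x))\<^sup>2"])
    show "integrable M (\<lambda>x. (norm (s n x - l x))\<^sup>2)" for n by (rule L2_integrable[OF L2_diff[OF s l]])
    have "(\<lambda>n. (l2norm M (\<lambda>x. s n x - l x))\<^sup>2) \<longlonglongrightarrow> 0\<^sup>2" by (intro tendsto_power lim)
    then show "(\<lambda>n. LINT x|M. norm ((norm (s n x - l x))\<^sup>2)) \<longlonglongrightarrow> 0" by (simp add: l2norm_power2)
  qed
  then obtain r where r: "strict_mono r" "AE x in M. (\<lambda>n. (norm (s (r n) x - l x))\<^sup>2) \<longlonglongrightarrow> 0" by blast
  from r(2) have "AE x in M. (\<lambda>n. s (r n) x) \<longlonglongrightarrow> l x"
  proof eventually_elim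
    case (elim x)
    then have "(\<lambda>n. sqrt ((norm (s (r n) x - l x))\<^sup>2)) \<longlonglongrightarrow> sqrt 0" by (rule tendsto_real_sqrt)
    then show ?case by (simp add: LIM_zero_iff tendsto_norm_zero_iff)
  qed
  with r(1) show ?thesis by blast
qed

lemma l2norm_dominated_convergence:
  assumes [measurable]: "\<And>n. s n \<in> borel_measurable M" "l \<in> borel_measurable M" and g [measurable]: "g \<in> L2 M"
    and bound: "\<And>n. AE x in M. norm (s n x - l x) \<le> K * norm (g x)"
    and lim: "AE x in M. (\<lambda>n. s n x) \<longlonglongrightarrow> l x"
  shows "(\<lambda>n. l2norm M (\<lambda>x. s n x - l x)) \<longlonglongrightarrow> 0"
proof -
  have "(\<lambda>n. LINT x|M. (norm (s n x - l x))\<^sup>2) \<longlonglongrightarrow> (LINT x|M. 0)"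
  proof (rule integral_dominated_convergence)
    show "integrable M (\<lambda>x. (K * norm (g x))\<^sup>2)"
      using L2_integrable[OF g] by (simp add: power_mult_distrib)
    show "AE x in M. (\<lambda>n. (norm (s n x - l x))\<^sup>2) \<longlonglongrightarrow> 0"
      using lim
    proof eventually_elim
      case (elim x)
      then have "(\<lambda>n. (norm (s n x - l x))\<^sup>2) \<longlonglongrightarrow> (norm (l x - l x))\<^sup>2" by (intro tendsto_intros)
      then show ?case by simp
    qed
    show "AE x in M. norm ((norm (s n x - l x))\<^sup>2) \<le> (K * norm (g x))\<^sup>2" for n
      using bound[of n] by eventually_elim (auto intro: power_mono)
  qed measurable
  then have "(\<lambda>n. sqrt (LINT x|M. (norm (s n x - l x))\<^sup>2)) \<longlonglongrightarrow> sqrt 0"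
    by (intro tendsto_real_sqrt) simp
  then show ?thesis by (simp add: l2norm_def)
qed

text \<open>The difference splits into \<open>\<theta> (wn) (Gn - G)\<close>, small because
  \<open>\<theta>\<close> is bounded, and \<open>(\<theta> (wn) - \<theta> w) G\<close>. For the
  latter, every subsequence of \<open>wn\<close> has a further one converging almost everywhere, and
  \<open>2 * norm (G x)\<close> dominates; a discontinuity of \<open>\<theta>\<close> at
  \<open>w x\<close> does no harm where \<open>G x = 0\<close>. The case in view is the sign
  function.\<close>

lemma l2norm_multiplier_tendsto:
  fixes G :: "'a \<Rightarrow> 'b::euclidean_space" and w :: "'a \<Rightarrow> real"
  assumes Gn [measurable]: "\<And>n. Gn n \<in> L2 M" and G [measurable]: "G \<in> L2 M"
    and limG: "(\<lambda>n. l2norm M (\<lambda>x. Gn n x - G x)) \<longlonglongrightarrow> 0"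
    and wn [measurable]: "\<And>n. wn n \<in> L2 M" and w [measurable]: "w \<in> L2 M"
    and limw: "(\<lambda>n. l2norm M (\<lambda>x. wn n x - w x)) \<longlonglongrightarrow> 0"
    and [measurable]: "\<theta> \<in> borel_measurable borel" and \<theta>: "\<And>t. \<bar>\<theta> t\<bar> \<le> 1"
    and cont: "AE x in M. isCont \<theta> (w x) \<or> G x = 0"
  shows "(\<lambda>n. l2norm M (\<lambda>x. \<theta> (wn n x) *\<^sub>R Gn n x - \<theta> (w x) *\<^sub>R G x)) \<longlonglongrightarrow> 0"
proof -
  have L2\<theta>: "(\<lambda>x. \<theta> (v x) *\<^sub>R F x) \<in> L2 M"
    if [measurable]: "v \<in> borel_measurable M" "F \<in> L2 M" for v and F :: "'a \<Rightarrow> 'b"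
    by (rule L2_bound[of F _ _ 1]) (use that \<theta> in \<open>auto simp: mult_left_le_one_le\<close>)
  have second: "(\<lambda>n. l2norm M (\<lambda>x. \<theta> (wn n x) *\<^sub>R G x - \<theta> (w x) *\<^sub>R G x)) \<longlonglongrightarrow> 0"
  proof (rule tendsto_zero_subseq)
    fix r :: "nat \<Rightarrow> nat" assume r: "strict_mono r"
    have "(\<lambda>n. l2norm M (\<lambda>x. wn (r n) x - w x)) \<longlonglongrightarrow> 0"
      using LIMSEQ_subseq_LIMSEQ[OF limw r] by (simp add: o_def)
    from l2norm_AE_subseq[of "\<lambda>n. wn (r n)", OF wn w this]
    obtain q where q: "strict_mono q" "AE x in M. (\<lambda>n. wn (r (q n)) x) \<longlonglongrightarrow> w x" by blast
    have "(\<lambda>n. l2norm M (\<lambda>x. \<theta> (wn (r (q n)) x) *\<^sub>R G x - \<theta> (w x) *\<^sub>R G x)) \<longlonglongrightarrow> 0"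
    proof (rule l2norm_dominated_convergence[OF _ _ G, of _ _ 2])
      show "AE x in M. (\<lambda>n. \<theta> (wn (r (q n)) x) *\<^sub>R G x) \<longlonglongrightarrow> \<theta> (w x) *\<^sub>R G x"
        using q(2) cont
      proof eventually_elim
        case (elim x)
        then show ?case
          by (cases "G x = 0") (auto intro!: tendsto_scaleR isCont_tendsto_compose[of _ \<theta>])
      qed
      show "AE x in M. norm (\<theta> (wn (r (q n)) x) *\<^sub>R G x - \<theta> (w x) *\<^sub>R G x) \<le> 2 * norm (G x)" for n
      proof (intro always_eventually allI)
        fix x
        have "\<bar>\<theta> (wn (r (q n)) x) - \<theta> (w x)\<bar> \<le> 2"
          using \<theta>[of "wn (r (q n)) x"] \<theta>[of "w x"] by linarith
        then show "norm (\<theta> (wn (r (q n)) x) *\<^sub>R G x - \<theta> (w x) *\<^sub>R G x) \<le> 2 * norm (G x)"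
          by (simp add: scaleR_diff_left[symmetric] mult_right_mono)
      qed
    qed measurable
    then show "\<exists>q. strict_mono q \<and> (\<lambda>n. l2norm M (\<lambda>x. \<theta> (wn (r (q n)) x) *\<^sub>R G x - \<theta> (w x) *\<^sub>R G x)) \<longlonglongrightarrow> 0"
      using q(1) by blast
  qed
  show ?thesis
  proof (rule Lim_null_comparison)
    show "(\<lambda>n. l2norm M (\<lambda>x. Gn n x - G x) + l2norm M (\<lambda>x. \<theta> (wn n x) *\<^sub>R G x - \<theta> (w x) *\<^sub>R G x)) \<longlonglongrightarrow> 0"
      by (intro tendsto_add_zero limG second)
    show "\<forall>\<^sub>F n in sequentially. norm (l2norm M (\<lambda>x. \<theta> (wn n x) *\<^sub>R Gn n x - \<theta> (w x) *\<^sub>R G x))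
        \<le> l2norm M (\<lambda>x. Gn n x - G x) + l2norm M (\<lambda>x. \<theta> (wn n x) *\<^sub>R G x - \<theta> (w x) *\<^sub>R G x)"
    proof (intro always_eventually allI)
      fix n
      have "l2norm M (\<lambda>x. \<theta> (wn n x) *\<^sub>R Gn n x - \<theta> (w x) *\<^sub>R G x) \<le>
          l2norm M (\<lambda>x. \<theta> (wn n x) *\<^sub>R Gn n x - \<theta> (wn n x) *\<^sub>R G x) +
          l2norm M (\<lambda>x. \<theta> (wn n x) *\<^sub>R G x - \<theta> (w x) *\<^sub>R G x)"
        by (intro l2norm_diff_triangle L2\<theta>) (use wn w Gn G in measurable)
      moreover have "l2norm M (\<lambda>x. \<theta> (wn n x) *\<^sub>R Gn n x - \<theta> (wn n x) *\<^sub>R G x) \<le> l2norm M (\<lambda>x. Gn n x - G x)"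
        by (rule l2norm_mono[OF L2_diff[OF Gn G]])
          (use \<theta> in \<open>auto simp: scaleR_diff_right[symmetric] mult_left_le_one_le\<close>)
      ultimately show "norm (l2norm M (\<lambda>x. \<theta> (wn n x) *\<^sub>R Gn n x - \<theta> (w x) *\<^sub>R G x))
        \<le> l2norm M (\<lambda>x. Gn n x - G x) + l2norm M (\<lambda>x. \<theta> (wn n x) *\<^sub>R G x - \<theta> (w x) *\<^sub>R G x)"
        by simp
    qed
  qed
qed

text \<open>Riesz-Fischer: a rapidly Cauchy subsequence converges almost everywhere, and Fatou's
  lemma turns the Cauchy estimate into one for the distance to the limit.\<close>

lemma l2_complete:
  fixes s :: "nat \<Rightarrow> 'a \<Rightarrow> 'b::euclidean_space"
  assumes s [measurable]: "\<And>n. s n \<in> L2 M"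
    and Cauchy: "\<And>r. r > 0 \<Longrightarrow> \<exists>N. \<forall>m\<ge>N. \<forall>n\<ge>m. l2norm M (\<lambda>x. s m x - s n x) < r"
  shows "\<exists>l\<in>L2 M. (\<lambda>n. l2norm M (\<lambda>x. s n x - l x)) \<longlonglongrightarrow> 0"
proof -
  have "\<exists>N. \<forall>k. (\<forall>m\<ge>N k. \<forall>n\<ge>m. l2norm M (\<lambda>x. s m x - s n x) < (1/4)^k)"
    by (rule choice) (use Cauchy in simp)
  then obtain N where N: "\<And>k m n. m \<ge> N k \<Longrightarrow> n \<ge> m \<Longrightarrow> l2norm M (\<lambda>x. s m x - s n x) < (1/4)^k"
    by blast
  \<comment> \<open>Summing the thresholds gives indices that dominate every \<open>N k\<close>; the
    added \<open>k\<close> makes them strictly increasing.\<close>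
  define r where "r k = (\<Sum>i\<le>k. N i) + k" for k
  have rN: "N k \<le> r k" for k unfolding r_def by (intro trans_le_add1 member_le_sum) auto
  have r_mono: "strict_mono r" unfolding r_def by (rule strict_monoI_Suc) simp
  define d where "d k x = norm (s (r (Suc k)) x - s (r k) x)" for k x
  have d_meas [measurable]: "d k \<in> borel_measurable M" for k unfolding d_def by measurable
  have d_L2: "l2norm M (\<lambda>x. s (r (Suc k)) x - s (r k) x) \<le> (1/4)^k" for k
    using N[OF rN strict_mono_leD[OF r_mono], of k "Suc k"] by (subst l2norm_minus_commute) simp
  \<comment> \<open>The weights \<open>4^k\<close> turn finiteness of the sum of squares into geometric decay of \<open>d k x\<close>.\<close>
  have nn: "(\<integral>\<^sup>+x. ennreal (4^k * (d k x)\<^sup>2) \<partial>M) \<le> ennreal ((1/4)^k)" for k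
  proof -
    have int: "integrable M (\<lambda>x. (d k x)\<^sup>2)" unfolding d_def by (rule L2_integrable[OF L2_diff[OF s s]])
    have "(\<integral>\<^sup>+x. ennreal (4^k * (d k x)\<^sup>2) \<partial>M) = ennreal (4^k * (l2norm M (\<lambda>x. s (r (Suc k)) x - s (r k) x))\<^sup>2)"
      using int by (subst nn_integral_eq_integral) (auto simp: l2norm_power2 d_def)
    also have "\<dots> \<le> ennreal (4^k * ((1/4)^k)\<^sup>2)"
      using d_L2[of k] by (intro ennreal_leI mult_left_mono power_mono) auto
    also have "4^k * ((1/4::real)^k)\<^sup>2 = (1/4)^k" by (simp add: power2_eq_square power_one_over)
    finally show ?thesis .
  qed
  have "(\<integral>\<^sup>+x. (\<Sum>k. ennreal (4^k * (d k x)\<^sup>2)) \<partial>M) = (\<Sum>k. \<integral>\<^sup>+x. ennreal (4^k * (d k x)\<^sup>2) \<partial>M)"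
    by (rule nn_integral_suminf) measurable
  also have "\<dots> \<le> (\<Sum>k. ennreal ((1/4)^k))" by (intro suminf_le nn) auto
  also have "\<dots> < \<infinity>"
    by (subst suminf_ennreal2) auto
  finally have "AE x in M. (\<Sum>k. ennreal (4^k * (d k x)\<^sup>2)) \<noteq> \<infinity>"
    by (intro nn_integral_PInf_AE) (auto simp: less_top)
  then have AE_conv: "AE x in M. convergent (\<lambda>k. s (r k) x)"
  proof eventually_elim
    case (elim x)
    define C where "C = enn2real (\<Sum>k. ennreal (4^k * (d k x)\<^sup>2))"
    have "d k x \<le> sqrt C * (1/2)^k" for k
    proof -
      have "(\<Sum>k\<in>{k}. ennreal (4^k * (d k x)\<^sup>2)) \<le> (\<Sum>k. ennreal (4^k * (d k x)\<^sup>2))"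
        by (rule sum_le_suminf) auto
      also have "\<dots> = ennreal C" using elim by (simp add: C_def ennreal_enn2real_if)
      finally have "4^k * (d k x)\<^sup>2 \<le> C" by (simp add: C_def)
      then have "sqrt (4^k * (d k x)\<^sup>2) \<le> sqrt C" by (rule real_sqrt_le_mono)
      moreover have "sqrt (4^k * (d k x)\<^sup>2) = 2^k * d k x"
        by (simp add: real_sqrt_mult real_sqrt_power d_def)
      ultimately have "2^k * d k x \<le> sqrt C" by simp
      then show ?thesis by (simp add: power_one_over divide_inverse[symmetric] pos_le_divide_eq mult.commute)
    qed
    then have le: "norm (s (r (Suc k)) x - s (r k) x) \<le> sqrt C * (1/2)^k" for k by (simp only: d_def)
    have "summable (\<lambda>k. sqrt C * (1/2)^k)" by (intro summable_mult summable_geometric) simp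
    then have "summable (\<lambda>k. s (r (Suc k)) x - s (r k) x)"
      by (rule summable_comparison_test'[where N=0]) (rule le)
    then have "convergent (\<lambda>n. \<Sum>k<n. s (r (Suc k)) x - s (r k) x)" by (simp add: summable_iff_convergent)
    then have "convergent (\<lambda>n. s (r n) x - s (r 0) x)"
      using sum_lessThan_telescope[of "\<lambda>n. s (r n) x"] by simp
    then show ?case by (simp add: convergent_diff_const_right_iff)
  qed
  \<comment> \<open>Where the subsequence diverges, \<open>lim\<close> takes a value of no
    importance, and the resulting function is still measurable.\<close>
  define l where "l x = lim (\<lambda>k. s (r k) x)" for x
  have l_meas [measurable]: "l \<in> borel_measurable M"
    unfolding l_def by (rule borel_measurable_lim_metric) measurable
  have AE_lim: "AE x in M. (\<lambda>k. s (r k) x) \<longlonglongrightarrow> l x"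
    using AE_conv by eventually_elim (simp add: l_def convergent_LIMSEQ_iff)
  have Fatou: "(\<lambda>x. s n x - l x) \<in> L2 M \<and> l2norm M (\<lambda>x. s n x - l x) \<le> e"
    if e: "e > 0" and le: "\<And>k. k \<ge> n \<Longrightarrow> l2norm M (\<lambda>x. s n x - s k x) \<le> e" for n e
  proof -
    have "(\<integral>\<^sup>+x. ennreal ((norm (s n x - l x))\<^sup>2) \<partial>M) \<le>
        (\<integral>\<^sup>+x. liminf (\<lambda>k. ennreal ((norm (s n x - s (r k) x))\<^sup>2)) \<partial>M)"
    proof (rule nn_integral_mono_AE)
      show "AE x in M. ennreal ((norm (s n x - l x))\<^sup>2) \<le> liminf (\<lambda>k. ennreal ((norm (s n x - s (r k) x))\<^sup>2))"
        using AE_lim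
      proof eventually_elim
        case (elim x)
        then have "(\<lambda>k. ennreal ((norm (s n x - s (r k) x))\<^sup>2)) \<longlonglongrightarrow> ennreal ((norm (s n x - l x))\<^sup>2)"
          by (intro tendsto_ennrealI tendsto_intros)
        then show ?case using lim_imp_Liminf[of sequentially] by fastforce
      qed
    qed
    also have "\<dots> \<le> liminf (\<lambda>k. \<integral>\<^sup>+x. ennreal ((norm (s n x - s (r k) x))\<^sup>2) \<partial>M)"
      by (rule nn_integral_liminf) measurable
    also have "\<dots> \<le> liminf (\<lambda>k::nat. ennreal (e\<^sup>2))"
    proof (rule Liminf_mono)
      have "(\<integral>\<^sup>+x. ennreal ((norm (s n x - s (r k) x))\<^sup>2) \<partial>M) \<le> ennreal (e\<^sup>2)" if "k \<ge> n" for k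
      proof -
        have "n \<le> r k" using that seq_suble[OF r_mono, of k] by simp
        then have "(l2norm M (\<lambda>x. s n x - s (r k) x))\<^sup>2 \<le> e\<^sup>2" by (intro power_mono le) auto
        then show ?thesis
          by (subst nn_integral_eq_integral[OF L2_integrable[OF L2_diff[OF s s]]])
            (auto simp: l2norm_power2)
      qed
      then show "\<forall>\<^sub>F k in sequentially. (\<integral>\<^sup>+x. ennreal ((norm (s n x - s (r k) x))\<^sup>2) \<partial>M) \<le> ennreal (e\<^sup>2)"
        by (auto simp: eventually_sequentially)
    qed
    finally have nn: "(\<integral>\<^sup>+x. ennreal ((norm (s n x - l x))\<^sup>2) \<partial>M) \<le> ennreal (e\<^sup>2)" by (simp add: Liminf_const)
    have int: "integrable M (\<lambda>x. (norm (s n x - l x))\<^sup>2)"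
      by (rule integrableI_bounded) (use nn in \<open>auto simp: less_top[symmetric] top_unique\<close>)
    have "(l2norm M (\<lambda>x. s n x - l x))\<^sup>2 \<le> e\<^sup>2"
      using nn nn_integral_eq_integral[OF int] by (simp add: l2norm_power2 ennreal_le_iff)
    then have "l2norm M (\<lambda>x. s n x - l x) \<le> e" by (rule power2_le_imp_le) (use e in simp)
    moreover have "(\<lambda>x. s n x - l x) \<in> borel_measurable M" by measurable
    ultimately show ?thesis using int by (simp add: L2_def)
  qed
  have unif: "\<exists>N. \<forall>n\<ge>N. (\<lambda>x. s n x - l x) \<in> L2 M \<and> l2norm M (\<lambda>x. s n x - l x) \<le> e" if "e > 0" for e
  proof -
    obtain N where N: "\<And>m n. m \<ge> N \<Longrightarrow> n \<ge> m \<Longrightarrow> l2norm M (\<lambda>x. s m x - s n x) < e"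
      using Cauchy[OF \<open>e > 0\<close>] by blast
    show ?thesis
      by (intro exI[of _ N] allI impI Fatou \<open>e > 0\<close>) (rule less_imp_le[OF N])
  qed
  \<comment> \<open>Fatou gives square integrability only for the differences; \<open>l\<close> is
    recovered as \<open>s n - (s n - l)\<close>.\<close>
  obtain n where "(\<lambda>x. s n x - l x) \<in> L2 M" using unif[of 1] by auto
  from L2_diff[OF s[of n] this] have "l \<in> L2 M" by simp
  moreover have "(\<lambda>n. l2norm M (\<lambda>x. s n x - l x)) \<longlonglongrightarrow> 0"
  proof (rule LIMSEQ_I)
    fix e :: real assume "e > 0"
    then obtain N where "\<And>n. n \<ge> N \<Longrightarrow> l2norm M (\<lambda>x. s n x - l x) \<le> e / 2" using unif[of "e/2"] by auto
    with \<open>e > 0\<close> show "\<exists>no. \<forall>n\<ge>no. norm (l2norm M (\<lambda>x. s n x - l x) - 0) < e"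
      by (intro exI[of _ N]) force
  qed
  ultimately show ?thesis by blast
qed

lemma L2_Pair:
  assumes "f \<in> L2 M" "g \<in> L2 M"
  shows "(\<lambda>x. (f x, g x)) \<in> L2 M"
  using assms by (auto simp: L2_def norm_Pair intro: borel_measurable_Pair)

lemma L2_fst:
  assumes "F \<in> L2 M" shows "(\<lambda>x. fst (F x)) \<in> L2 M"
proof (rule L2_bound[OF assms, of _ 1])
  have "fst \<in> borel_measurable borel" by (intro borel_measurable_continuous_onI continuous_intros)
  then show "(\<lambda>x. fst (F x)) \<in> borel_measurable M" by (rule measurable_compose[OF L2_measurable[OF assms]])
  show "AE x in M. norm (fst (F x)) \<le> 1 * norm (F x)"
    using norm_fst_le[of "fst (F x)" "snd (F x)" for x] by simp
qed

lemma L2_snd: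
  assumes "F \<in> L2 M" shows "(\<lambda>x. snd (F x)) \<in> L2 M"
proof (rule L2_bound[OF assms, of _ 1])
  have "snd \<in> borel_measurable borel" by (intro borel_measurable_continuous_onI continuous_intros)
  then show "(\<lambda>x. snd (F x)) \<in> borel_measurable M" by (rule measurable_compose[OF L2_measurable[OF assms]])
  show "AE x in M. norm (snd (F x)) \<le> 1 * norm (F x)"
    using norm_snd_le[of "snd (F x)" "fst (F x)" for x] by simp
qed

text \<open>A function and its gradient are treated as one square integrable pair whose norm is the
  H^1 norm. These comparisons translate convergence in H^1 into convergence of both
  components.\<close>

lemma l2norm_Pair:
  assumes "f \<in> L2 M" "g \<in> L2 M"
  shows "l2norm M f \<le> l2norm M (\<lambda>x. (f x, g x))" "l2norm M g \<le> l2norm M (\<lambda>x. (f x, g x))"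
    "l2norm M (\<lambda>x. (f x, g x)) \<le> l2norm M f + l2norm M g"
proof -
  note P = L2_Pair[OF assms]
  show "l2norm M f \<le> l2norm M (\<lambda>x. (f x, g x))"
    by (rule l2norm_mono[OF P L2_measurable[OF assms(1)]]) (simp add: norm_fst_le)
  show "l2norm M g \<le> l2norm M (\<lambda>x. (f x, g x))"
    by (rule l2norm_mono[OF P L2_measurable[OF assms(2)]]) (simp add: norm_snd_le)
  have "(l2norm M (\<lambda>x. (f x, g x)))\<^sup>2 = (l2norm M f)\<^sup>2 + (l2norm M g)\<^sup>2"
    using assms by (simp add: l2norm_power2 norm_Pair L2_integrable)
  also have "\<dots> \<le> (l2norm M f + l2norm M g)\<^sup>2" by (simp add: power2_eq_square algebra_simps)
  finally show "l2norm M (\<lambda>x. (f x, g x)) \<le> l2norm M f + l2norm M g" by (rule power2_le_imp_le) simp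
qed

lemma L2_nth:
  fixes G :: "'a \<Rightarrow> real^'n::finite"
  assumes "G \<in> L2 M" shows "(\<lambda>x. G x $ i) \<in> L2 M"
proof (rule L2_bound[OF assms, of _ 1])
  have "(\<lambda>v::real^'n. v $ i) \<in> borel_measurable borel"
    by (intro borel_measurable_continuous_onI continuous_intros)
  then show "(\<lambda>x. G x $ i) \<in> borel_measurable M" by (rule measurable_compose[OF L2_measurable[OF assms]])
qed (simp add: component_le_norm_cart)

lemma L2_mult_integrable_real:
  fixes f g :: "'a \<Rightarrow> real"
  assumes "f \<in> L2 M" "g \<in> L2 M"
  shows "integrable M (\<lambda>x. f x * g x)"
  by (rule Bochner_Integration.integrable_bound[OF L2_mult_integrable[OF assms]])
    (use L2_measurable[OF assms(1)] L2_measurable[OF assms(2)] in \<open>auto simp: abs_mult\<close>)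

lemma L2_integral_tendsto:
  fixes f :: "nat \<Rightarrow> 'a \<Rightarrow> real"
  assumes fn: "\<And>n. f n \<in> L2 M" and f: "l \<in> L2 M" and g: "g \<in> L2 M"
    and lim: "(\<lambda>n. l2norm M (\<lambda>x. f n x - l x)) \<longlonglongrightarrow> 0"
  shows "(\<lambda>n. LINT x|M. f n x * g x) \<longlonglongrightarrow> (LINT x|M. l x * g x)"
proof -
  have "(\<lambda>n. (LINT x|M. f n x * g x) - (LINT x|M. l x * g x)) \<longlonglongrightarrow> 0"
  proof (rule Lim_null_comparison)
    show "(\<lambda>n. l2norm M (\<lambda>x. f n x - l x) * l2norm M g) \<longlonglongrightarrow> 0"
      using tendsto_mult_right[OF lim, of "l2norm M g"] by simp
    show "\<forall>\<^sub>F n in sequentially. norm ((LINT x|M. f n x * g x) - (LINT x|M. l x * g x)) \<le>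
        l2norm M (\<lambda>x. f n x - l x) * l2norm M g"
    proof (intro always_eventually allI)
      fix n
      have "(LINT x|M. f n x * g x) - (LINT x|M. l x * g x) = (LINT x|M. (f n x - l x) * g x)"
        using L2_mult_integrable_real[OF fn[of n] g] L2_mult_integrable_real[OF f g] by (simp add: left_diff_distrib)
      also have "norm \<dots> \<le> (LINT x|M. norm ((f n x - l x) * g x))" by (rule integral_norm_bound)
      also have "\<dots> \<le> l2norm M (\<lambda>x. f n x - l x) * l2norm M g"
        using L2_Cauchy_Schwarz[OF L2_diff[OF fn[of n] f] g] by (simp add: abs_mult)
      finally show "norm ((LINT x|M. f n x * g x) - (LINT x|M. l x * g x)) \<le>
        l2norm M (\<lambda>x. f n x - l x) * l2norm M g" .
    qed
  qed
  then show ?thesis by (simp add: LIM_zero_iff)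
qed

text \<open>This is the shape of the polarization, \<open>u + (1/2) (S |w| - w)\<close>, and also of
  its gradient, so one lemma serves both components of the H^1 norm.\<close>

lemma l2norm_lincomb_tendsto:
  fixes f g h :: "'a \<Rightarrow> 'b::euclidean_space"
  assumes L: "\<And>n. fn n \<in> L2 M" "f \<in> L2 M" "\<And>n. gn n \<in> L2 M" "g \<in> L2 M" "\<And>n. hn n \<in> L2 M" "h \<in> L2 M"
    and lim: "(\<lambda>n. l2norm M (\<lambda>x. fn n x - f x)) \<longlonglongrightarrow> 0" "(\<lambda>n. l2norm M (\<lambda>x. gn n x - g x)) \<longlonglongrightarrow> 0"
      "(\<lambda>n. l2norm M (\<lambda>x. hn n x - h x)) \<longlonglongrightarrow> 0"
  shows "(\<lambda>n. l2norm M (\<lambda>x. (fn n x + (1/2) *\<^sub>R (gn n x - hn n x)) - (f x + (1/2) *\<^sub>R (g x - h x)))) \<longlonglongrightarrow> 0"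
proof (rule tendsto_sandwich[OF _ _ tendsto_const])
  show "(\<lambda>n. l2norm M (\<lambda>x. fn n x - f x) + (\<bar>1/2\<bar> * l2norm M (\<lambda>x. gn n x - g x) +
      \<bar>-1/2\<bar> * l2norm M (\<lambda>x. hn n x - h x))) \<longlonglongrightarrow> 0"
    by (intro tendsto_add_zero tendsto_mult_right_zero lim)
  have "l2norm M (\<lambda>x. (fn n x + (1/2) *\<^sub>R (gn n x - hn n x)) - (f x + (1/2) *\<^sub>R (g x - h x))) \<le>
      l2norm M (\<lambda>x. fn n x - f x) + (\<bar>1/2\<bar> * l2norm M (\<lambda>x. gn n x - g x) + \<bar>-1/2\<bar> * l2norm M (\<lambda>x. hn n x - h x))" for n
  proof -
    note d = L2_diff[OF L(1)[of n] L(2)] L2_diff[OF L(3)[of n] L(4)] L2_diff[OF L(5)[of n] L(6)]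
    have "l2norm M (\<lambda>x. (fn n x + (1/2) *\<^sub>R (gn n x - hn n x)) - (f x + (1/2) *\<^sub>R (g x - h x))) =
        l2norm M (\<lambda>x. (fn n x - f x) + ((1/2) *\<^sub>R (gn n x - g x) + (-1/2) *\<^sub>R (hn n x - h x)))"
      by (simp add: algebra_simps)
    also have "\<dots> \<le> l2norm M (\<lambda>x. fn n x - f x) +
        l2norm M (\<lambda>x. (1/2) *\<^sub>R (gn n x - g x) + (-1/2) *\<^sub>R (hn n x - h x))"
      by (intro l2norm_triangle L2_add L2_scaleR d)
    also have "l2norm M (\<lambda>x. (1/2) *\<^sub>R (gn n x - g x) + (-1/2) *\<^sub>R (hn n x - h x)) \<le>
        l2norm M (\<lambda>x. (1/2) *\<^sub>R (gn n x - g x)) + l2norm M (\<lambda>x. (-1/2) *\<^sub>R (hn n x - h x))"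
      by (intro l2norm_triangle L2_scaleR d)
    finally show ?thesis unfolding l2norm_scaleR by simp
  qed
  then show "\<forall>\<^sub>F n in sequentially. l2norm M (\<lambda>x. (fn n x + (1/2) *\<^sub>R (gn n x - hn n x)) - (f x + (1/2) *\<^sub>R (g x - h x))) \<le>
      l2norm M (\<lambda>x. fn n x - f x) + (\<bar>1/2\<bar> * l2norm M (\<lambda>x. gn n x - g x) + \<bar>-1/2\<bar> * l2norm M (\<lambda>x. hn n x - h x))"
    by (intro always_eventually allI)
qed simp

section \<open>Smooth functions and test functions\<close>

lemma partial_deriv_eq:
  assumes "(f has_derivative f') (at x)"
  shows "partial_deriv i f x = f' (axis i 1)"
  using frechet_derivative_at[OF assms] by (simp add: partial_deriv_def)

lemma C_k_differentiable: "C_k (Suc k) f \<Longrightarrow> (f has_derivative frechet_derivative f (at x)) (at x)"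
  by (simp add: frechet_derivative_works)

lemma C_k_SucI:
  assumes "\<And>x. (f has_derivative f' x) (at x)" "\<And>i. C_k k (\<lambda>x. f' x (axis i 1))"
  shows "C_k (Suc k) f"
proof -
  have "partial_deriv i f = (\<lambda>x. f' x (axis i 1))" for i
    using partial_deriv_eq[OF assms(1)] by auto
  then show ?thesis using assms by (auto simp: differentiable_def)
qed

lemma C_k_continuous: "C_k k f \<Longrightarrow> continuous_on UNIV f"
  by (cases k) (auto intro!: differentiable_imp_continuous_on simp: differentiable_on_def)

lemma C_k_Suc_imp: "C_k (Suc k) f \<Longrightarrow> C_k k f"
proof (induction k arbitrary: f)
  case 0 then show ?case using C_k_continuous[of "Suc 0"] by simp
next
  case (Suc k)
  from Suc.prems have "(\<forall>x. f differentiable at x) \<and> (\<forall>i. C_k (Suc k) (partial_deriv i f))"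
    by (subst (asm) C_k.simps(2))
  then show ?case using Suc.IH unfolding C_k.simps(2)[of k f] by blast
qed

lemma C_k_const: "C_k k (\<lambda>x. c)"
proof (induction k arbitrary: c)
  case (Suc k)
  show ?case by (rule C_k_SucI[of _ "\<lambda>x h. 0"]) (auto intro: Suc)
qed simp

lemma C_k_add: "C_k k f \<Longrightarrow> C_k k g \<Longrightarrow> C_k k (\<lambda>x. f x + g x)"
proof (induction k arbitrary: f g)
  case 0 then show ?case by (auto intro: continuous_intros)
next
  case (Suc k)
  show ?case
  proof (rule C_k_SucI)
    show "((\<lambda>x. f x + g x) has_derivative (\<lambda>h. frechet_derivative f (at x) h + frechet_derivative g (at x) h)) (at x)"
      for x by (intro has_derivative_add C_k_differentiable[OF Suc.prems(1)] C_k_differentiable[OF Suc.prems(2)])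
    show "C_k k (\<lambda>x. frechet_derivative f (at x) (axis i 1) + frechet_derivative g (at x) (axis i 1))" for i
      using Suc.IH[of "partial_deriv i f" "partial_deriv i g"] Suc.prems
      by (simp add: partial_deriv_def[abs_def])
  qed
qed

lemma C_k_mult: "C_k k f \<Longrightarrow> C_k k g \<Longrightarrow> C_k k (\<lambda>x. f x * g x)"
proof (induction k arbitrary: f g)
  case 0 then show ?case by (auto intro: continuous_intros)
next
  case (Suc k)
  show ?case
  proof (rule C_k_SucI)
    show "((\<lambda>x. f x * g x) has_derivative
        (\<lambda>h. f x * frechet_derivative g (at x) h + frechet_derivative f (at x) h * g x)) (at x)"
      for x by (intro has_derivative_mult C_k_differentiable[OF Suc.prems(1)] C_k_differentiable[OF Suc.prems(2)])
    have fg: "C_k k f" "C_k k g" using Suc.prems by (auto intro: C_k_Suc_imp)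
    have "C_k k (partial_deriv i f)" "C_k k (partial_deriv i g)" for i using Suc.prems by auto
    then have "C_k k (\<lambda>x. f x * partial_deriv i g x + partial_deriv i f x * g x)" for i
      using fg by (intro C_k_add Suc.IH)
    then show "C_k k (\<lambda>x. f x * frechet_derivative g (at x) (axis i 1) + frechet_derivative f (at x) (axis i 1) * g x)"
      for i by (simp add: partial_deriv_def)
  qed
qed

lemma C_k_cmult: "C_k k f \<Longrightarrow> C_k k (\<lambda>x. c * f x)"
  by (rule C_k_mult[OF C_k_const])

lemma C_k_sum: "(\<And>i. i \<in> I \<Longrightarrow> C_k k (f i)) \<Longrightarrow> C_k k (\<lambda>x. \<Sum>i\<in>I. f i x)"
  by (induction I rule: infinite_finite_induct) (auto intro: C_k_const C_k_add)

lemma C_k_prod: "(\<And>i. i \<in> I \<Longrightarrow> C_k k (f i)) \<Longrightarrow> C_k k (\<lambda>x. \<Prod>i\<in>I. f i x)"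
  by (induction I rule: infinite_finite_induct) (auto intro: C_k_const C_k_mult)

lemma frechet_derivative_eq_sum_partial_deriv:
  assumes "(f::real^'n::finite \<Rightarrow> real) differentiable at x"
  shows "frechet_derivative f (at x) h = (\<Sum>i\<in>UNIV. h $ i * partial_deriv i f x)"
proof -
  have lin: "linear (frechet_derivative f (at x))"
    by (rule linear_frechet_derivative[OF assms])
  have "frechet_derivative f (at x) h = frechet_derivative f (at x) (\<Sum>i\<in>UNIV. h $ i *\<^sub>R axis i 1)"
    by (simp add: basis_expansion flip: scalar_mult_eq_scaleR)
  also have "\<dots> = (\<Sum>i\<in>UNIV. h $ i * partial_deriv i f x)"
    by (simp add: linear_sum[OF lin] linear_cmul[OF lin] partial_deriv_def)
  finally show ?thesis .
qed

lemma C_k_comp_affine: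
  fixes A :: "real^'n::finite \<Rightarrow> real^'n"
  assumes "bounded_linear A"
  shows "C_k k f \<Longrightarrow> C_k k (\<lambda>x. f (A x + c))"
proof (induction k arbitrary: f)
  case 0
  have "continuous_on UNIV (\<lambda>x. A x + c)"
    by (intro continuous_on_add linear_continuous_on[OF assms] continuous_on_const)
  then show ?case using 0 continuous_on_compose2[of UNIV f UNIV "\<lambda>x. A x + c"] by simp
next
  case (Suc k)
  show ?case
  proof (rule C_k_SucI)
    have "((\<lambda>x. A x + c) has_derivative A) (at x)" for x
      using has_derivative_add[OF bounded_linear_imp_has_derivative[OF assms] has_derivative_const] by simp
    then show "((\<lambda>x. f (A x + c)) has_derivative (\<lambda>h. frechet_derivative f (at (A x + c)) (A h))) (at x)" for x
      by (rule has_derivative_compose) (rule C_k_differentiable[OF Suc.prems])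
    have "C_k k (\<lambda>x. \<Sum>j\<in>UNIV. A (axis i 1) $ j * partial_deriv j f (A x + c))" for i
      using Suc.prems by (intro C_k_sum C_k_cmult Suc.IH) simp
    moreover have "f differentiable at x" for x using Suc.prems by simp
    note frechet_derivative_eq_sum_partial_deriv[OF this]
    ultimately show "C_k k (\<lambda>x. frechet_derivative f (at (A x + c)) (A (axis i 1)))" for i by simp
  qed
qed

definition smooth_real :: "(real \<Rightarrow> real) \<Rightarrow> bool" where
  "smooth_real f \<longleftrightarrow> (\<exists>D. D 0 = f \<and> (\<forall>n x. (D n has_real_derivative D (Suc n) x) (at x)))"

lemma smooth_realE:
  assumes "smooth_real f"
  obtains f' where "\<And>x. (f has_real_derivative f' x) (at x)" "smooth_real f'"
proof -
  obtain D where D: "D 0 = f" "\<And>n x. (D n has_real_derivative D (Suc n) x) (at x)"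
    using assms by (auto simp: smooth_real_def)
  have "smooth_real (D 1)" unfolding smooth_real_def
    by (rule exI[of _ "\<lambda>n. D (Suc n)"]) (use D in auto)
  with D show ?thesis by (intro that[of "D 1"]) auto
qed

lemma C_k_comp:
  "smooth_real h \<Longrightarrow> C_k k f \<Longrightarrow> C_k k (\<lambda>x. h (f x))"
proof (induction k arbitrary: f h)
  case 0
  then have "continuous_on UNIV h"
    by (meson DERIV_isCont continuous_at_imp_continuous_on smooth_realE)
  then show ?case using 0 continuous_on_compose2[of UNIV h UNIV f] by simp
next
  case (Suc k)
  from \<open>smooth_real h\<close> obtain h' where h': "\<And>x. (h has_real_derivative h' x) (at x)" "smooth_real h'"
    by (rule smooth_realE) blast
  show ?case
  proof (rule C_k_SucI)
    show "((\<lambda>x. h (f x)) has_derivative (\<lambda>v. h' (f x) * frechet_derivative f (at x) v)) (at x)" for x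
      using has_derivative_compose[OF C_k_differentiable[OF Suc.prems(2)]
          h'(1)[unfolded has_field_derivative_def]] by simp
    have "C_k k (\<lambda>x. h' (f x) * partial_deriv i f x)" for i
      using C_k_mult[OF Suc.IH[OF h'(2) C_k_Suc_imp[OF Suc.prems(2)]]] Suc.prems(2) by simp
    then show "C_k k (\<lambda>x. h' (f x) * frechet_derivative f (at x) (axis i 1))" for i
      by (simp add: partial_deriv_def)
  qed
qed

section \<open>Flat functions and smooth approximations of the positive part\<close>

definition flat :: "real \<Rightarrow> int \<Rightarrow> real \<Rightarrow> real" where
  "flat d m r = (if r > 0 then r powi m * exp (- d / r) else 0)"

text \<open>In terms of \<open>y = 1 / r\<close> the exponential beats every power. The exponent
  \<open>nat (- m)\<close> is 0 for \<open>m \<ge> 0\<close>, where \<open>r powi m \<le> 1\<close>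
  on the unit interval, so one estimate covers both signs of \<open>m\<close>.\<close>

lemma flat_tendsto_0:
  assumes "d > 0" shows "(flat d m \<longlongrightarrow> 0) (at 0)"
proof -
  have "((\<lambda>r. r powi m * exp (- d / r)) \<longlongrightarrow> 0) (at_right 0)"
  proof -
    have "((\<lambda>y. y ^ nat (- m) * exp (- d * y)) \<longlongrightarrow> 0) at_top" for m
    proof -
      have "((\<lambda>y. (1 / d ^ nat (- m)) * ((d * y) ^ nat (- m) / exp (d * y))) \<longlongrightarrow> (1 / d ^ nat (- m)) * 0) at_top"
        using assms
        by (intro tendsto_mult tendsto_const filterlim_compose[OF tendsto_power_div_exp_0]
            filterlim_tendsto_pos_mult_at_top[OF tendsto_const _ filterlim_ident])
      then show ?thesis using assms by (simp add: power_mult_distrib exp_minus field_simps)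
    qed
    note lim = filterlim_compose[OF this filterlim_inverse_at_top_right]
    show ?thesis
    proof (rule Lim_null_comparison)
      show "((\<lambda>r. inverse r ^ nat (- m) * exp (- d * inverse r)) \<longlongrightarrow> 0) (at_right 0)" by (rule lim)
      show "\<forall>\<^sub>F r in at_right 0. norm (r powi m * exp (- d / r)) \<le> inverse r ^ nat (- m) * exp (- d * inverse r)"
        unfolding eventually_at_right_field
      proof (intro exI[of _ 1] conjI allI impI)
        fix r :: real assume r: "0 < r" "r < 1"
        have "r powi m \<le> inverse r ^ nat (- m)"
          using r by (auto simp: power_int_def power_le_one)
        then show "norm (r powi m * exp (- d / r)) \<le> inverse r ^ nat (- m) * exp (- d * inverse r)"
          using r by (simp add: abs_mult divide_inverse mult_right_mono)
      qed simp
    qed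
  qed
  then have "(flat d m \<longlongrightarrow> 0) (at_right 0)"
    by (rule Lim_transform_eventually) (auto simp: flat_def eventually_at_right_field intro!: exI[of _ 1])
  moreover have "(flat d m \<longlongrightarrow> 0) (at_left 0)"
    by (rule Lim_transform_eventually[OF tendsto_const])
      (auto simp: flat_def eventually_at_left_field intro!: exI[of _ "-1"])
  ultimately show ?thesis by (rule filterlim_split_at_real[rotated])
qed

lemma flat_has_derivative:
  assumes "d > 0"
  shows "(flat d m has_real_derivative (m * flat d (m - 1) x + d * flat d (m - 2) x)) (at x)"
proof (cases x "0::real" rule: linorder_cases)
  case less
  have "((\<lambda>r. 0) has_real_derivative 0) (at x)" by simp
  then have "(flat d m has_real_derivative 0) (at x)"
    by (rule has_field_derivative_transform_within[of _ _ _ _ "- x"]) (use less in \<open>auto simp: flat_def dist_real_def\<close>)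
  then show ?thesis using less by (simp add: flat_def)
next
  case equal
  \<comment> \<open>At 0 the difference quotient is \<open>flat d (m - 1)\<close> itself, whose
    limit is already known.\<close>
  have "((\<lambda>h. (flat d m (0 + h) - flat d m 0) / h) \<longlongrightarrow> 0) (at 0)"
  proof (rule Lim_transform_eventually[OF flat_tendsto_0[OF assms, of "m - 1"]])
    have "flat d (m - 1) h = (flat d m (0 + h) - flat d m 0) / h" if "h \<noteq> 0" for h
      using that by (simp add: flat_def power_int_diff)
    then show "\<forall>\<^sub>F h in at 0. flat d (m - 1) h = (flat d m (0 + h) - flat d m 0) / h"
      by (auto simp: eventually_at intro!: exI[of _ 1])
  qed
  then show ?thesis using equal by (simp add: DERIV_def flat_def)
next
  case greater
  have "((\<lambda>r. r powi m) has_real_derivative m * x powi (m - 1)) (at x)"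
    using greater by (auto intro!: derivative_eq_intros)
  moreover have "((\<lambda>r. exp (- d / r)) has_real_derivative exp (- d / x) * (d / x\<^sup>2)) (at x)"
    using greater by (auto intro!: derivative_eq_intros simp: power2_eq_square)
  ultimately have "((\<lambda>r. r powi m * exp (- d / r)) has_real_derivative
      m * x powi (m - 1) * exp (- d / x) + exp (- d / x) * (d / x\<^sup>2) * x powi m) (at x)"
    by (rule DERIV_mult)
  also have "m * x powi (m - 1) * exp (- d / x) + exp (- d / x) * (d / x\<^sup>2) * x powi m =
      m * flat d (m - 1) x + d * flat d (m - 2) x"
    using greater by (simp add: flat_def power_int_diff mult_ac)
  finally have "((\<lambda>r. r powi m * exp (- d / r)) has_real_derivative
      m * flat d (m - 1) x + d * flat d (m - 2) x) (at x)" .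
  then show ?thesis
    by (rule has_field_derivative_transform_within[of _ _ _ _ x]) (use greater in \<open>auto simp: flat_def dist_real_def\<close>)
qed

text \<open>Iterating one choice \<open>N\<close> of derivative inside the class \<open>P\<close>
  produces the whole sequence of derivatives at once, so a class closed under differentiation
  consists of smooth functions.\<close>

lemma smooth_real_coinduct:
  assumes "P f" and step: "\<And>g. P g \<Longrightarrow> \<exists>g'. (\<forall>x. (g has_real_derivative g' x) (at x)) \<and> P g'"
  shows "smooth_real f"
proof -
  obtain N where N: "\<And>g x. P g \<Longrightarrow> (g has_real_derivative N g x) (at x)" "\<And>g. P g \<Longrightarrow> P (N g)"
    using step by metis
  have P: "P ((N ^^ n) f)" for n by (induction n) (auto simp: assms(1) N)
  show ?thesis unfolding smooth_real_def
    by (rule exI[of _ "\<lambda>n. (N ^^ n) f"]) (auto intro: N P)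
qed

text \<open>The span of the functions \<open>flat d m\<close>, \<open>m\<close> an integer, is closed under differentiation.\<close>

lemma smooth_real_flat:
  assumes "d > 0" shows "smooth_real (flat d m)"
proof (rule smooth_real_coinduct[where P="\<lambda>g. \<exists>L. g = (\<lambda>x. \<Sum>(c, m)\<leftarrow>L. c * flat d m x)"])
  show "\<exists>L. flat d m = (\<lambda>x. \<Sum>(c, m)\<leftarrow>L. c * flat d m x)"
    by (rule exI[of _ "[(1, m)]"]) simp
  fix g assume "\<exists>L. g = (\<lambda>x. \<Sum>(c, m)\<leftarrow>L. c * flat d m x)"
  then obtain L where g: "g = (\<lambda>x. \<Sum>(c, m)\<leftarrow>L. c * flat d m x)" ..
  have "\<exists>L'. \<forall>x. ((\<lambda>x. \<Sum>(c, m)\<leftarrow>L. c * flat d m x) has_real_derivative (\<Sum>(c, m)\<leftarrow>L'. c * flat d m x)) (at x)"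
  proof (induction L)
    case Nil show ?case by (rule exI[of _ "[]"]) simp
  next
    case (Cons a L)
    obtain c m where a: "a = (c, m)" by fastforce
    from Cons obtain L' where L':
      "\<And>x. ((\<lambda>x. \<Sum>(c, m)\<leftarrow>L. c * flat d m x) has_real_derivative (\<Sum>(c, m)\<leftarrow>L'. c * flat d m x)) (at x)"
      by blast
    have "((\<lambda>x. \<Sum>(c, m)\<leftarrow>a # L. c * flat d m x) has_real_derivative
        (\<Sum>(c, m)\<leftarrow>(c * m, m - 1) # (c * d, m - 2) # L'. c * flat d m x)) (at x)" for x
      using DERIV_add[OF DERIV_cmult[OF flat_has_derivative[OF assms, of m x], of c] L'[of x]]
      by (simp add: a algebra_simps)
    then show ?case by blast
  qed
  then obtain L' where L':
    "\<And>x. ((\<lambda>x. \<Sum>(c, m)\<leftarrow>L. c * flat d m x) has_real_derivative (\<Sum>(c, m)\<leftarrow>L'. c * flat d m x)) (at x)"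
    by blast
  show "\<exists>g'. (\<forall>x. (g has_real_derivative g' x) (at x)) \<and> (\<exists>L. g' = (\<lambda>x. \<Sum>(c, m)\<leftarrow>L. c * flat d m x))"
    unfolding g by (rule exI[of _ "\<lambda>x. \<Sum>(c, m)\<leftarrow>L'. c * flat d m x"]) (use L' in blast)
qed

lemma smooth_real_add:
  assumes "smooth_real f" "smooth_real g" shows "smooth_real (\<lambda>x. f x + g x)"
proof -
  obtain D E where "D 0 = f" "\<And>n x. (D n has_real_derivative D (Suc n) x) (at x)"
    "E 0 = g" "\<And>n x. (E n has_real_derivative E (Suc n) x) (at x)"
    using assms by (auto simp: smooth_real_def)
  then show ?thesis unfolding smooth_real_def
    by (intro exI[of _ "\<lambda>n x. D n x + E n x"]) (auto intro: DERIV_add)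
qed

lemma smooth_real_affine:
  assumes "smooth_real f" shows "smooth_real (\<lambda>x. c * f (a * x + b))"
proof -
  obtain D where D: "D 0 = f" "\<And>n x. (D n has_real_derivative D (Suc n) x) (at x)"
    using assms by (auto simp: smooth_real_def)
  have "((\<lambda>x. c * a ^ n * D n (a * x + b)) has_real_derivative c * a ^ Suc n * D (Suc n) (a * x + b)) (at x)" for n x
    by (auto intro!: derivative_eq_intros DERIV_chain2[OF D(2)])
  with D(1) show ?thesis unfolding smooth_real_def
    by (intro exI[of _ "\<lambda>n x. c * a ^ n * D n (a * x + b)"]) auto
qed

lemma flat_0_bounds: "d > 0 \<Longrightarrow> 0 \<le> flat d 0 r \<and> flat d 0 r \<le> 1"
  by (simp add: flat_def)

lemma flat_0_tendsto:
  "(\<lambda>k. flat (1 / real (Suc k)) 0 r) \<longlonglongrightarrow> (if r > 0 then 1 else 0)"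
proof -
  have "(\<lambda>k. exp (- (1 / real (Suc k)) / r)) \<longlonglongrightarrow> exp (- 0 / r)" if "r > 0"
    using that by (intro tendsto_intros LIMSEQ_Suc[OF lim_1_over_n]) auto
  then show ?thesis by (auto simp: flat_def)
qed

text \<open>The factor \<open>r\<close> in \<open>r exp (- d / r)\<close> makes the derivative equal to \<open>(1 + x) exp (- x)\<close> with
  \<open>x = d / r\<close>, which stays in \<open>[0, 1]\<close> for all \<open>d\<close>; the shift makes the function vanish near 0.\<close>

definition smooth_pos :: "nat \<Rightarrow> real \<Rightarrow> real" where
  "smooth_pos k t = flat (1 / real (Suc k)) 1 (t - 1 / real (Suc k))"

definition smooth_pos' :: "nat \<Rightarrow> real \<Rightarrow> real" where
  "smooth_pos' k t = flat (1 / real (Suc k)) 0 (t - 1 / real (Suc k)) +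
     1 / real (Suc k) * flat (1 / real (Suc k)) (- 1) (t - 1 / real (Suc k))"

lemma smooth_real_smooth_pos: "smooth_real (smooth_pos k)"
proof -
  define e where "e = 1 / real (Suc k)"
  have e: "e > 0" by (simp add: e_def)
  show ?thesis
    using smooth_real_affine[OF smooth_real_flat[OF e, of 1], of 1 1 "- e"]
    unfolding smooth_pos_def[abs_def] e_def[symmetric] by simp
qed

lemma smooth_pos_derivative: "(smooth_pos k has_real_derivative smooth_pos' k t) (at t)"
proof -
  define e where "e = 1 / real (Suc k)"
  have e: "e > 0" by (simp add: e_def)
  have "((\<lambda>t. t - e) has_real_derivative 1) (at t)" by (auto intro!: derivative_eq_intros)
  from DERIV_chain2[where g="\<lambda>t. t - e", OF flat_has_derivative[OF e, of 1 "t - e"] this]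
  show ?thesis unfolding smooth_pos_def[abs_def] smooth_pos'_def e_def[symmetric] by simp
qed

lemma smooth_pos_eq_0: "t \<le> 1 / real (Suc k) \<Longrightarrow> smooth_pos k t = 0 \<and> smooth_pos' k t = 0"
  unfolding smooth_pos_def smooth_pos'_def flat_def by (simp only: diff_gt_0_iff_gt not_le[symmetric]) simp

lemma smooth_pos_bounds: "0 \<le> smooth_pos k t \<and> smooth_pos k t \<le> max 0 t"
proof (cases "t > 1 / real (Suc k)")
  case True
  define e where "e = 1 / real (Suc k)"
  have e: "e > 0" "t - e > 0" using True by (auto simp: e_def)
  have "(t - e) * exp (- e / (t - e)) \<le> (t - e) * 1" using e by (intro mult_left_mono) auto
  also have "\<dots> \<le> t" using e by simp
  finally show ?thesis using e unfolding smooth_pos_def flat_def e_def[symmetric] by auto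
qed (use smooth_pos_eq_0[of t k] in auto)

lemma smooth_pos'_bounds: "0 \<le> smooth_pos' k t \<and> smooth_pos' k t \<le> 1"
proof (cases "t > 1 / real (Suc k)")
  case True
  define e where "e = 1 / real (Suc k)"
  have e: "e > 0" "t - e > 0" using True by (auto simp: e_def)
  define x where "x = e / (t - e)"
  have x: "x > 0" using e by (simp add: x_def)
  have E: "exp (- e / (t - e)) = exp (- x)" by (simp add: x_def)
  have "e * ((t - e) powi (- 1) * exp (- x)) = x * exp (- x)"
    using e by (simp add: x_def power_int_minus field_simps)
  then have "smooth_pos' k t = (1 + x) * exp (- x)"
    using e unfolding smooth_pos'_def flat_def e_def[symmetric] E by (simp add: distrib_right)
  moreover have "(1 + x) * exp (- x) \<le> exp x * exp (- x)"
    using exp_ge_add_one_self[of x] by (intro mult_right_mono) auto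
  ultimately show ?thesis using x by (simp add: exp_minus)
qed (use smooth_pos_eq_0[of t k] in auto)

lemma smooth_pos_tendsto: "(\<lambda>k. smooth_pos k t) \<longlonglongrightarrow> max 0 t"
  and smooth_pos'_tendsto: "(\<lambda>k. smooth_pos' k t) \<longlonglongrightarrow> (if t > 0 then 1 else 0)"
proof -
  define e where "e k = 1 / real (Suc k)" for k
  have e: "e \<longlonglongrightarrow> 0" "\<And>k. e k > 0" 
    using LIMSEQ_inverse_real_of_nat by (simp_all add: e_def[abs_def] inverse_eq_divide)
  have "(\<lambda>k. smooth_pos k t) \<longlonglongrightarrow> t \<and> (\<lambda>k. smooth_pos' k t) \<longlonglongrightarrow> 1" if t: "t > 0"
  proof
    have ev: "\<forall>\<^sub>F k in sequentially. e k < t" using e(1) t by (rule order_tendstoD(2))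
    have "(\<lambda>k. (t - e k) * exp (- e k / (t - e k))) \<longlonglongrightarrow> (t - 0) * exp (- 0 / (t - 0))"
      using t by (intro tendsto_intros e) auto
    then have "(\<lambda>k. (t - e k) * exp (- e k / (t - e k))) \<longlonglongrightarrow> t" by simp
    moreover have "\<forall>\<^sub>F k in sequentially. (t - e k) * exp (- e k / (t - e k)) = smooth_pos k t"
      using ev unfolding smooth_pos_def flat_def e_def[symmetric] by eventually_elim simp
    ultimately show "(\<lambda>k. smooth_pos k t) \<longlonglongrightarrow> t" by (rule Lim_transform_eventually)
    have "(\<lambda>k. exp (- e k / (t - e k)) + e k * (inverse (t - e k) * exp (- e k / (t - e k))))
        \<longlonglongrightarrow> exp (- 0 / (t - 0)) + 0 * (inverse (t - 0) * exp (- 0 / (t - 0)))"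
      using t by (intro tendsto_intros e) auto
    then have "(\<lambda>k. exp (- e k / (t - e k)) + e k * (inverse (t - e k) * exp (- e k / (t - e k)))) \<longlonglongrightarrow> 1"
      by simp
    moreover have "\<forall>\<^sub>F k in sequentially. exp (- e k / (t - e k)) +
        e k * (inverse (t - e k) * exp (- e k / (t - e k))) = smooth_pos' k t"
      using ev unfolding smooth_pos'_def flat_def e_def[symmetric]
      by eventually_elim (simp add: power_int_minus)
    ultimately show "(\<lambda>k. smooth_pos' k t) \<longlonglongrightarrow> 1" by (rule Lim_transform_eventually)
  qed
  note pos = this
  have neg: "smooth_pos k t = 0 \<and> smooth_pos' k t = 0" if "\<not> t > 0" for k
    by (rule smooth_pos_eq_0, rule order_trans[of t 0]) (use that in auto)
  show "(\<lambda>k. smooth_pos k t) \<longlonglongrightarrow> max 0 t"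
  proof (cases "t > 0")
    case False then show ?thesis using neg by (simp add: max_absorb1)
  qed (use pos in \<open>simp add: max_absorb2\<close>)
  show "(\<lambda>k. smooth_pos' k t) \<longlonglongrightarrow> (if t > 0 then 1 else 0)"
  proof (cases "t > 0")
    case False then show ?thesis using neg by simp
  qed (use pos in simp)
qed

lemma C_k_component: "C_k k (\<lambda>x::real^'n::finite. x $ i + c)"
proof (cases k)
  case 0 then show ?thesis by (auto intro!: continuous_intros)
next
  case (Suc j)
  have "((\<lambda>x::real^'n. x $ i + c) has_derivative (\<lambda>h. h $ i)) (at x)" for x
    using has_derivative_add[OF bounded_linear_imp_has_derivative[OF bounded_linear_vec_nth] has_derivative_const]
    by simp
  then show ?thesis unfolding Suc by (intro C_k_SucI[of _ "\<lambda>x h. h $ i"] C_k_const)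
qed

section \<open>Test functions and integration by parts\<close>

lemma test_functionsI:
  assumes "\<And>k. C_k k f" "compact K" "K \<subseteq> \<Omega>" "\<And>x. x \<notin> K \<Longrightarrow> f x = 0"
  shows "f \<in> test_functions \<Omega>"
proof -
  have "closure {x. f x \<noteq> 0} \<subseteq> K"
    using assms by (intro closure_minimal compact_imp_closed) auto
  moreover from this have "compact (closure {x. f x \<noteq> 0})"
    using assms(2) compact_Int_closed[of K "closure {x. f x \<noteq> 0}"] by (simp add: Int_absorb1)
  ultimately show ?thesis using assms by (auto simp: test_functions_def)
qed

lemma test_functionsE:
  assumes "f \<in> test_functions \<Omega>"
  obtains K where "\<And>k. C_k k f" "compact K" "K \<subseteq> \<Omega>" "\<And>x. x \<notin> K \<Longrightarrow> f x = 0"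
  by (rule that[of "closure {x. f x \<noteq> 0}"])
    (use assms closure_subset[of "{x. f x \<noteq> 0}"] in \<open>auto simp: test_functions_def\<close>)

lemma test_function_derivative:
  assumes "f \<in> test_functions \<Omega>"
  shows "(f has_derivative frechet_derivative f (at x)) (at x)"
proof -
  have "C_k (Suc 0) f" using assms by (elim test_functionsE) blast
  then show ?thesis by (rule C_k_differentiable)
qed

lemma test_function_C_k_partial: "f \<in> test_functions \<Omega> \<Longrightarrow> C_k k (partial_deriv i f)"
  by (elim test_functionsE) (metis C_k.simps(2))

lemma test_function_continuous:
  assumes "f \<in> test_functions \<Omega>"
  shows "continuous_on UNIV f" "continuous_on UNIV (partial_deriv i f)"
  using assms test_function_C_k_partial[OF assms, of 0] by (auto elim!: test_functionsE intro: C_k_continuous)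

lemma partial_deriv_eq_0:
  assumes "closed K" "\<And>y. y \<notin> K \<Longrightarrow> f y = 0" "x \<notin> K"
  shows "partial_deriv i f x = 0"
proof -
  have "open (- K)" using assms(1) by auto
  have "(f has_derivative (\<lambda>h. 0)) (at x)"
    by (rule has_derivative_transform_within_open[OF has_derivative_const \<open>open (- K)\<close>, of _ 0])
      (use assms in auto)
  then show ?thesis by (rule partial_deriv_eq)
qed

lemma test_function_partial:
  assumes f: "f \<in> test_functions \<Omega>"
  shows "partial_deriv i f \<in> test_functions \<Omega>"
proof -
  obtain K where K: "compact K" "K \<subseteq> \<Omega>" "\<And>x. x \<notin> K \<Longrightarrow> f x = 0" using f by (elim test_functionsE) blast
  show ?thesis
    by (rule test_functionsI[OF test_function_C_k_partial[OF f] K(1,2)])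
      (rule partial_deriv_eq_0[OF compact_imp_closed[OF K(1)] K(3)])
qed

lemma test_function_mult_smooth:
  assumes "f \<in> test_functions \<Omega>" "\<And>k. C_k k g"
  shows "(\<lambda>x. g x * f x) \<in> test_functions \<Omega>"
  using assms(1)
proof (rule test_functionsE)
  fix K assume "\<And>k. C_k k f" "compact K" "K \<subseteq> \<Omega>" "\<And>x. x \<notin> K \<Longrightarrow> f x = 0"
  then show ?thesis by (intro test_functionsI[of _ K] C_k_mult assms(2)) auto
qed

lemma test_function_cmult: "f \<in> test_functions \<Omega> \<Longrightarrow> (\<lambda>x. c * f x) \<in> test_functions \<Omega>"
  by (rule test_function_mult_smooth[OF _ C_k_const])

lemma test_function_add:
  assumes "f \<in> test_functions \<Omega>" "g \<in> test_functions \<Omega>"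
  shows "(\<lambda>x. f x + g x) \<in> test_functions \<Omega>"
proof -
  obtain K where K: "\<And>k. C_k k f" "compact K" "K \<subseteq> \<Omega>" "\<And>x. x \<notin> K \<Longrightarrow> f x = 0"
    using assms(1) by (rule test_functionsE) blast
  obtain L where L: "\<And>k. C_k k g" "compact L" "L \<subseteq> \<Omega>" "\<And>x. x \<notin> L \<Longrightarrow> g x = 0"
    using assms(2) by (rule test_functionsE) blast
  show ?thesis
    by (rule test_functionsI[of _ "K \<union> L"]) (use K L in \<open>auto intro: C_k_add\<close>)
qed

lemma zero_test_function: "(\<lambda>x. 0) \<in> test_functions \<Omega>"
  by (rule test_functionsI[of _ "{}"]) (auto intro: C_k_const)

lemma partial_deriv_linear:
  assumes "f \<in> test_functions \<Omega>" "g \<in> test_functions \<Omega>"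
  shows "partial_deriv i (\<lambda>x. a * f x + b * g x) x = a * partial_deriv i f x + b * partial_deriv i g x"
proof -
  have "((\<lambda>x. a * f x + b * g x) has_derivative
      (\<lambda>h. a * frechet_derivative f (at x) h + b * frechet_derivative g (at x) h)) (at x)"
    by (intro has_derivative_add has_derivative_mult_right test_function_derivative[OF assms(1)]
        test_function_derivative[OF assms(2)])
  from partial_deriv_eq[OF this] show ?thesis by (simp add: partial_deriv_def)
qed

lemma continuous_compact_support_integrable:
  fixes f :: "'a::euclidean_space \<Rightarrow> real"
  assumes "continuous_on UNIV f" "compact K" "\<And>x. x \<notin> K \<Longrightarrow> f x = 0"
  shows "integrable lborel f"
proof -
  have "integrable lborel (\<lambda>x. indicator K x *\<^sub>R f x)"
    using assms by (intro borel_integrable_compact) (auto intro: continuous_on_subset)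
  also have "(\<lambda>x. indicator K x *\<^sub>R f x) = f" using assms(3) by (auto simp: indicator_def fun_eq_iff)
  finally show ?thesis .
qed

lemma integrable_lebesgue_on_if_lborel:
  fixes f :: "'a::euclidean_space \<Rightarrow> real"
  assumes "integrable lborel f" "\<Omega> \<in> sets lebesgue"
  shows "integrable (lebesgue_on \<Omega>) f"
proof -
  have "integrable lebesgue f"
    using assms(1) integrable_completion[of f lborel] by auto
  then have "integrable lebesgue (\<lambda>x. indicator \<Omega> x *\<^sub>R f x)"
    using assms(2) by (rule integrable_mult_indicator[rotated])
  then show ?thesis using assms(2) by (subst integrable_restrict_space) auto
qed

lemma integral_lebesgue_on_eq_lborel:
  fixes f :: "'a::euclidean_space \<Rightarrow> real"
  assumes "integrable lborel f" "\<Omega> \<in> sets lebesgue" "\<And>x. x \<notin> \<Omega> \<Longrightarrow> f x = 0"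
  shows "(LINT x|lebesgue_on \<Omega>. f x) = (LINT x|lborel. f x)"
proof -
  have "(LINT x|lebesgue_on \<Omega>. f x) = (LINT x|lebesgue. indicator \<Omega> x *\<^sub>R f x)"
    using assms(2) by (subst integral_restrict_space) auto
  also have "(\<lambda>x. indicator \<Omega> x *\<^sub>R f x) = f" using assms(3) by (auto simp: indicator_def fun_eq_iff)
  also have "(LINT x|lebesgue. f x) = (LINT x|lborel. f x)"
    using assms(1) by (intro integral_completion) auto
  finally show ?thesis .
qed

lemma test_function_measurable:
  fixes f :: "real^'n::finite \<Rightarrow> real"
  assumes "f \<in> test_functions \<Omega>"
  shows "f \<in> borel_measurable (lebesgue_on S)" "partial_deriv i f \<in> borel_measurable (lebesgue_on S)"
proof -
  have "g \<in> borel_measurable (lebesgue_on S)" if "continuous_on UNIV g" for g :: "real^'n \<Rightarrow> real"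
    using borel_measurable_continuous_onI[OF that]
    by (simp add: measurable_completion measurable_restrict_space1 measurable_lborel1)
  then show "f \<in> borel_measurable (lebesgue_on S)" "partial_deriv i f \<in> borel_measurable (lebesgue_on S)"
    using test_function_continuous[OF assms] by blast+
qed

lemma test_function_bounded:
  assumes "f \<in> test_functions \<Omega>"
  obtains B where "\<And>x. \<bar>f x\<bar> \<le> B"
proof -
  obtain K where K: "compact K" "\<And>x. x \<notin> K \<Longrightarrow> f x = 0" using assms by (elim test_functionsE) blast
  have "compact (f ` K)"
    using test_function_continuous(1)[OF assms] K(1) by (intro compact_continuous_image) (auto intro: continuous_on_subset)
  then obtain B where B: "\<forall>x\<in>K. \<bar>f x\<bar> \<le> B"
    by (auto dest!: compact_imp_bounded simp: bounded_iff)
  have "\<bar>f x\<bar> \<le> \<bar>B\<bar>" for x using B K(2)[of x] by (cases "x \<in> K") force+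
  then show thesis by (rule that)
qed

lemma test_function_L2:
  assumes f: "f \<in> test_functions \<Omega>" and S: "S \<in> sets lebesgue"
  shows "f \<in> L2 (lebesgue_on S)"
proof -
  obtain K where K: "compact K" "\<And>x. x \<notin> K \<Longrightarrow> f x = 0" using f by (elim test_functionsE) blast
  have "integrable lborel (\<lambda>x. (f x)\<^sup>2)"
    using test_function_continuous(1)[OF f] K
    by (intro continuous_compact_support_integrable[of _ K]) (auto intro!: continuous_intros)
  then have "integrable (lebesgue_on S) (\<lambda>x. (f x)\<^sup>2)" by (rule integrable_lebesgue_on_if_lborel[OF _ S])
  then show ?thesis using test_function_measurable(1)[OF f] by (simp add: L2_def)
qed

lemma lborel_integral_shift:
  fixes f :: "'a::euclidean_space \<Rightarrow> real"
  assumes "f \<in> borel_measurable borel"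
  shows "(LINT x|lborel. f (c + x)) = (LINT x|lborel. f x)"
  using integral_distr[of "(+) c" lborel borel f] assms lborel_distr_plus[of c] by simp

text \<open>The difference quotients \<open>q n\<close> integrate to zero by translation invariance.
  They are uniformly bounded, live on one compact set and converge pointwise to the partial
  derivative, so dominated convergence replaces an iterated integral.\<close>

lemma integral_partial_deriv_eq_0:
  fixes f :: "real^'n::finite \<Rightarrow> real"
  assumes f: "f \<in> test_functions UNIV"
  shows "(LINT x|lborel. partial_deriv i f x) = 0"
proof -
  define e :: "real^'n" where "e = axis i 1"
  obtain K where K: "compact K" "\<And>x. x \<notin> K \<Longrightarrow> f x = 0" using f by (elim test_functionsE) blast
  obtain B where B: "\<And>x. \<bar>partial_deriv i f x\<bar> \<le> B"
    using test_function_bounded[OF test_function_partial[OF f]] by blast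
  have der: "((\<lambda>s. f (x + s *\<^sub>R e)) has_real_derivative partial_deriv i f (x + s *\<^sub>R e)) (at s)" for x s
  proof -
    have "((\<lambda>s. x + s *\<^sub>R e) has_derivative (\<lambda>h. h *\<^sub>R e)) (at s)" by (auto intro!: derivative_eq_intros)
    from has_derivative_compose[OF this test_function_derivative[OF f]]
    have "((\<lambda>s. f (x + s *\<^sub>R e)) has_derivative (\<lambda>h. frechet_derivative f (at (x + s *\<^sub>R e)) (h *\<^sub>R e))) (at s)" .
    moreover have "frechet_derivative f (at (x + s *\<^sub>R e)) (h *\<^sub>R e) = partial_deriv i f (x + s *\<^sub>R e) * h" for h
      using linear_cmul[OF has_derivative_linear[OF test_function_derivative[OF f]]]
      by (simp add: partial_deriv_def e_def)
    ultimately show ?thesis by (simp add: has_field_derivative_def)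
  qed
  define q where "q n x = (f (x + (1 / real (Suc n)) *\<^sub>R e) - f x) * real (Suc n)" for n x
  have q_bound: "\<bar>q n x\<bar> \<le> B" for n x
  proof -
    define t where "t = 1 / real (Suc n)"
    have t: "t > 0" by (simp add: t_def)
    obtain \<xi> where "f (x + t *\<^sub>R e) - f (x + 0 *\<^sub>R e) = (t - 0) * partial_deriv i f (x + \<xi> *\<^sub>R e)"
      using MVT2[of 0 t "\<lambda>s. f (x + s *\<^sub>R e)" "\<lambda>s. partial_deriv i f (x + s *\<^sub>R e)"] der t by auto
    then have "q n x = partial_deriv i f (x + \<xi> *\<^sub>R e)"
      unfolding q_def t_def[symmetric] by (simp add: t_def)
    then show ?thesis using B by simp
  qed
  have q_tendsto: "(\<lambda>n. q n x) \<longlonglongrightarrow> partial_deriv i f x" for x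
  proof -
    have "((\<lambda>h. (f (x + h *\<^sub>R e) - f x) / h) \<longlongrightarrow> partial_deriv i f x) (at 0)"
      using der[of x 0] by (simp add: DERIV_def)
    moreover have "filterlim (\<lambda>n. 1 / real (Suc n)) (at 0) sequentially"
      using LIMSEQ_inverse_real_of_nat
      by (auto simp: filterlim_at inverse_eq_divide simp del: of_nat_Suc)
    ultimately have "(\<lambda>n. (f (x + (1 / real (Suc n)) *\<^sub>R e) - f x) / (1 / real (Suc n))) \<longlonglongrightarrow> partial_deriv i f x"
      by (rule filterlim_compose)
    then show ?thesis by (simp add: q_def del: of_nat_Suc)
  qed
  \<comment> \<open>All increments are at most 1, so the closed unit neighbourhood of
    \<open>K\<close> contains the support of every \<open>q n\<close>; its finite measure makes the
    constant bound \<open>B\<close> integrable.\<close>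
  define L where "L = {x + y |x y. x \<in> K \<and> y \<in> cball (0::real^'n) 1}"
  have L: "compact L" unfolding L_def by (rule compact_sums[OF K(1) compact_cball])
  have q_support: "q n x = 0" if "x \<notin> L" for n x
  proof -
    have "x \<notin> K" using that by (force simp: L_def)
    moreover have "x + (1 / real (Suc n)) *\<^sub>R e \<notin> K"
    proof
      assume k: "x + (1 / real (Suc n)) *\<^sub>R e \<in> K"
      have "x = (x + (1 / real (Suc n)) *\<^sub>R e) + (- (1 / real (Suc n)) *\<^sub>R e)" by simp
      moreover have "- (1 / real (Suc n)) *\<^sub>R e \<in> cball 0 1" by (simp add: e_def)
      ultimately show False using that k unfolding L_def by blast
    qed
    ultimately show ?thesis by (simp add: q_def K(2))
  qed
  have fm [measurable]: "f \<in> borel_measurable borel" "partial_deriv i f \<in> borel_measurable borel"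
    using test_function_continuous[OF f] by (auto intro: borel_measurable_continuous_onI)
  have f_int: "integrable lborel f" by (rule continuous_compact_support_integrable[OF test_function_continuous(1)[OF f] K])
  have "(\<lambda>n. LINT x|lborel. q n x) \<longlonglongrightarrow> (LINT x|lborel. partial_deriv i f x)"
  proof (rule integral_dominated_convergence[where w="\<lambda>x. B * indicator L x"])
    show "integrable lborel (\<lambda>x. B * indicator L x)"
      using L compact_imp_closed[OF L] emeasure_bounded_finite[OF compact_imp_bounded[OF L]]
      by (intro integrable_mult_right integrable_real_indicator) auto
    show "AE x in lborel. norm (q n x) \<le> B * indicator L x" for n
      using q_bound q_support by (intro always_eventually allI) (auto simp: indicator_def)
    show "q n \<in> borel_measurable lborel" for n unfolding q_def by measurable
  qed (use q_tendsto in auto)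
  moreover have "(LINT x|lborel. q n x) = 0" for n
  proof -
    have "integrable lborel (\<lambda>x. f ((1 / real (Suc n)) *\<^sub>R e + x))"
      using f_int integrable_distr_eq[of "(+) ((1 / real (Suc n)) *\<^sub>R e)" lborel borel f]
        lborel_distr_plus[of "(1 / real (Suc n)) *\<^sub>R e"] by simp
    then have "(LINT x|lborel. q n x) = ((LINT x|lborel. f ((1 / real (Suc n)) *\<^sub>R e + x)) - (LINT x|lborel. f x)) * real (Suc n)"
      unfolding q_def using f_int by (simp add: add.commute)
    then show ?thesis using lborel_integral_shift[OF fm(1)] by simp
  qed
  ultimately show ?thesis by (simp add: LIMSEQ_const_iff)
qed

text \<open>The product is a test function on the whole space, so the integral of its partial
  derivative vanishes there. All integrands are zero off \<open>\<Omega>\<close>, which allows the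
  change of domain.\<close>

lemma test_function_integration_by_parts:
  fixes f g :: "real^'n::finite \<Rightarrow> real"
  assumes \<Omega>: "\<Omega> \<in> sets lebesgue" and f: "f \<in> test_functions \<Omega>" and g: "g \<in> test_functions \<Omega>"
  shows "(LINT x|lebesgue_on \<Omega>. f x * partial_deriv i g x) = - (LINT x|lebesgue_on \<Omega>. partial_deriv i f x * g x)"
proof -
  have mono: "h \<in> test_functions UNIV" if "h \<in> test_functions \<Omega>" for h :: "real^'n \<Rightarrow> real"
    using that by (auto simp: test_functions_def)
  obtain K where K: "compact K" "K \<subseteq> \<Omega>" "\<And>x. x \<notin> K \<Longrightarrow> g x = 0" using g by (elim test_functionsE) blast
  have g': "partial_deriv i g x = 0" if "x \<notin> K" for x
    using partial_deriv_eq_0[OF compact_imp_closed[OF K(1)] K(3) that] by simp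
  have i1: "integrable lborel (\<lambda>x. f x * partial_deriv i g x)"
    using test_function_continuous[OF f] test_function_continuous[OF g] K g'
    by (intro continuous_compact_support_integrable[of _ K]) (auto intro!: continuous_intros)
  have i2: "integrable lborel (\<lambda>x. partial_deriv i f x * g x)"
    using test_function_continuous[OF f] test_function_continuous[OF g] K
    by (intro continuous_compact_support_integrable[of _ K]) (auto intro!: continuous_intros)
  have C: "\<And>k. C_k k f" using f by (elim test_functionsE) blast
  have fg: "(\<lambda>x. f x * g x) \<in> test_functions UNIV" by (rule mono[OF test_function_mult_smooth[OF g C]])
  have "partial_deriv i (\<lambda>x. f x * g x) x = f x * partial_deriv i g x + partial_deriv i f x * g x" for x
    using partial_deriv_eq[OF has_derivative_mult[OF test_function_derivative[OF f] test_function_derivative[OF g]]]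
    by (simp add: partial_deriv_def)
  then have "(LINT x|lborel. f x * partial_deriv i g x) + (LINT x|lborel. partial_deriv i f x * g x) = 0"
    using integral_partial_deriv_eq_0[OF fg, of i] i1 i2 by simp
  moreover have "(LINT x|lebesgue_on \<Omega>. f x * partial_deriv i g x) = (LINT x|lborel. f x * partial_deriv i g x)"
    using K g' by (intro integral_lebesgue_on_eq_lborel i1 \<Omega>) auto
  moreover have "(LINT x|lebesgue_on \<Omega>. partial_deriv i f x * g x) = (LINT x|lborel. partial_deriv i f x * g x)"
    using K by (intro integral_lebesgue_on_eq_lborel i2 \<Omega>) auto
  ultimately show ?thesis by simp
qed

text \<open>A product over the coordinates of \<open>exp (- d / r)\<close>, with \<open>r\<close>
  the signed distance to each face and \<open>d\<close> tending to 0. The bumps vanish on the faces,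
  so their limit is the indicator of the open box, whereas their supports are only confined to the
  closed one.\<close>

lemma box_bump:
  fixes a b :: "real^'n::finite"
  assumes "cbox a b \<subseteq> \<Omega>"
  obtains \<eta> :: "nat \<Rightarrow> real^'n \<Rightarrow> real"
  where "\<And>n. \<eta> n \<in> test_functions \<Omega>" "\<And>n x. 0 \<le> \<eta> n x \<and> \<eta> n x \<le> indicator (cbox a b) x"
    "\<And>x. (\<lambda>n. \<eta> n x) \<longlonglongrightarrow> indicator (box a b) x"
proof -
  define h where "h n = flat (1 / real (Suc n)) 0" for n
  have h: "0 \<le> h n r" "h n r \<le> 1" "r \<le> 0 \<Longrightarrow> h n r = 0" for n r
    using flat_0_bounds[of "1 / real (Suc n)" r] by (auto simp: h_def flat_def)
  define \<eta> where "\<eta> n x = (\<Prod>i\<in>UNIV. h n (x $ i - a $ i) * h n (b $ i - x $ i))" for n and x :: "real^'n"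
  have ind: "0 \<le> \<eta> n x \<and> \<eta> n x \<le> indicator (cbox a b) x" for n x
  proof (cases "x \<in> cbox a b")
    case True
    have "\<eta> n x \<le> 1" unfolding \<eta>_def by (intro prod_le_1 conjI mult_nonneg_nonneg mult_le_one h)
    moreover have "0 \<le> \<eta> n x" unfolding \<eta>_def by (intro prod_nonneg mult_nonneg_nonneg h)
    ultimately show ?thesis using True by simp
  next
    case False
    then obtain i where "x $ i < a $ i \<or> b $ i < x $ i" by (auto simp: mem_box_cart not_le)
    then have "h n (x $ i - a $ i) * h n (b $ i - x $ i) = 0" using h(3) by fastforce
    then have "\<eta> n x = 0" unfolding \<eta>_def by (intro prod_zero) auto
    then show ?thesis by simp
  qed
  show thesis
  proof (rule that[of \<eta>])
    fix n
    have sm: "smooth_real (h n)" unfolding h_def by (rule smooth_real_flat) simp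
    have "C_k k (\<lambda>x::real^'n. h n (x $ i - a $ i))" for k i
      using C_k_comp[OF sm C_k_component[of k i "- a $ i"]] by simp
    moreover have "C_k k (\<lambda>x::real^'n. h n (b $ i - x $ i))" for k i
      using C_k_comp[OF sm C_k_cmult[OF C_k_component[of k i "- b $ i"], of "-1"]] by simp
    ultimately have "C_k k (\<eta> n)" for k unfolding \<eta>_def by (intro C_k_prod C_k_mult)
    then show "\<eta> n \<in> test_functions \<Omega>"
    proof (rule test_functionsI[of _ "cbox a b"])
      show "\<eta> n x = 0" if "x \<notin> cbox a b" for x using ind[of n x] that by simp
    qed (use assms in auto)
  next
    fix x
    have "(\<lambda>n. \<eta> n x) \<longlonglongrightarrow> (\<Prod>i\<in>UNIV. (if x $ i - a $ i > 0 then 1 else 0) * (if b $ i - x $ i > 0 then 1 else 0))"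
      unfolding \<eta>_def h_def by (intro tendsto_prod tendsto_mult flat_0_tendsto)
    also have "(\<Prod>i\<in>UNIV. (if x $ i - a $ i > 0 then 1 else 0) * (if b $ i - x $ i > 0 then 1 else 0)) = (indicator (box a b) x :: real)"
    proof (cases "x \<in> box a b")
      case True then show ?thesis by (auto simp: mem_box_cart)
    next
      case False
      then obtain i where "\<not> (a $ i < x $ i \<and> x $ i < b $ i)" by (auto simp: mem_box_cart)
      then show ?thesis using False by (auto intro!: prod_zero bexI[of _ i])
    qed
    finally show "(\<lambda>n. \<eta> n x) \<longlonglongrightarrow> indicator (box a b) x" .
  qed (rule ind)
qed

section \<open>Isometric involutions preserve Lebesgue measure\<close>

text \<open>The library's results on linear images of measurable sets need a well-ordered index type. Here,
  Vitali's theorem fills an open set up to a null set with disjoint balls, and the measure of a ball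
  does not depend on its centre.\<close>

lemma distr_lborel_isometric_involution:
  fixes \<sigma> :: "'a::euclidean_space \<Rightarrow> 'a"
  assumes iso: "\<And>x y. dist (\<sigma> x) (\<sigma> y) = dist x y" and inv: "\<And>x. \<sigma> (\<sigma> x) = x"
  shows "distr lborel borel \<sigma> = lborel"
proof -
  have cont: "continuous_on UNIV \<sigma>"
    unfolding continuous_on_iff using iso by auto
  then have meas [measurable]: "\<sigma> \<in> borel_measurable borel" by (rule borel_measurable_continuous_onI)
  have open_vimage: "open (\<sigma> -` U)" if "open U" for U using open_vimage[OF that cont] .
  have ball: "emeasure lborel (\<sigma> -` ball c r) = emeasure lborel (ball c r)" for c r
  proof -
    have "\<sigma> -` ball c r = ball (\<sigma> c) r" using iso[of "\<sigma> c"] by (auto simp: inv)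
    then show ?thesis by (cases "r \<ge> 0") (simp_all add: emeasure_ball ball_empty)
  qed
  have le: "emeasure lborel U \<le> emeasure lborel (\<sigma> -` U)" if U: "open U" for U
  proof -
    define K where "K = {(c, r). ball c r \<subseteq> U}"
    have "\<exists>i. i \<in> K \<and> x \<in> ball (fst i) (snd i) \<and> snd i < d" if "x \<in> U" "d > 0" for x d
    proof -
      obtain e where e: "e > 0" "ball x e \<subseteq> U" using U \<open>x \<in> U\<close> by (meson open_contains_ball)
      have "ball x (min e (d/2)) \<subseteq> U" using e(2) by auto
      then show ?thesis using e(1) \<open>d > 0\<close> by (intro exI[of _ "(x, min e (d/2))"]) (auto simp: K_def)
    qed
    from Vitali_covering_theorem_balls[of U K fst snd, OF this]
    obtain C where C: "countable C" "C \<subseteq> K"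
      "pairwise (\<lambda>i j. disjnt (ball (fst i) (snd i)) (ball (fst j) (snd j))) C"
      "negligible (U - (\<Union>i\<in>C. ball (fst i) (snd i)))" by blast
    define B where "B = (\<Union>i\<in>C. ball (fst i) (snd i))"
    have BU: "B \<subseteq> U" using C(2) unfolding B_def K_def by fastforce
    have B: "open B" by (auto simp: B_def)
    have disj: "disjoint_family_on (\<lambda>i. ball (fst i) (snd i)) C"
      using C(3) by (auto simp: disjoint_family_on_def pairwise_def disjnt_def)
    have "emeasure lborel (U - B) = 0"
      using C(4) U B unfolding B_def[symmetric] negligible_iff_null_sets
      by (auto simp: null_sets_completion_iff)
    then have "emeasure lborel U = emeasure lborel B"
      using emeasure_Un_null_set[of B lborel "U - B"] U B BU
      by (simp add: null_sets_def Un_absorb1)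
    also have "\<dots> = (\<integral>\<^sup>+i. emeasure lborel (ball (fst i) (snd i)) \<partial>count_space C)"
      unfolding B_def by (rule emeasure_UN_countable[OF _ C(1) disj]) auto
    also have "\<dots> = (\<integral>\<^sup>+i. emeasure lborel (\<sigma> -` ball (fst i) (snd i)) \<partial>count_space C)"
      by (simp add: ball)
    also have "\<dots> = emeasure lborel (\<Union>i\<in>C. \<sigma> -` ball (fst i) (snd i))"
    proof (rule emeasure_UN_countable[symmetric, OF _ C(1)])
      show "disjoint_family_on (\<lambda>i. \<sigma> -` ball (fst i) (snd i)) C"
        using disj unfolding disjoint_family_on_def by blast
    qed (auto intro!: borel_open open_vimage)
    also have "\<dots> \<le> emeasure lborel (\<sigma> -` U)"
      using BU open_vimage[OF U] by (intro emeasure_mono) (auto simp: B_def)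
    finally show ?thesis .
  qed
  \<comment> \<open>Since \<open>\<sigma>\<close> undoes itself, the inequality \<open>le\<close>
    for the preimage of \<open>U\<close> is the reverse inequality for \<open>U\<close>.\<close>
  have eq: "emeasure lborel (\<sigma> -` U) = emeasure lborel U" if U: "open U" for U
  proof (rule antisym)
    have "\<sigma> -` \<sigma> -` U = U" using inv by auto
    then show "emeasure lborel (\<sigma> -` U) \<le> emeasure lborel U" using le[OF open_vimage[OF U]] by simp
  qed (rule le[OF U])
  show ?thesis
  proof (rule lborel_eqI[symmetric])
    fix l u :: 'a assume "\<And>b. b \<in> Basis \<Longrightarrow> l \<bullet> b \<le> u \<bullet> b"
    then show "emeasure (distr lborel borel \<sigma>) (box l u) = ennreal (prod ((\<bullet>) (u - l)) Basis)"
      by (simp add: emeasure_distr eq open_box)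
  qed simp
qed

text \<open>Measurability for the completed measure requires null sets to pull back to null sets,
  which holds because \<open>\<sigma>\<close> preserves the Borel measure. The preimage of a subset
  of the invariant set \<open>\<Omega>\<close> stays in \<open>\<Omega>\<close>, so everything
  restricts.\<close>

lemma lebesgue_on_isometric_involution:
  fixes \<sigma> :: "'a::euclidean_space \<Rightarrow> 'a"
  assumes iso: "\<And>x y. dist (\<sigma> x) (\<sigma> y) = dist x y" and inv: "\<And>x. \<sigma> (\<sigma> x) = x"
    and \<Omega>: "\<Omega> \<in> sets lebesgue" "\<And>x. x \<in> \<Omega> \<Longrightarrow> \<sigma> x \<in> \<Omega>"
  shows "\<sigma> \<in> lebesgue_on \<Omega> \<rightarrow>\<^sub>M lebesgue_on \<Omega>" (is ?meas)
    and "distr (lebesgue_on \<Omega>) (lebesgue_on \<Omega>) \<sigma> = lebesgue_on \<Omega>" (is ?distr)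
proof -
  have "continuous_on UNIV \<sigma>" unfolding continuous_on_iff using iso by auto
  then have "\<sigma> \<in> borel_measurable borel" by (rule borel_measurable_continuous_onI)
  then have meas: "\<sigma> \<in> lebesgue \<rightarrow>\<^sub>M lborel" by (simp add: measurable_completion measurable_lborel1)
  have d: "distr lebesgue lborel \<sigma> = lborel"
    using distr_lborel_isometric_involution[OF iso inv] \<open>\<sigma> \<in> borel_measurable borel\<close>
    by (simp add: distr_completion cong: distr_cong)
  have mm: "\<sigma> \<in> lebesgue \<rightarrow>\<^sub>M lebesgue"
    by (rule completion.measurable_completion2[OF meas]) (simp add: d)
  have dd: "distr lebesgue lebesgue \<sigma> = lebesgue"
    using completion.completion_distr_eq[OF meas] by (simp add: d)
  show m: ?meas
    using mm \<Omega>(2) by (intro measurable_restrict_space3) auto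
  show ?distr
  proof (rule measure_eqI)
    fix A assume "A \<in> sets (distr (lebesgue_on \<Omega>) (lebesgue_on \<Omega>) \<sigma>)"
    then have A: "A \<in> sets (lebesgue_on \<Omega>)" by simp
    then have A': "A \<subseteq> \<Omega>" "A \<in> sets lebesgue" using \<Omega>(1) by (auto simp: sets_restrict_space_iff)
    have "\<sigma> -` A \<inter> \<Omega> = \<sigma> -` A" using A'(1) \<Omega>(2) inv by (metis Int_absorb2 subsetD subsetI vimage_eq)
    then have "emeasure (distr (lebesgue_on \<Omega>) (lebesgue_on \<Omega>) \<sigma>) A = emeasure (lebesgue_on \<Omega>) (\<sigma> -` A)"
      using A m by (simp add: emeasure_distr)
    also have "\<dots> = emeasure lebesgue (\<sigma> -` A)"
      using \<open>\<sigma> -` A \<inter> \<Omega> = \<sigma> -` A\<close> \<Omega>(1) by (intro emeasure_restrict_space) auto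
    also have "\<dots> = emeasure (distr lebesgue lebesgue \<sigma>) A"
      using A'(2) mm by (simp add: emeasure_distr)
    also have "\<dots> = emeasure (lebesgue_on \<Omega>) A"
      using A' \<Omega>(1) by (simp add: dd emeasure_restrict_space)
    finally show "emeasure (distr (lebesgue_on \<Omega>) (lebesgue_on \<Omega>) \<sigma>) A = emeasure (lebesgue_on \<Omega>) A" .
  qed simp
qed

section \<open>The Sobolev space\<close>

text \<open>Boxes are stable under intersection and generate the Borel sets, so the integral of
  \<open>g\<close> vanishes over every Borel set; the sets where \<open>g\<close> is positive and
  where it is negative then conclude. The integral over the whole space, needed for complements,
  comes from growing boxes.\<close>

lemma AE_zero_if_box_integrals_zero:
  fixes g :: "'a::euclidean_space \<Rightarrow> real"
  assumes int: "integrable lborel g" and zero: "\<And>a b. (LINT x|lborel. indicator (box a b) x * g x) = 0"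
  shows "AE x in lborel. g x = 0"
proof -
  have [measurable]: "g \<in> borel_measurable borel" using int by auto
  have int_ind: "integrable lborel (\<lambda>x. indicator A x * g x)" if "A \<in> sets borel" for A
    using integrable_mult_indicator[OF _ int, of A] that by simp
  have total: "(LINT x|lborel. g x) = 0"
  proof -
    have "(\<lambda>n. LINT x|lborel. indicator (box (- real n *\<^sub>R One) (real n *\<^sub>R One)) x * g x) \<longlonglongrightarrow> (LINT x|lborel. g x)"
    proof (rule integral_dominated_convergence[where w="\<lambda>x. norm (g x)"])
      show "AE x in lborel. (\<lambda>n. indicator (box (- real n *\<^sub>R One) (real n *\<^sub>R One)) x * g x) \<longlonglongrightarrow> g x"
      proof (intro always_eventually allI)
        fix x :: 'a
        obtain n0 :: nat where n0: "norm x < real n0" using reals_Archimedean2 by blast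
        have "x \<in> box (- real n *\<^sub>R One) (real n *\<^sub>R One)" if "n \<ge> n0" for n
          unfolding mem_box
        proof
          fix i :: 'a assume i: "i \<in> Basis"
          have "\<bar>x \<bullet> i\<bar> < real n" using Basis_le_norm[OF i, of x] n0 that by linarith
          then show "(- real n *\<^sub>R One) \<bullet> i < x \<bullet> i \<and> x \<bullet> i < (real n *\<^sub>R One) \<bullet> i" using i by (simp add: abs_less_iff)
        qed
        then have "\<forall>\<^sub>F n in sequentially. indicator (box (- real n *\<^sub>R One) (real n *\<^sub>R One)) x * g x = g x"
          by (auto simp: eventually_sequentially intro!: exI[of _ n0])
        then show "(\<lambda>n. indicator (box (- real n *\<^sub>R One) (real n *\<^sub>R One)) x * g x) \<longlonglongrightarrow> g x"
          by (rule tendsto_eventually)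
      qed
    qed (use int in \<open>auto simp: indicator_def\<close>)
    then show ?thesis by (simp add: zero LIMSEQ_const_iff)
  qed
  have all: "(LINT x|lborel. indicator A x * g x) = 0" if "A \<in> sets borel" for A
  proof -
    have "Int_stable (range (\<lambda>(a, b). box a b :: 'a set))"
      by (auto simp: Int_stable_def box_Int_box)
    moreover have "range (\<lambda>(a, b). box a b :: 'a set) \<subseteq> Pow UNIV" by auto
    moreover have "A \<in> sigma_sets UNIV (range (\<lambda>(a, b). box a b :: 'a set))"
      using that unfolding borel_eq_box by simp
    ultimately show ?thesis
    proof (induction rule: sigma_sets_induct_disjoint)
      case (basic A)
      then show ?case by (auto simp: zero)
    next
      case empty then show ?case by simp
    next
      case (compl A)
      then have A: "A \<in> sets borel" by (simp add: borel_eq_box)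
      have "(LINT x|lborel. indicator (UNIV - A) x * g x) = (LINT x|lborel. g x - indicator A x * g x)"
        by (intro Bochner_Integration.integral_cong) (auto simp: indicator_def)
      also have "\<dots> = 0" using compl.IH total int int_ind[OF A] by simp
      finally show ?case .
    next
      case (union F)
      then have F: "F i \<in> sets borel" for i by (simp add: borel_eq_box subset_eq)
      have F': "(\<Union>i. F i) \<in> sets borel" using F by auto
      have "(\<lambda>n. LINT x|lborel. (\<Sum>i<n. indicator (F i) x * g x)) \<longlonglongrightarrow> (LINT x|lborel. indicator (\<Union>i. F i) x * g x)"
      proof (rule integral_dominated_convergence[where w="\<lambda>x. norm (g x)"])
        have sum_eq: "(\<Sum>i<n. indicator (F i) x * g x) = indicator (\<Union>i<n. F i) x * g x" for n x
        proof -
          have "(\<Sum>i<n. indicator (F i) x) = (indicator (\<Union>i<n. F i) x :: real)"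
            using union.hyps(1) by (intro indicator_UN_disjoint[symmetric]) (auto intro: disjoint_family_on_mono)
          then show ?thesis by (simp add: sum_distrib_right[symmetric])
        qed
        show "AE x in lborel. norm (\<Sum>i<n. indicator (F i) x * g x) \<le> norm (g x)" for n
          unfolding sum_eq by (intro always_eventually allI) (auto simp: indicator_def)
        show "AE x in lborel. (\<lambda>n. \<Sum>i<n. indicator (F i) x * g x) \<longlonglongrightarrow> indicator (\<Union>i. F i) x * g x"
          unfolding sum_eq by (intro always_eventually allI tendsto_mult tendsto_const LIMSEQ_indicator_UN)
      qed (use F F' int in auto)
      moreover have "(LINT x|lborel. (\<Sum>i<n. indicator (F i) x * g x)) = 0" for n
        using union.IH int_ind[OF F] by (subst Bochner_Integration.integral_sum) auto
      ultimately show ?case by (simp add: LIMSEQ_const_iff)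
    qed
  qed
  have nonpos: "AE x in lborel. s * g x \<le> 0" if s: "s = 1 \<or> s = (-1::real)" for s
  proof -
    define A where "A = {x. s * g x > 0}"
    have A: "A \<in> sets borel" unfolding A_def by measurable
    have "(LINT x|lborel. indicator A x * (s * g x)) = s * (LINT x|lborel. indicator A x * g x)"
      using int_ind[OF A] by (subst Bochner_Integration.integral_mult_right[symmetric]) (auto simp: mult_ac)
    then have "(LINT x|lborel. indicator A x * (s * g x)) = 0" using all[OF A] by simp
    moreover have "integrable lborel (\<lambda>x. indicator A x * (s * g x))"
      using integrable_mult_right[OF int_ind[OF A], of s] by (simp add: mult_ac)
    moreover have "AE x in lborel. 0 \<le> indicator A x * (s * g x)"
      by (auto simp: A_def indicator_def)
    ultimately have "AE x in lborel. indicator A x * (s * g x) = 0"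
      using integral_nonneg_eq_0_iff_AE by blast
    then show ?thesis by eventually_elim (auto simp: A_def indicator_def split: if_splits)
  qed
  have "AE x in lborel. 1 * g x \<le> 0" "AE x in lborel. - 1 * g x \<le> 0" by (rule nonpos, simp)+
  then show ?thesis by eventually_elim auto
qed

text \<open>Bumps approximate the indicator of a box whose closure lies in \<open>\<Omega>\<close>,
  so \<open>g\<close> integrates to zero over all such boxes, and countably many closed boxes
  exhaust \<open>\<Omega>\<close>. Restriction to a bounded box makes the square integrable
  \<open>g\<close> integrable.\<close>

lemma fundamental_lemma_of_variations:
  fixes g :: "real^'n::finite \<Rightarrow> real"
  assumes \<Omega>: "open \<Omega>" and g: "g \<in> L2 (lebesgue_on \<Omega>)"
    and zero: "\<And>\<eta>. \<eta> \<in> test_functions \<Omega> \<Longrightarrow> (LINT x|lebesgue_on \<Omega>. g x * \<eta> x) = 0"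
  shows "AE x in lebesgue_on \<Omega>. g x = 0"
proof -
  have \<Omega>s: "\<Omega> \<in> sets lebesgue" using \<Omega> by auto
  note gm = L2_measurable[OF g]
  define G where "G x = indicator \<Omega> x *\<^sub>R g x" for x
  have Gm [measurable]: "G \<in> borel_measurable lebesgue"
    unfolding G_def using gm \<Omega>s by (subst borel_measurable_restrict_space_iff[symmetric]) auto
  have G2: "integrable lebesgue (\<lambda>x. (G x)\<^sup>2)"
  proof -
    have "integrable lebesgue (\<lambda>x. indicator \<Omega> x *\<^sub>R (norm (g x))\<^sup>2)"
      using L2_integrable[OF g] \<Omega>s by (subst integrable_restrict_space[symmetric]) auto
    also have "(\<lambda>x. indicator \<Omega> x *\<^sub>R (norm (g x))\<^sup>2) = (\<lambda>x. (G x)\<^sup>2)"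
      by (auto simp: G_def indicator_def fun_eq_iff)
    finally show ?thesis .
  qed
  have GL2: "G \<in> L2 lebesgue" using Gm G2 by (simp add: L2_def)
  have G\<eta>: "(LINT x|lebesgue. G x * \<eta> x) = 0" if "\<eta> \<in> test_functions \<Omega>" for \<eta>
    using zero[OF that] \<Omega>s by (simp add: integral_restrict_space G_def mult.assoc)
  have indG: "(\<lambda>x. indicator A x * G x) \<in> borel_measurable lebesgue" if "A \<in> sets lebesgue" for A
    using that Gm by (intro borel_measurable_times borel_measurable_indicator)
  have box_int: "integrable lebesgue (\<lambda>x. indicator (cbox a b) x * G x)" for a b
  proof -
    have "(indicator (cbox a b) :: _ \<Rightarrow> real) \<in> L2 lebesgue"
    proof -
      have "integrable lebesgue (indicator (cbox a b) :: _ \<Rightarrow> real)"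
        by (intro integrable_real_indicator) (auto simp: emeasure_lborel_cbox_eq)
      moreover have "(\<lambda>x. (norm (indicator (cbox a b) x :: real))\<^sup>2) = indicator (cbox a b)"
        by (auto simp: indicator_def fun_eq_iff)
      ultimately show ?thesis by (simp add: L2_def)
    qed
    from L2_mult_integrable[OF this GL2] have "integrable lebesgue (\<lambda>x. norm (indicator (cbox a b) x * G x))"
      by (simp add: abs_mult)
    then show ?thesis by (rule integrable_norm_cancel) (rule indG, simp)
  qed
  have box_zero: "(LINT x|lebesgue. indicator (box a b) x * G x) = 0" if ab: "cbox a b \<subseteq> \<Omega>" for a b
  proof -
    obtain \<eta> :: "nat \<Rightarrow> _" where \<eta>: "\<And>n. \<eta> n \<in> test_functions \<Omega>"
      "\<And>n x. 0 \<le> \<eta> n x \<and> \<eta> n x \<le> indicator (cbox a b) x" "\<And>x. (\<lambda>n. \<eta> n x) \<longlonglongrightarrow> indicator (box a b) x"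
      using box_bump[OF ab] by blast
    have "(\<lambda>n. LINT x|lebesgue. G x * \<eta> n x) \<longlonglongrightarrow> (LINT x|lebesgue. G x * indicator (box a b) x)"
    proof (rule integral_dominated_convergence[where w="\<lambda>x. norm (indicator (cbox a b) x * G x)"])
      show "AE x in lebesgue. (\<lambda>n. G x * \<eta> n x) \<longlonglongrightarrow> G x * indicator (box a b) x"
        by (intro always_eventually allI tendsto_mult tendsto_const \<eta>)
      show "AE x in lebesgue. norm (G x * \<eta> n x) \<le> norm (indicator (cbox a b) x * G x)" for n
        using \<eta>(2)[of n] by (intro always_eventually allI)
          (auto simp: abs_mult mult.commute[of "\<bar>G _\<bar>"] intro!: mult_right_mono)
      show "(\<lambda>x. G x * \<eta> n x) \<in> borel_measurable lebesgue" for n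
        using test_function_measurable(1)[OF \<eta>(1), of n UNIV] Gm by (simp add: lebesgue_on_UNIV_eq)
      show "(\<lambda>x. G x * indicator (box a b) x) \<in> borel_measurable lebesgue"
        using indG[of "box a b"] by (simp add: mult.commute)
    qed (use box_int in auto)
    then show ?thesis using G\<eta>[OF \<eta>(1)] by (simp add: LIMSEQ_const_iff mult.commute)
  qed
  have AE_box: "AE x in lebesgue. x \<in> cbox a b \<longrightarrow> G x = 0" if ab: "cbox a b \<subseteq> \<Omega>" for a b
  proof -
    \<comment> \<open>The criterion by box integrals concerns the Borel measure, while
      \<open>G\<close> is measurable only for its completion; \<open>G'\<close> is a Borel version
      of \<open>G\<close> cut off to the box.\<close>
    obtain G' where G'm: "G' \<in> borel_measurable lborel" and G': "AE x in lborel. indicator (box a b) x * G x = G' x"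
      using completion_ex_borel_measurable_real[of "\<lambda>x. indicator (box a b) x * G x" lborel]
        indG[of "box a b"] by auto
    have int: "integrable lebesgue (\<lambda>x. indicator (box a b) x * G x)"
      by (rule Bochner_Integration.integrable_bound[OF box_int[of a b]])
        (use indG[of "box a b"] box_subset_cbox[of a b] in \<open>auto simp: indicator_def\<close>)
    have G'_int: "integrable lborel G'"
    proof -
      have "integrable lebesgue G'"
        using int by (rule integrable_cong_AE_imp) (use G'm G' AE_completion in \<open>auto simp: measurable_completion\<close>)
      then show ?thesis using integrable_completion[of G' lborel] G'm by auto
    qed
    have "AE x in lborel. G' x = 0"
    proof (rule AE_zero_if_box_integrals_zero[OF G'_int])
      fix c d
      \<comment> \<open>The intersection of two open boxes is a box whose closure stays in
        \<open>cbox a b\<close>, hence in \<open>\<Omega>\<close>, so \<open>box_zero\<close>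
        applies to it.\<close>
      have sub: "box a b \<inter> box c d = box (\<Sum>i\<in>Basis. max (a \<bullet> i) (c \<bullet> i) *\<^sub>R i) (\<Sum>i\<in>Basis. min (b \<bullet> i) (d \<bullet> i) *\<^sub>R i)"
        (is "_ = box ?l ?u") by (rule box_Int_box)
      have "cbox ?l ?u \<subseteq> cbox a b" by (auto simp: mem_box)
      then have "cbox ?l ?u \<subseteq> \<Omega>" using ab by blast
      from box_zero[OF this, folded sub]
      have "(LINT x|lebesgue. indicator (box a b \<inter> box c d) x * G x) = 0" .
      also have "(\<lambda>x. indicator (box a b \<inter> box c d) x * G x) = (\<lambda>x. indicator (box c d) x * (indicator (box a b) x * G x))"
        by (auto simp: indicator_def)
      also have "(LINT x|lebesgue. indicator (box c d) x * (indicator (box a b) x * G x)) = (LINT x|lebesgue. indicator (box c d) x * G' x)"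
      proof (rule integral_cong_AE)
        show "(\<lambda>x. indicator (box c d) x * (indicator (box a b) x * G x)) \<in> borel_measurable lebesgue"
          by (intro borel_measurable_times borel_measurable_indicator Gm) auto
      qed (use G'm AE_completion[OF G'] in \<open>auto simp: measurable_completion\<close>)
      also have "\<dots> = (LINT x|lborel. indicator (box c d) x * G' x)"
        using G'm by (intro integral_completion) auto
      finally show "(LINT x|lborel. indicator (box c d) x * G' x) = 0" .
    qed
    with G' have "AE x in lborel. indicator (box a b) x * G x = 0" by eventually_elim simp
    then have 1: "AE x in lebesgue. indicator (box a b) x * G x = 0" by (rule AE_completion)
    \<comment> \<open>The open box is exchanged for the closed one because the countable cover of
      \<open>\<Omega>\<close> used below consists of closed boxes.\<close>
    have "AE x in lebesgue. x \<notin> cbox a b - box a b"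
      using negligible_frontier_interval[of a b] by (intro AE_not_in) (simp add: negligible_iff_null_sets)
    with 1 show ?thesis by eventually_elim (auto simp: indicator_def)
  qed
  obtain \<D> where \<D>: "countable \<D>" "\<D> \<subseteq> Pow \<Omega>" "\<And>X. X \<in> \<D> \<Longrightarrow> \<exists>a b. X = cbox a b" "\<Union>\<D> = \<Omega>"
    using open_countable_Union_open_cbox[OF \<Omega>] by blast
  have "AE x in lebesgue. x \<in> X \<longrightarrow> G x = 0" if X: "X \<in> \<D>" for X
  proof -
    obtain a b where "X = cbox a b" using \<D>(3)[OF X] by blast
    then show ?thesis using AE_box[of a b] X \<D>(2) by auto
  qed
  then have "AE x in lebesgue. \<forall>X\<in>\<D>. x \<in> X \<longrightarrow> G x = 0"
    by (subst AE_ball_countable[OF \<D>(1)]) blast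
  then have "AE x in lebesgue. x \<in> \<Omega> \<longrightarrow> g x = 0"
  proof eventually_elim
    case (elim x)
    show ?case
    proof
      assume x: "x \<in> \<Omega>"
      with elim \<D>(4) have "G x = 0" by blast
      then show "g x = 0" using x by (simp add: G_def)
    qed
  qed
  then show ?thesis using \<Omega>s by (subst AE_restrict_space_iff) auto
qed

definition grad :: "(real^'n::finite \<Rightarrow> real) \<Rightarrow> real^'n \<Rightarrow> real^'n" where
  "grad f x = (\<chi> i. partial_deriv i f x)"

text \<open>Near a zero of \<open>\<zeta>\<close> the composite vanishes because \<open>f\<close>
  vanishes near 0; elsewhere \<open>S\<close> is locally constant. Thus the jumps of
  \<open>S\<close> are never seen.\<close>

lemma test_function_signed_comp:
  fixes \<zeta> :: "real^'n::finite \<Rightarrow> real"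
  assumes \<zeta>: "\<zeta> \<in> test_functions \<Omega>" and f: "smooth_real f" "\<And>t. (f has_real_derivative f' t) (at t)"
    and \<delta>: "\<delta> > 0" "\<And>t. \<bar>t\<bar> < \<delta> \<Longrightarrow> f t = 0"
    and S: "\<And>x. \<zeta> x \<noteq> 0 \<Longrightarrow> \<exists>U. open U \<and> x \<in> U \<and> (\<forall>y\<in>U. S y = S x)"
  shows "(\<lambda>x. S x * f (\<zeta> x)) \<in> test_functions \<Omega>"
    and "grad (\<lambda>x. S x * f (\<zeta> x)) x = (S x * f' (\<zeta> x)) *\<^sub>R grad \<zeta> x"
proof -
  have cont: "continuous_on UNIV \<zeta>" by (rule test_function_continuous(1)[OF \<zeta>])
  \<comment> \<open>The spare factor \<open>g\<close> makes the class closed under differentiation: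
    each term of the derivative is again \<open>S\<close> times a function of \<open>\<zeta>\<close>
    times a factor, with \<open>f\<close> replaced by \<open>f'\<close> or \<open>g\<close> by one
    of its partial derivatives. The induction in \<open>C\<close> rests on this.\<close>
  have der: "((\<lambda>x. S x * f (\<zeta> x) * g x) has_derivative
      (\<lambda>h. S x * f' (\<zeta> x) * frechet_derivative \<zeta> (at x) h * g x + S x * f (\<zeta> x) * frechet_derivative g (at x) h)) (at x)"
    if f': "\<And>t. (f has_real_derivative f' t) (at t)" and f0: "\<And>t. \<bar>t\<bar> < \<delta> \<Longrightarrow> f t = 0"
      and g: "C_k (Suc 0) g" for f f' g x
  proof (cases "\<zeta> x = 0")
    case True
    have "f' 0 = 0"
    proof (rule DERIV_unique[OF f'])
      show "(f has_real_derivative 0) (at 0)"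
        by (rule has_field_derivative_transform_within[OF DERIV_const \<delta>(1)]) (auto simp: f0 dist_real_def)
    qed
    moreover have "((\<lambda>x. S x * f (\<zeta> x) * g x) has_derivative (\<lambda>h. 0)) (at x)"
    proof (rule has_derivative_transform_within_open[OF has_derivative_const])
      show "open (\<zeta> -` {-\<delta><..<\<delta>})" by (rule open_vimage[OF _ cont]) simp
      show "x \<in> \<zeta> -` {-\<delta><..<\<delta>}" using True \<delta>(1) by simp
      show "0 = S y * f (\<zeta> y) * g y" if "y \<in> \<zeta> -` {-\<delta><..<\<delta>}" for y using that f0[of "\<zeta> y"] by auto
    qed
    ultimately show ?thesis using True f0[of 0] \<delta>(1) by simp
  next
    case False
    from S[OF this] obtain U where U: "open U" "x \<in> U" "\<forall>y\<in>U. S y = S x" by blast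
    have "((\<lambda>x. f (\<zeta> x)) has_derivative (\<lambda>h. f' (\<zeta> x) * frechet_derivative \<zeta> (at x) h)) (at x)"
      using has_derivative_compose[OF test_function_derivative[OF \<zeta>] f'[unfolded has_field_derivative_def]] by simp
    from has_derivative_mult[OF has_derivative_mult_right[OF this, of "S x"] C_k_differentiable[OF g]]
    have "((\<lambda>y. S x * f (\<zeta> y) * g y) has_derivative
        (\<lambda>h. S x * f' (\<zeta> x) * frechet_derivative \<zeta> (at x) h * g x + S x * f (\<zeta> x) * frechet_derivative g (at x) h)) (at x)"
      by (simp add: add.commute mult_ac)
    then show ?thesis
      by (rule has_derivative_transform_within_open[OF _ U(1,2)]) (simp add: U(3))
  qed
  have C: "C_k k (\<lambda>x. S x * f (\<zeta> x) * g x)"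
    if "smooth_real f" "\<And>t. \<bar>t\<bar> < \<delta> \<Longrightarrow> f t = 0" "\<And>k. C_k k g" for f g k
    using that
  proof (induction k arbitrary: f g)
    case 0
    from \<open>smooth_real f\<close> obtain f' where f': "\<And>t. (f has_real_derivative f' t) (at t)" by (rule smooth_realE) blast
    have "(\<lambda>x. S x * f (\<zeta> x) * g x) differentiable (at x)" for x
      using der[OF f' 0(2,3)] by (auto simp: differentiable_def)
    then show ?case by (auto intro!: differentiable_imp_continuous_on simp: differentiable_on_def)
  next
    case (Suc k)
    from \<open>smooth_real f\<close> obtain f' where f': "\<And>t. (f has_real_derivative f' t) (at t)" "smooth_real f'"
      by (rule smooth_realE) blast
    have f'0: "f' t = 0" if "\<bar>t\<bar> < \<delta>" for t
    proof (rule DERIV_unique[OF f'(1)])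
      show "(f has_real_derivative 0) (at t)"
        by (rule has_field_derivative_transform_within[OF DERIV_const, of "\<delta> - \<bar>t\<bar>"])
          (use that Suc.prems(2) in \<open>auto simp: dist_real_def\<close>)
    qed
    show ?case
    proof (rule C_k_SucI[OF der[OF f'(1) Suc.prems(2,3)]])
      fix i
      have \<zeta>i: "C_k j (\<lambda>x. partial_deriv i \<zeta> x * g x)" for j
        by (rule C_k_mult[OF test_function_C_k_partial[OF \<zeta>] Suc.prems(3)])
      have gi: "C_k j (partial_deriv i g)" for j using Suc.prems(3)[of "Suc j"] by simp
      have "C_k k (\<lambda>x. S x * f' (\<zeta> x) * (partial_deriv i \<zeta> x * g x) + S x * f (\<zeta> x) * partial_deriv i g x)"
        by (rule C_k_add[OF Suc.IH[OF f'(2) f'0 \<zeta>i] Suc.IH[OF Suc.prems(1,2) gi]])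
      then show "C_k k (\<lambda>x. S x * f' (\<zeta> x) * frechet_derivative \<zeta> (at x) (axis i 1) * g x +
          S x * f (\<zeta> x) * frechet_derivative g (at x) (axis i 1))"
        by (simp add: partial_deriv_def mult.assoc)
    qed
  qed
  obtain K where K: "compact K" "K \<subseteq> \<Omega>" "\<And>x. x \<notin> K \<Longrightarrow> \<zeta> x = 0" using \<zeta> by (elim test_functionsE) blast
  show "(\<lambda>x. S x * f (\<zeta> x)) \<in> test_functions \<Omega>"
    using C[OF f(1) \<delta>(2) C_k_const[of _ 1]] \<delta> K by (intro test_functionsI[of _ K]) auto
  have d1: "((\<lambda>x. S x * f (\<zeta> x)) has_derivative (\<lambda>h. S x * f' (\<zeta> x) * frechet_derivative \<zeta> (at x) h)) (at x)"
    using der[OF f(2) \<delta>(2) C_k_const[of _ 1]] by simp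
  show "grad (\<lambda>x. S x * f (\<zeta> x)) x = (S x * f' (\<zeta> x)) *\<^sub>R grad \<zeta> x"
    using partial_deriv_eq[OF d1] by (simp add: grad_def vec_eq_iff partial_deriv_def)
qed

section \<open>Weak gradients and Sobolev spaces over a fixed open set\<close>

context
  fixes \<Omega> :: "(real^'n::finite) set"
  assumes open_\<Omega>: "open \<Omega>"
begin

abbreviation (input) "\<mu> \<equiv> lebesgue_on \<Omega>"

lemma \<Omega>_lebesgue: "\<Omega> \<in> sets lebesgue"
  using open_\<Omega> by auto

lemma weak_gradient_L2: "is_weak_gradient \<Omega> u G \<Longrightarrow> G \<in> L2 \<mu>"
  by (simp add: is_weak_gradient_def L2_def)

lemma test_L2: "\<eta> \<in> test_functions \<Omega> \<Longrightarrow> \<eta> \<in> L2 \<mu>"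
  and test_partial_L2: "\<eta> \<in> test_functions \<Omega> \<Longrightarrow> partial_deriv i \<eta> \<in> L2 \<mu>"
  using test_function_L2[OF _ \<Omega>_lebesgue] test_function_partial by blast+

text \<open>Each component of the difference integrates to zero against every test function, so the
  fundamental lemma applies; finitely many components share one null set.\<close>

lemma weak_gradient_unique:
  assumes G: "is_weak_gradient \<Omega> u G" and F: "is_weak_gradient \<Omega> u F"
  shows "AE x in \<mu>. G x = F x"
proof -
  have "AE x in \<mu>. G x $ i - F x $ i = 0" for i
  proof (rule fundamental_lemma_of_variations[OF open_\<Omega>])
    note L = L2_nth[OF weak_gradient_L2[OF G], of i] L2_nth[OF weak_gradient_L2[OF F], of i]
    show "(\<lambda>x. G x $ i - F x $ i) \<in> L2 \<mu>" by (rule L2_diff[OF L])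
    fix \<eta> assume \<eta>: "\<eta> \<in> test_functions \<Omega>"
    have "(LINT x|\<mu>. u x * partial_deriv i \<eta> x) = - (LINT x|\<mu>. G x $ i * \<eta> x)"
      "(LINT x|\<mu>. u x * partial_deriv i \<eta> x) = - (LINT x|\<mu>. F x $ i * \<eta> x)"
      using G F \<eta> by (simp_all add: is_weak_gradient_def)
    then have "(LINT x|\<mu>. G x $ i * \<eta> x) = (LINT x|\<mu>. F x $ i * \<eta> x)" by linarith
    then show "(LINT x|\<mu>. (G x $ i - F x $ i) * \<eta> x) = 0"
      using L2_mult_integrable_real[OF L(1) test_L2[OF \<eta>]] L2_mult_integrable_real[OF L(2) test_L2[OF \<eta>]]
      by (simp add: left_diff_distrib)
  qed
  then have "AE x in \<mu>. \<forall>i. G x $ i - F x $ i = 0" by (subst AE_all_countable) auto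
  then show ?thesis by eventually_elim (simp add: vec_eq_iff)
qed

text \<open>For a fixed test function both sides of the defining identity are continuous in L^2. The
  gradients of reflections and of compositions are obtained from smooth approximations in this
  way.\<close>

lemma is_weak_gradient_limit:
  assumes un: "\<And>n. un n \<in> L2 \<mu>" and u: "u \<in> L2 \<mu>" and G: "G \<in> L2 \<mu>"
    and w: "\<And>n. is_weak_gradient \<Omega> (un n) (Gn n)"
    and limu: "(\<lambda>n. l2norm \<mu> (\<lambda>x. un n x - u x)) \<longlonglongrightarrow> 0"
    and limG: "(\<lambda>n. l2norm \<mu> (\<lambda>x. Gn n x - G x)) \<longlonglongrightarrow> 0"
  shows "is_weak_gradient \<Omega> u G"
  unfolding is_weak_gradient_def
proof (intro conjI ballI allI)
  show "G \<in> borel_measurable \<mu>" "integrable \<mu> (\<lambda>x. (norm (G x))\<^sup>2)"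
    using G by (auto simp: L2_def)
  fix \<eta> :: "real^'n \<Rightarrow> real" and i assume \<eta>: "\<eta> \<in> test_functions \<Omega>"
  note Gn = weak_gradient_L2[OF w]
  have "(\<lambda>n. LINT x|\<mu>. un n x * partial_deriv i \<eta> x) \<longlonglongrightarrow> (LINT x|\<mu>. u x * partial_deriv i \<eta> x)"
    by (rule L2_integral_tendsto[OF un u test_partial_L2[OF \<eta>] limu])
  moreover have "(\<lambda>n. - (LINT x|\<mu>. Gn n x $ i * \<eta> x)) \<longlonglongrightarrow> - (LINT x|\<mu>. G x $ i * \<eta> x)"
  proof (intro tendsto_minus L2_integral_tendsto L2_nth[OF Gn] L2_nth[OF G] test_L2[OF \<eta>])
    show "(\<lambda>n. l2norm \<mu> (\<lambda>x. Gn n x $ i - G x $ i)) \<longlonglongrightarrow> 0"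
    proof (rule tendsto_sandwich[OF _ _ tendsto_const limG]; intro always_eventually allI)
      fix n show "l2norm \<mu> (\<lambda>x. Gn n x $ i - G x $ i) \<le> l2norm \<mu> (\<lambda>x. Gn n x - G x)"
        using L2_measurable[OF L2_diff[OF L2_nth[OF Gn, of n i] L2_nth[OF G, of i]]]
          component_le_norm_cart[of "Gn n x - G x" i for x]
        by (intro l2norm_mono[OF L2_diff[OF Gn G]]) auto
    qed simp
  qed
  moreover have "(LINT x|\<mu>. un n x * partial_deriv i \<eta> x) = - (LINT x|\<mu>. Gn n x $ i * \<eta> x)" for n
    using w[of n] \<eta> by (simp add: is_weak_gradient_def)
  ultimately show "(LINT x|\<mu>. u x * partial_deriv i \<eta> x) = - (LINT x|\<mu>. G x $ i * \<eta> x)"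
    by (simp add: LIMSEQ_unique)
qed

lemma is_weak_gradient_lincomb:
  assumes u: "u \<in> L2 \<mu>" and v: "v \<in> L2 \<mu>"
    and G: "is_weak_gradient \<Omega> u G" and F: "is_weak_gradient \<Omega> v F"
  shows "is_weak_gradient \<Omega> (\<lambda>x. a * u x + b * v x) (\<lambda>x. a *\<^sub>R G x + b *\<^sub>R F x)"
  unfolding is_weak_gradient_def
proof (intro conjI ballI allI)
  note L = weak_gradient_L2[OF G] weak_gradient_L2[OF F]
  have "(\<lambda>x. a *\<^sub>R G x + b *\<^sub>R F x) \<in> L2 \<mu>" by (intro L2_add L2_scaleR L)
  then show "(\<lambda>x. a *\<^sub>R G x + b *\<^sub>R F x) \<in> borel_measurable \<mu>"
    "integrable \<mu> (\<lambda>x. (norm (a *\<^sub>R G x + b *\<^sub>R F x))\<^sup>2)" by (auto simp: L2_def)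
  fix \<eta> :: "real^'n \<Rightarrow> real" and i assume \<eta>: "\<eta> \<in> test_functions \<Omega>"
  have "(LINT x|\<mu>. (a * u x + b * v x) * partial_deriv i \<eta> x) =
      a * (LINT x|\<mu>. u x * partial_deriv i \<eta> x) + b * (LINT x|\<mu>. v x * partial_deriv i \<eta> x)"
    using L2_mult_integrable_real[OF u test_partial_L2[OF \<eta>]] L2_mult_integrable_real[OF v test_partial_L2[OF \<eta>]]
    by (simp add: distrib_right mult.assoc)
  moreover have "(LINT x|\<mu>. (a *\<^sub>R G x + b *\<^sub>R F x) $ i * \<eta> x) =
      a * (LINT x|\<mu>. G x $ i * \<eta> x) + b * (LINT x|\<mu>. F x $ i * \<eta> x)"
    using L2_mult_integrable_real[OF L2_nth[OF L(1)] test_L2[OF \<eta>]]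
      L2_mult_integrable_real[OF L2_nth[OF L(2)] test_L2[OF \<eta>]]
    by (simp add: distrib_right mult.assoc)
  ultimately show "(LINT x|\<mu>. (a * u x + b * v x) * partial_deriv i \<eta> x) =
      - (LINT x|\<mu>. (a *\<^sub>R G x + b *\<^sub>R F x) $ i * \<eta> x)"
    using G F \<eta> by (simp add: is_weak_gradient_def)
qed

lemma is_weak_gradient_diff:
  assumes "u \<in> L2 \<mu>" "v \<in> L2 \<mu>" "is_weak_gradient \<Omega> u G" "is_weak_gradient \<Omega> v F"
  shows "is_weak_gradient \<Omega> (u - v) (\<lambda>x. G x - F x)"
  using is_weak_gradient_lincomb[OF assms, of 1 "-1"] by (simp add: fun_diff_def)

lemma is_weak_gradient_test:
  assumes \<eta>: "\<eta> \<in> test_functions \<Omega>"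
  shows "is_weak_gradient \<Omega> \<eta> (grad \<eta>)"
  unfolding is_weak_gradient_def
proof (intro conjI ballI allI)
  have m: "grad \<eta> \<in> borel_measurable \<mu>"
    unfolding grad_def[abs_def]
    using test_function_measurable(2)[OF \<eta>]
    by (subst borel_measurable_euclidean_space) (auto simp: Basis_vec_def inner_axis)
  then show "grad \<eta> \<in> borel_measurable \<mu>" .
  have "(\<lambda>x. \<Sum>i\<in>UNIV. \<bar>partial_deriv i \<eta> x\<bar>) \<in> L2 \<mu>"
  proof -
    have "finite I \<Longrightarrow> (\<lambda>x. \<Sum>i\<in>I. \<bar>partial_deriv i \<eta> x\<bar>) \<in> L2 \<mu>" for I
      by (induction I rule: finite_induct) (auto intro!: L2_add L2_norm[OF test_partial_L2[OF \<eta>], simplified])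
    then show ?thesis by simp
  qed
  then have "grad \<eta> \<in> L2 \<mu>"
  proof (rule L2_bound[OF _ m, of _ 1])
    show "AE x in \<mu>. norm (grad \<eta> x) \<le> 1 * norm (\<Sum>i\<in>UNIV. \<bar>partial_deriv i \<eta> x\<bar>)"
      using norm_le_l1_cart[of "grad \<eta> x" for x] by (intro always_eventually allI) (simp add: grad_def)
  qed
  then show "integrable \<mu> (\<lambda>x. (norm (grad \<eta> x))\<^sup>2)" by (rule L2_integrable)
  fix \<zeta> :: "real^'n \<Rightarrow> real" and i assume \<zeta>: "\<zeta> \<in> test_functions \<Omega>"
  show "(LINT x|\<mu>. \<eta> x * partial_deriv i \<zeta> x) = - (LINT x|\<mu>. grad \<eta> x $ i * \<zeta> x)"
    using test_function_integration_by_parts[OF \<Omega>_lebesgue \<eta> \<zeta>] by (simp add: grad_def)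
qed

lemma h1_space_iff: "u \<in> h1_space \<Omega> \<longleftrightarrow> u \<in> L2 \<mu> \<and> (\<exists>G. is_weak_gradient \<Omega> u G)"
  by (auto simp: h1_space_def L2_def)

lemma h1_space_I: "u \<in> L2 \<mu> \<Longrightarrow> is_weak_gradient \<Omega> u G \<Longrightarrow> u \<in> h1_space \<Omega>"
  by (auto simp: h1_space_iff)

lemma h1_space_weak_gradient:
  assumes "u \<in> h1_space \<Omega>" shows "is_weak_gradient \<Omega> u (weak_gradient \<Omega> u)"
proof -
  obtain G where "is_weak_gradient \<Omega> u G" using assms unfolding h1_space_iff by blast
  then show ?thesis unfolding weak_gradient_def by (rule someI[of "is_weak_gradient \<Omega> u"])
qed

lemma h1_space_L2: "u \<in> h1_space \<Omega> \<Longrightarrow> u \<in> L2 \<mu>"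
  by (simp add: h1_space_iff)

text \<open>\<open>h1_norm\<close> refers to an arbitrarily chosen gradient; uniqueness up to a null
  set lets any explicit one stand in for it. As the L^2 norm of a pair, the H^1 norm inherits the
  triangle inequality and completeness.\<close>

lemma h1_norm_eq:
  assumes u: "u \<in> L2 \<mu>" and G: "is_weak_gradient \<Omega> u G"
  shows "h1_norm \<Omega> u = l2norm \<mu> (\<lambda>x. (u x, G x))"
proof -
  have W: "is_weak_gradient \<Omega> u (weak_gradient \<Omega> u)" by (intro h1_space_weak_gradient h1_space_I[OF u G])
  have "AE x in \<mu>. (norm (weak_gradient \<Omega> u x))\<^sup>2 = (norm (G x))\<^sup>2"
    using weak_gradient_unique[OF W G] by eventually_elim simp
  then have "(LINT x|\<mu>. (norm (weak_gradient \<Omega> u x))\<^sup>2) = (LINT x|\<mu>. (norm (G x))\<^sup>2)"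
    using L2_measurable[OF weak_gradient_L2[OF W]] L2_measurable[OF weak_gradient_L2[OF G]]
    by (intro integral_cong_AE) auto
  then show ?thesis
    using L2_integrable[OF u] L2_integrable[OF weak_gradient_L2[OF G]]
    by (simp add: h1_norm_def l2norm_def norm_Pair)
qed

lemma h1_norm_diff_eq:
  assumes "u \<in> L2 \<mu>" "v \<in> L2 \<mu>" "is_weak_gradient \<Omega> u G" "is_weak_gradient \<Omega> v F"
  shows "h1_norm \<Omega> (u - v) = l2norm \<mu> (\<lambda>x. (u x, G x) - (v x, F x))"
  using h1_norm_eq[OF _ is_weak_gradient_diff[OF assms]] L2_diff[OF assms(1,2)] by (simp add: fun_diff_def)

lemma h1_norm_diff_tendsto_iff:
  assumes "\<And>n. un n \<in> L2 \<mu>" "u \<in> L2 \<mu>" "\<And>n. is_weak_gradient \<Omega> (un n) (Gn n)" "is_weak_gradient \<Omega> u G"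
  shows "(\<lambda>n. h1_norm \<Omega> (un n - u)) \<longlonglongrightarrow> 0 \<longleftrightarrow>
    (\<lambda>n. l2norm \<mu> (\<lambda>x. un n x - u x)) \<longlonglongrightarrow> 0 \<and> (\<lambda>n. l2norm \<mu> (\<lambda>x. Gn n x - G x)) \<longlonglongrightarrow> 0"
proof -
  have eq: "h1_norm \<Omega> (un n - u) = l2norm \<mu> (\<lambda>x. (un n x - u x, Gn n x - G x))" for n
    using h1_norm_diff_eq[OF assms(1,2,3,4)] by simp
  have P: "l2norm \<mu> (\<lambda>x. un n x - u x) \<le> h1_norm \<Omega> (un n - u)"
    "l2norm \<mu> (\<lambda>x. Gn n x - G x) \<le> h1_norm \<Omega> (un n - u)"
    "h1_norm \<Omega> (un n - u) \<le> l2norm \<mu> (\<lambda>x. un n x - u x) + l2norm \<mu> (\<lambda>x. Gn n x - G x)" for n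
    unfolding eq using l2norm_Pair[OF L2_diff[OF assms(1)[of n] assms(2)]
        L2_diff[OF weak_gradient_L2[OF assms(3)[of n]] weak_gradient_L2[OF assms(4)]]] by auto
  show ?thesis
  proof (intro iffI conjI; (elim conjE)?)
    assume lim: "(\<lambda>n. h1_norm \<Omega> (un n - u)) \<longlonglongrightarrow> 0"
    show "(\<lambda>n. l2norm \<mu> (\<lambda>x. un n x - u x)) \<longlonglongrightarrow> 0"
      by (rule tendsto_sandwich[OF _ _ tendsto_const lim]) (use P(1) in auto)
    show "(\<lambda>n. l2norm \<mu> (\<lambda>x. Gn n x - G x)) \<longlonglongrightarrow> 0"
      by (rule tendsto_sandwich[OF _ _ tendsto_const lim]) (use P(2) in auto)
  next
    assume "(\<lambda>n. l2norm \<mu> (\<lambda>x. un n x - u x)) \<longlonglongrightarrow> 0" "(\<lambda>n. l2norm \<mu> (\<lambda>x. Gn n x - G x)) \<longlonglongrightarrow> 0"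
    from tendsto_add_zero[OF this] have lim:
      "(\<lambda>n. l2norm \<mu> (\<lambda>x. un n x - u x) + l2norm \<mu> (\<lambda>x. Gn n x - G x)) \<longlonglongrightarrow> 0" .
    show "(\<lambda>n. h1_norm \<Omega> (un n - u)) \<longlonglongrightarrow> 0"
      by (rule tendsto_sandwich[OF _ _ tendsto_const lim]) (use P(3) in \<open>auto simp: eq\<close>)
  qed
qed

lemma h1_space_lincomb:
  assumes "u \<in> h1_space \<Omega>" "v \<in> h1_space \<Omega>"
  shows "(\<lambda>x. a * u x + b * v x) \<in> h1_space \<Omega>"
proof -
  have "(\<lambda>x. a * u x + b * v x) \<in> L2 \<mu>"
    using L2_add[OF L2_scaleR[OF h1_space_L2[OF assms(1)], of a] L2_scaleR[OF h1_space_L2[OF assms(2)], of b]] by simp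
  then show ?thesis
    using is_weak_gradient_lincomb[OF assms[THEN h1_space_L2] assms[THEN h1_space_weak_gradient]]
    by (rule h1_space_I)
qed

lemma h1_space_diff: "u \<in> h1_space \<Omega> \<Longrightarrow> v \<in> h1_space \<Omega> \<Longrightarrow> u - v \<in> h1_space \<Omega>"
  using h1_space_lincomb[of u v 1 "-1"] by (simp add: fun_diff_def)

lemma h1_norm_nonneg: "0 \<le> h1_norm \<Omega> u"
  by (simp add: h1_norm_def)

lemma h1_norm_lincomb_le:
  assumes u: "u \<in> h1_space \<Omega>" and v: "v \<in> h1_space \<Omega>"
  shows "h1_norm \<Omega> (\<lambda>x. a * u x + b * v x) \<le> \<bar>a\<bar> * h1_norm \<Omega> u + \<bar>b\<bar> * h1_norm \<Omega> v"
proof -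
  define U where "U x = (u x, weak_gradient \<Omega> u x)" for x
  define V where "V x = (v x, weak_gradient \<Omega> v x)" for x
  note W = u[THEN h1_space_weak_gradient] v[THEN h1_space_weak_gradient]
  note L = u[THEN h1_space_L2] v[THEN h1_space_L2]
  have UV: "U \<in> L2 \<mu>" "V \<in> L2 \<mu>"
    unfolding U_def[abs_def] V_def[abs_def] by (intro L2_Pair L W[THEN weak_gradient_L2])+
  have "h1_norm \<Omega> (\<lambda>x. a * u x + b * v x) = l2norm \<mu> (\<lambda>x. a *\<^sub>R U x + b *\<^sub>R V x)"
    using h1_norm_eq[OF h1_space_L2[OF h1_space_lincomb[OF u v]] is_weak_gradient_lincomb[OF L W]]
    by (simp add: U_def V_def)
  also have "\<dots> \<le> \<bar>a\<bar> * l2norm \<mu> U + \<bar>b\<bar> * l2norm \<mu> V"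
    using l2norm_triangle[OF L2_scaleR[OF UV(1), of a] L2_scaleR[OF UV(2), of b]] by (simp add: l2norm_scaleR)
  finally show ?thesis using h1_norm_eq[OF L(1) W(1)] h1_norm_eq[OF L(2) W(2)] by (simp add: U_def[abs_def] V_def[abs_def])
qed

lemma h1_norm_scale:
  assumes u: "u \<in> h1_space \<Omega>"
  shows "h1_norm \<Omega> (\<lambda>x. a * u x) = \<bar>a\<bar> * h1_norm \<Omega> u"
proof -
  note W = h1_space_weak_gradient[OF u] note L = h1_space_L2[OF u]
  have "is_weak_gradient \<Omega> (\<lambda>x. a * u x) (\<lambda>x. a *\<^sub>R weak_gradient \<Omega> u x)"
    using is_weak_gradient_lincomb[OF L L W W, of a 0] by simp
  moreover have "(\<lambda>x. a * u x) \<in> L2 \<mu>" using L2_scaleR[OF L, of a] by simp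
  ultimately have "h1_norm \<Omega> (\<lambda>x. a * u x) = l2norm \<mu> (\<lambda>x. a *\<^sub>R (u x, weak_gradient \<Omega> u x))"
    by (simp add: h1_norm_eq)
  then show ?thesis unfolding l2norm_scaleR h1_norm_eq[OF L W] .
qed

lemma h10_h1: "u \<in> h10_space \<Omega> \<Longrightarrow> u \<in> h1_space \<Omega>"
  by (simp add: h10_space_def)

lemma test_h1: "\<eta> \<in> test_functions \<Omega> \<Longrightarrow> \<eta> \<in> h1_space \<Omega>"
  by (rule h1_space_I[OF test_L2 is_weak_gradient_test])

lemma h10_approx: "u \<in> h10_space \<Omega> \<Longrightarrow> \<exists>\<eta>. (\<forall>k. \<eta> k \<in> test_functions \<Omega>) \<and> (\<lambda>k. h1_norm \<Omega> (u - \<eta> k)) \<longlonglongrightarrow> 0"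
  by (simp add: h10_space_def)

lemma h10_I:
  assumes "u \<in> h1_space \<Omega>" "\<And>e. e > 0 \<Longrightarrow> \<exists>\<eta>\<in>test_functions \<Omega>. h1_norm \<Omega> (u - \<eta>) < e"
  shows "u \<in> h10_space \<Omega>"
proof -
  have "\<exists>\<eta>\<in>test_functions \<Omega>. h1_norm \<Omega> (u - \<eta>) < inverse (real (Suc n))" for n by (rule assms(2)) simp
  then obtain \<eta> where \<eta>: "\<And>n. \<eta> n \<in> test_functions \<Omega>" "\<And>n. h1_norm \<Omega> (u - \<eta> n) < inverse (real (Suc n))" by metis
  have "(\<lambda>k. h1_norm \<Omega> (u - \<eta> k)) \<longlonglongrightarrow> 0"
    by (rule tendsto_sandwich[OF _ _ tendsto_const LIMSEQ_inverse_real_of_nat])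
      (use \<eta>(2) h1_norm_nonneg in \<open>auto simp: less_imp_le intro!: always_eventually\<close>)
  then show ?thesis using assms(1) \<eta>(1) by (auto simp: h10_space_def)
qed

lemma h10_approx_less:
  assumes "u \<in> h10_space \<Omega>" "e > 0"
  shows "\<exists>\<eta>\<in>test_functions \<Omega>. h1_norm \<Omega> (u - \<eta>) < e"
proof -
  obtain \<eta> where \<eta>: "\<And>k. \<eta> k \<in> test_functions \<Omega>" "(\<lambda>k. h1_norm \<Omega> (u - \<eta> k)) \<longlonglongrightarrow> 0"
    using h10_approx[OF assms(1)] by blast
  have "\<forall>\<^sub>F k in sequentially. h1_norm \<Omega> (u - \<eta> k) < e" using \<eta>(2) assms(2) by (rule order_tendstoD(2))
  then show ?thesis using \<eta>(1) by (auto simp: eventually_sequentially)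
qed

lemma test_h10:
  assumes \<eta>: "\<eta> \<in> test_functions \<Omega>" shows "\<eta> \<in> h10_space \<Omega>"
proof (rule h10_I[OF test_h1[OF \<eta>]])
  fix e :: real assume "e > 0"
  moreover have "h1_norm \<Omega> (\<eta> - \<eta>) = 0"
    using h1_norm_scale[OF test_h1[OF \<eta>], of 0] by (simp add: zero_fun_def)
  ultimately show "\<exists>\<zeta>\<in>test_functions \<Omega>. h1_norm \<Omega> (\<eta> - \<zeta>) < e" using \<eta> by (intro bexI[of _ \<eta>]) simp
qed

lemma h1_norm_diff_triangle:
  assumes "u \<in> h1_space \<Omega>" "v \<in> h1_space \<Omega>" "w \<in> h1_space \<Omega>"
  shows "h1_norm \<Omega> (u - w) \<le> h1_norm \<Omega> (u - v) + h1_norm \<Omega> (v - w)"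
proof -
  have "u - w = (\<lambda>x. 1 * (u - v) x + 1 * (v - w) x)" by (simp add: fun_eq_iff)
  then show ?thesis
    using h1_norm_lincomb_le[OF h1_space_diff[OF assms(1,2)] h1_space_diff[OF assms(2,3)], of 1 1] by simp
qed

lemma h10_closed:
  assumes u: "u \<in> h1_space \<Omega>" and v: "\<And>e. e > 0 \<Longrightarrow> \<exists>v\<in>h10_space \<Omega>. h1_norm \<Omega> (u - v) < e"
  shows "u \<in> h10_space \<Omega>"
proof (rule h10_I[OF u])
  fix e :: real assume e: "e > 0"
  obtain v where v: "v \<in> h10_space \<Omega>" "h1_norm \<Omega> (u - v) < e / 2" using v[of "e/2"] e by auto
  obtain \<eta> where \<eta>: "\<eta> \<in> test_functions \<Omega>" "h1_norm \<Omega> (v - \<eta>) < e / 2" using h10_approx_less[OF v(1), of "e/2"] e by auto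
  have "h1_norm \<Omega> (u - \<eta>) < e"
    using h1_norm_diff_triangle[OF u h10_h1[OF v(1)] test_h1[OF \<eta>(1)]] v \<eta> by simp
  then show "\<exists>\<eta>\<in>test_functions \<Omega>. h1_norm \<Omega> (u - \<eta>) < e" using \<eta> by blast
qed

text \<open>The working tool for membership: it suffices to exhibit approximants in the space whose
  values and gradients converge separately in L^2. The limit of the gradients is then the gradient
  of the limit.\<close>

lemma h10_limit:
  assumes un: "\<And>n. un n \<in> h10_space \<Omega>" "\<And>n. is_weak_gradient \<Omega> (un n) (Gn n)"
    and u: "u \<in> L2 \<mu>" and G: "G \<in> L2 \<mu>"
    and limu: "(\<lambda>n. l2norm \<mu> (\<lambda>x. un n x - u x)) \<longlonglongrightarrow> 0"
    and limG: "(\<lambda>n. l2norm \<mu> (\<lambda>x. Gn n x - G x)) \<longlonglongrightarrow> 0"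
  shows "u \<in> h10_space \<Omega>" "is_weak_gradient \<Omega> u G" "(\<lambda>n. h1_norm \<Omega> (un n - u)) \<longlonglongrightarrow> 0"
proof -
  have L: "un n \<in> L2 \<mu>" for n using un(1) by (intro h1_space_L2 h10_h1)
  show W: "is_weak_gradient \<Omega> u G" by (rule is_weak_gradient_limit[OF L u G un(2) limu limG])
  show lim: "(\<lambda>n. h1_norm \<Omega> (un n - u)) \<longlonglongrightarrow> 0"
    using h1_norm_diff_tendsto_iff[of un u Gn G, OF L u un(2) W] limu limG by blast
  have u1: "u \<in> h1_space \<Omega>" by (rule h1_space_I[OF u W])
  show "u \<in> h10_space \<Omega>"
  proof (rule h10_closed[OF u1])
    fix e :: real assume "e > 0"
    with lim have "\<forall>\<^sub>F n in sequentially. h1_norm \<Omega> (un n - u) < e" by (rule order_tendstoD(2))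
    then obtain n where "h1_norm \<Omega> (un n - u) < e" by (auto simp: eventually_sequentially)
    moreover have "h1_norm \<Omega> (un n - u) = h1_norm \<Omega> (u - un n)"
      using h1_norm_scale[OF h1_space_diff[OF u1 h10_h1[OF un(1)[of n]]], of "-1"] by (simp add: fun_diff_def)
    ultimately show "\<exists>v\<in>h10_space \<Omega>. h1_norm \<Omega> (u - v) < e" using un(1) by auto
  qed
qed

text \<open>The constant sequence \<open>u\<close> converges to \<open>v\<close> in L^2, with
  constant gradients, so \<open>h10_limit\<close> transfers membership and gradient.\<close>

lemma h10_cong_AE:
  assumes u: "u \<in> h10_space \<Omega>" and W: "is_weak_gradient \<Omega> u G"
    and v: "v \<in> borel_measurable \<mu>" and eq: "AE x in \<mu>. v x = u x"
  shows "v \<in> h10_space \<Omega>" "is_weak_gradient \<Omega> v G" "h1_norm \<Omega> (v - u) = 0"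
proof -
  have uL: "u \<in> L2 \<mu>" by (intro h1_space_L2 h10_h1 u)
  have vL: "v \<in> L2 \<mu>" by (rule L2_bound[OF uL v, of 1]) (use eq in auto)
  have "l2norm \<mu> (\<lambda>x. u x - v x) = 0"
    using eq by (subst l2norm_eq_0_iff[OF L2_diff[OF uL vL]]) auto
  moreover have "l2norm \<mu> (\<lambda>x. G x - G x) = 0" by (simp add: l2norm_def)
  ultimately have *: "v \<in> h10_space \<Omega>" "is_weak_gradient \<Omega> v G"
    by (auto intro: h10_limit[of "\<lambda>_. u" "\<lambda>_. G", OF u W vL weak_gradient_L2[OF W]])
  then show "v \<in> h10_space \<Omega>" "is_weak_gradient \<Omega> v G" .
  have "h1_norm \<Omega> (v - u) = l2norm \<mu> (\<lambda>x. (v x, G x) - (u x, G x))" by (rule h1_norm_diff_eq[OF vL uL *(2) W])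
  also have "\<dots> = 0"
    using eq L2_diff[OF L2_Pair[OF vL weak_gradient_L2[OF W]] L2_Pair[OF uL weak_gradient_L2[OF W]]]
    by (subst l2norm_eq_0_iff) (auto simp: zero_prod_def)
  finally show "h1_norm \<Omega> (v - u) = 0" .
qed

lemma h10_lincomb:
  assumes u: "u \<in> h10_space \<Omega>" and v: "v \<in> h10_space \<Omega>"
  shows "(\<lambda>x. a * u x + b * v x) \<in> h10_space \<Omega>"
proof (rule h10_I)
  show "(\<lambda>x. a * u x + b * v x) \<in> h1_space \<Omega>" by (intro h1_space_lincomb h10_h1 u v)
  fix e :: real assume e: "e > 0"
  \<comment> \<open>The summand 1 keeps the divisor positive when \<open>a\<close> and
    \<open>b\<close> both vanish.\<close>
  define d where "d = e / (2 * (\<bar>a\<bar> + \<bar>b\<bar> + 1))"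
  have d: "d > 0" using e by (simp add: d_def add_nonneg_pos)
  obtain \<eta> where \<eta>: "\<eta> \<in> test_functions \<Omega>" "h1_norm \<Omega> (u - \<eta>) < d" using h10_approx_less[OF u d] by auto
  obtain \<zeta> where \<zeta>: "\<zeta> \<in> test_functions \<Omega>" "h1_norm \<Omega> (v - \<zeta>) < d" using h10_approx_less[OF v d] by auto
  have "(\<lambda>x. a * u x + b * v x) - (\<lambda>x. a * \<eta> x + b * \<zeta> x) = (\<lambda>x. a * (u - \<eta>) x + b * (v - \<zeta>) x)"
    by (simp add: fun_eq_iff algebra_simps)
  then have "h1_norm \<Omega> ((\<lambda>x. a * u x + b * v x) - (\<lambda>x. a * \<eta> x + b * \<zeta> x)) \<le>
      \<bar>a\<bar> * h1_norm \<Omega> (u - \<eta>) + \<bar>b\<bar> * h1_norm \<Omega> (v - \<zeta>)"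
    using h1_norm_lincomb_le[OF h1_space_diff[OF h10_h1[OF u] test_h1[OF \<eta>(1)]]
        h1_space_diff[OF h10_h1[OF v] test_h1[OF \<zeta>(1)]], of a b] by simp
  also have "\<dots> \<le> \<bar>a\<bar> * d + \<bar>b\<bar> * d" using \<eta> \<zeta> by (intro add_mono mult_left_mono) auto
  also have "\<dots> < e"
  proof -
    have "(\<bar>a\<bar> + \<bar>b\<bar>) * d < (2 * (\<bar>a\<bar> + \<bar>b\<bar> + 1)) * d" using d by (intro mult_strict_right_mono) auto
    also have "\<dots> = e" by (simp add: d_def add_nonneg_pos less_imp_neq[THEN not_sym])
    finally show ?thesis by (simp add: distrib_right)
  qed
  finally show "\<exists>\<eta>\<in>test_functions \<Omega>. h1_norm \<Omega> ((\<lambda>x. a * u x + b * v x) - \<eta>) < e"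
    using test_function_add[OF test_function_cmult[OF \<eta>(1)] test_function_cmult[OF \<zeta>(1)]] by blast
qed

lemma zero_h10: "(\<lambda>x. 0) \<in> h10_space \<Omega>"
  by (rule test_h10[OF zero_test_function])

lemma h1_norm_eq_0_AE:
  assumes "u \<in> h1_space \<Omega>" "h1_norm \<Omega> u = 0"
  shows "AE x in \<mu>. u x = 0"
proof -
  note W = h1_space_weak_gradient[OF assms(1)] note L = h1_space_L2[OF assms(1)]
  have "l2norm \<mu> u \<le> 0"
    using l2norm_Pair(1)[OF L weak_gradient_L2[OF W]] h1_norm_eq[OF L W] assms(2) by simp
  then show ?thesis using l2norm_eq_0_iff[OF L] l2norm_nonneg[of \<mu> u] by linarith
qed

text \<open>Completeness of L^2 is applied to the pairs of values and gradients; by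
  \<open>h10_limit\<close> the components of the limit pair are a function of the space and its weak
  gradient.\<close>

lemma h10_complete:
  assumes s: "\<And>n. s n \<in> h10_space \<Omega>"
    and Cauchy: "\<And>r. r > 0 \<Longrightarrow> \<exists>N. \<forall>m\<ge>N. \<forall>n\<ge>m. h1_norm \<Omega> (s m - s n) < r"
  shows "\<exists>l\<in>h10_space \<Omega>. (\<lambda>n. h1_norm \<Omega> (s n - l)) \<longlonglongrightarrow> 0"
proof -
  define F where "F n x = (s n x, weak_gradient \<Omega> (s n) x)" for n x
  have W: "is_weak_gradient \<Omega> (s n) (weak_gradient \<Omega> (s n))" for n by (intro h1_space_weak_gradient h10_h1 s)
  have L: "s n \<in> L2 \<mu>" for n by (intro h1_space_L2 h10_h1 s)
  have FL: "F n \<in> L2 \<mu>" for n unfolding F_def[abs_def] by (intro L2_Pair L weak_gradient_L2[OF W])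
  have F_eq: "l2norm \<mu> (\<lambda>x. F m x - F n x) = h1_norm \<Omega> (s m - s n)" for m n
    unfolding F_def by (rule h1_norm_diff_eq[OF L L W W, symmetric])
  have "\<exists>l\<in>L2 \<mu>. (\<lambda>n. l2norm \<mu> (\<lambda>x. F n x - l x)) \<longlonglongrightarrow> 0"
    by (rule l2_complete[of F, OF FL], unfold F_eq) (rule Cauchy)
  then obtain l where l: "l \<in> L2 \<mu>" "(\<lambda>n. l2norm \<mu> (\<lambda>x. F n x - l x)) \<longlonglongrightarrow> 0"
    by blast
  have lim: "(\<lambda>n. l2norm \<mu> (\<lambda>x. s n x - fst (l x))) \<longlonglongrightarrow> 0 \<and> (\<lambda>n. l2norm \<mu> (\<lambda>x. weak_gradient \<Omega> (s n) x - snd (l x))) \<longlonglongrightarrow> 0"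
  proof -
    have eq: "(\<lambda>x. F n x - l x) = (\<lambda>x. (s n x - fst (l x), weak_gradient \<Omega> (s n) x - snd (l x)))" for n
      by (simp add: F_def fun_eq_iff prod_eq_iff)
    have P: "l2norm \<mu> (\<lambda>x. s n x - fst (l x)) \<le> l2norm \<mu> (\<lambda>x. F n x - l x)"
      "l2norm \<mu> (\<lambda>x. weak_gradient \<Omega> (s n) x - snd (l x)) \<le> l2norm \<mu> (\<lambda>x. F n x - l x)" for n
      unfolding eq using l2norm_Pair(1,2)[OF L2_diff[OF L[of n] L2_fst[OF l(1)]]
          L2_diff[OF weak_gradient_L2[OF W[of n]] L2_snd[OF l(1)]]] by auto
    show ?thesis
      by (intro conjI; rule tendsto_sandwich[OF _ _ tendsto_const l(2)]) (use P in auto)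
  qed
  show ?thesis
    using h10_limit[of s, OF s W L2_fst[OF l(1)] L2_snd[OF l(1)] lim[THEN conjunct1] lim[THEN conjunct2]] by blast
qed

lemma h10_complete_seminormed_subspace:
  "complete_seminormed_subspace (\<lambda>c u x. c * u x) (h10_space \<Omega>) (h1_norm \<Omega>)"
proof -
  interpret vector_space "\<lambda>(c::real) (u::real^'n \<Rightarrow> real) x. c * u x"
    by unfold_locales (auto simp: fun_eq_iff algebra_simps)
  show ?thesis
  proof unfold_locales
    show "subspace (h10_space \<Omega>)"
    proof (rule subspaceI)
      show "0 \<in> h10_space \<Omega>" using zero_h10 by (simp add: zero_fun_def)
      show "u + v \<in> h10_space \<Omega>" if "u \<in> h10_space \<Omega>" "v \<in> h10_space \<Omega>" for u v
        using h10_lincomb[OF that, of 1 1] by (simp add: plus_fun_def)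
      show "(\<lambda>x. c * u x) \<in> h10_space \<Omega>" if "u \<in> h10_space \<Omega>" for c u
        using h10_lincomb[OF that that, of c 0] by simp
    qed
    show "h1_norm \<Omega> (u + v) \<le> h1_norm \<Omega> u + h1_norm \<Omega> v" if "u \<in> h10_space \<Omega>" "v \<in> h10_space \<Omega>" for u v
      using h1_norm_lincomb_le[OF that[THEN h10_h1], of 1 1] by (simp add: plus_fun_def)
    show "h1_norm \<Omega> (\<lambda>x. a * u x) = \<bar>a\<bar> * h1_norm \<Omega> u" if "u \<in> h10_space \<Omega>" for a u
      by (rule h1_norm_scale[OF h10_h1[OF that]])
    show "\<exists>l\<in>h10_space \<Omega>. (\<lambda>n. h1_norm \<Omega> (s n - l)) \<longlonglongrightarrow> 0"
      if "\<And>n. s n \<in> h10_space \<Omega>" "\<And>r. r > 0 \<Longrightarrow> \<exists>N. \<forall>m\<ge>N. \<forall>n\<ge>m. h1_norm \<Omega> (s m - s n) < r" for s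
      by (rule h10_complete[OF that])
  qed
qed

section \<open>Polarization is continuous\<close>

context
  fixes a :: "real^'n" and b :: real and \<sigma> A
  assumes a: "a \<noteq> 0"
  defines "\<sigma> \<equiv> reflect {x. a \<bullet> x \<le> b}"
    and "A \<equiv> \<lambda>x. x - (2 * ((a \<bullet> x) / (a \<bullet> a))) *\<^sub>R a"
  assumes \<sigma>_\<Omega>: "\<And>x. x \<in> \<Omega> \<Longrightarrow> \<sigma> x \<in> \<Omega>"
begin

section \<open>The reflection and its linear part\<close>

lemma aa: "a \<bullet> a > 0"
  using a by simp

text \<open>\<open>A\<close> is the reflection across the parallel hyperplane through the origin. As
  the linear part of \<open>\<sigma>\<close> it is what acts on gradients.\<close>

lemma \<sigma>_eq: "\<sigma> x = A x + (2 * (b / (a \<bullet> a))) *\<^sub>R a"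
  unfolding \<sigma>_def A_def reflect_half_space[OF a] by (simp add: diff_divide_distrib algebra_simps)

lemma A_linear: "bounded_linear A"
  unfolding A_def
  by (intro bounded_linear_sub bounded_linear_ident bounded_linear_scaleR_const bounded_linear_const_mult
      bounded_linear_inner_right_comp bounded_linear_divide[THEN bounded_linear_compose] bounded_linear_inner_right)

text \<open>The chain rule produces the transpose of \<open>A\<close>; symmetry turns it back into
  \<open>A\<close> in the gradient of a reflected function.\<close>

lemma A_symmetric: "A x \<bullet> y = x \<bullet> A y"
  by (simp add: A_def inner_diff_left inner_diff_right inner_commute[of x a])

lemma A_involution: "A (A x) = x"
  using aa by (simp add: A_def inner_diff_right algebra_simps)

lemma A_norm: "norm (A x) = norm x"
  using A_symmetric[of x "A x"] by (simp add: norm_eq_sqrt_inner A_involution)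

lemma \<sigma>_dist: "dist (\<sigma> x) (\<sigma> y) = dist x y"
proof -
  have "\<sigma> x - \<sigma> y = A (x - y)" by (simp add: \<sigma>_eq linear_diff[OF bounded_linear.linear[OF A_linear]])
  then show ?thesis by (simp add: dist_norm A_norm)
qed

lemma \<sigma>_involution: "\<sigma> (\<sigma> x) = x"
proof -
  have "A a = - a" using aa by (simp add: A_def scaleR_2)
  then have "A (\<sigma> x) = x - (2 * (b / (a \<bullet> a))) *\<^sub>R a"
    by (simp add: \<sigma>_eq A_involution linear_add[OF bounded_linear.linear[OF A_linear]]
        linear_cmul[OF bounded_linear.linear[OF A_linear]])
  then show ?thesis by (simp add: \<sigma>_eq[of "\<sigma> x"])
qed

lemma \<sigma>_fixed: "a \<bullet> x = b \<Longrightarrow> \<sigma> x = x"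
  unfolding \<sigma>_def reflect_half_space[OF a] by simp

lemma \<sigma>_measurable: "\<sigma> \<in> \<mu> \<rightarrow>\<^sub>M \<mu>"
  and \<sigma>_distr: "distr \<mu> \<mu> \<sigma> = \<mu>"
  using lebesgue_on_isometric_involution[OF \<sigma>_dist \<sigma>_involution \<Omega>_lebesgue \<sigma>_\<Omega>] by auto

lemma L2_\<sigma>:
  fixes f :: "real^'n \<Rightarrow> 'b::euclidean_space"
  assumes "f \<in> L2 \<mu>"
  shows "(\<lambda>x. f (\<sigma> x)) \<in> L2 \<mu>"
  using assms \<sigma>_measurable integrable_distr[OF \<sigma>_measurable, of "\<lambda>x. (norm (f x))\<^sup>2"]
  by (auto simp: L2_def \<sigma>_distr intro: measurable_compose)

lemma l2norm_\<sigma>: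
  fixes f :: "real^'n \<Rightarrow> 'b::euclidean_space"
  assumes "f \<in> L2 \<mu>"
  shows "l2norm \<mu> (\<lambda>x. f (\<sigma> x)) = l2norm \<mu> f"
  using integral_distr[OF \<sigma>_measurable, of "\<lambda>x. (norm (f x))\<^sup>2"] L2_measurable[OF assms]
  by (simp add: l2norm_def \<sigma>_distr)

lemma A_measurable: "A \<in> borel_measurable borel"
  by (intro borel_measurable_continuous_onI linear_continuous_on A_linear)

lemma L2_A\<sigma>:
  assumes "G \<in> L2 \<mu>" shows "(\<lambda>x. A (G (\<sigma> x))) \<in> L2 \<mu>"
  by (rule L2_bound[OF L2_\<sigma>[OF assms], of _ 1])
    (auto simp: A_norm intro: measurable_compose[OF L2_measurable[OF L2_\<sigma>[OF assms]] A_measurable])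

lemma l2norm_A\<sigma>_diff:
  assumes "G \<in> L2 \<mu>" "F \<in> L2 \<mu>"
  shows "l2norm \<mu> (\<lambda>x. A (G (\<sigma> x)) - A (F (\<sigma> x))) = l2norm \<mu> (\<lambda>x. G x - F x)"
proof -
  have "l2norm \<mu> (\<lambda>x. A (G (\<sigma> x)) - A (F (\<sigma> x))) = l2norm \<mu> (\<lambda>x. G (\<sigma> x) - F (\<sigma> x))"
    by (simp add: l2norm_def A_norm linear_diff[OF bounded_linear.linear[OF A_linear], symmetric])
  then show ?thesis using l2norm_\<sigma>[OF L2_diff[OF assms]] by simp
qed

lemma test_\<sigma>:
  assumes \<eta>: "\<eta> \<in> test_functions \<Omega>"
  shows "(\<lambda>x. \<eta> (\<sigma> x)) \<in> test_functions \<Omega>"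
    and "grad (\<lambda>x. \<eta> (\<sigma> x)) x = A (grad \<eta> (\<sigma> x))"
proof -
  obtain K where K: "\<And>k. C_k k \<eta>" "compact K" "K \<subseteq> \<Omega>" "\<And>x. x \<notin> K \<Longrightarrow> \<eta> x = 0"
    using \<eta> by (rule test_functionsE) blast
  show "(\<lambda>x. \<eta> (\<sigma> x)) \<in> test_functions \<Omega>"
  proof (rule test_functionsI)
    show "C_k k (\<lambda>x. \<eta> (\<sigma> x))" for k unfolding \<sigma>_eq by (rule C_k_comp_affine[OF A_linear K(1)])
    show "compact (\<sigma> ` K)"
      by (intro compact_continuous_image K(2)) (auto simp: continuous_on_iff \<sigma>_dist)
    show "\<sigma> ` K \<subseteq> \<Omega>" using K(3) \<sigma>_\<Omega> by auto
    show "\<eta> (\<sigma> x) = 0" if "x \<notin> \<sigma> ` K" for x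
      using that K(4)[of "\<sigma> x"] \<sigma>_involution[of x] by (metis imageI)
  qed
  have "(\<sigma> has_derivative A) (at x)"
    using has_derivative_add[OF bounded_linear_imp_has_derivative[OF A_linear] has_derivative_const]
    by (simp add: \<sigma>_eq[abs_def])
  from has_derivative_compose[OF this test_function_derivative[OF \<eta>]]
  have d: "((\<lambda>x. \<eta> (\<sigma> x)) has_derivative (\<lambda>h. frechet_derivative \<eta> (at (\<sigma> x)) (A h))) (at x)" .
  have "frechet_derivative \<eta> (at (\<sigma> x)) h = h \<bullet> grad \<eta> (\<sigma> x)" for h
    using frechet_derivative_eq_sum_partial_deriv[of \<eta> "\<sigma> x" h] test_function_derivative[OF \<eta>]
    by (auto simp: grad_def inner_vec_def differentiable_def)
  then have "partial_deriv i (\<lambda>x. \<eta> (\<sigma> x)) x = A (grad \<eta> (\<sigma> x)) $ i" for i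
    using partial_deriv_eq[OF d] by (simp add: A_symmetric inner_axis' )
  then show "grad (\<lambda>x. \<eta> (\<sigma> x)) x = A (grad \<eta> (\<sigma> x))" by (simp add: grad_def vec_eq_iff)
qed

section \<open>Reflected Sobolev functions and their antisymmetric parts\<close>

lemma h10_test_sequence:
  assumes u: "u \<in> h10_space \<Omega>" and G: "is_weak_gradient \<Omega> u G"
  obtains \<eta> where "\<And>k. \<eta> k \<in> test_functions \<Omega>" "(\<lambda>k. l2norm \<mu> (\<lambda>x. \<eta> k x - u x)) \<longlonglongrightarrow> 0"
    "(\<lambda>k. l2norm \<mu> (\<lambda>x. grad (\<eta> k) x - G x)) \<longlonglongrightarrow> 0"
proof -
  obtain \<eta> where \<eta>: "\<And>k. \<eta> k \<in> test_functions \<Omega>" "(\<lambda>k. h1_norm \<Omega> (u - \<eta> k)) \<longlonglongrightarrow> 0"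
    using h10_approx[OF u] by blast
  note u1 = h10_h1[OF u]
  have "h1_norm \<Omega> (\<eta> k - u) = h1_norm \<Omega> (u - \<eta> k)" for k
    using h1_norm_scale[OF h1_space_diff[OF u1 test_h1[OF \<eta>(1)[of k]]], of "-1"]
    by (simp add: fun_diff_def)
  then have "(\<lambda>k. h1_norm \<Omega> (\<eta> k - u)) \<longlonglongrightarrow> 0" using \<eta>(2) by simp
  then show thesis
    using h1_norm_diff_tendsto_iff[of \<eta> u "\<lambda>k. grad (\<eta> k)" G, OF test_L2[OF \<eta>(1)]
        h1_space_L2[OF u1] is_weak_gradient_test[OF \<eta>(1)] G] \<eta>(1)
    by (intro that[of \<eta>]) auto
qed

text \<open>Reflection preserves the L^2 distances of values and, since \<open>A\<close> is an
  isometry, of gradients as well, so the formula for test functions passes to the limit.\<close>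

lemma h10_\<sigma>:
  assumes u: "u \<in> h10_space \<Omega>" and G: "is_weak_gradient \<Omega> u G"
  shows "(\<lambda>x. u (\<sigma> x)) \<in> h10_space \<Omega>" "is_weak_gradient \<Omega> (\<lambda>x. u (\<sigma> x)) (\<lambda>x. A (G (\<sigma> x)))"
proof -
  obtain \<eta> where \<eta>: "\<And>k. \<eta> k \<in> test_functions \<Omega>" "(\<lambda>k. l2norm \<mu> (\<lambda>x. \<eta> k x - u x)) \<longlonglongrightarrow> 0"
    "(\<lambda>k. l2norm \<mu> (\<lambda>x. grad (\<eta> k) x - G x)) \<longlonglongrightarrow> 0" using h10_test_sequence[OF u G] by blast
  note uL = h1_space_L2[OF h10_h1[OF u]]
  note GL = weak_gradient_L2[OF G]
  note gL = weak_gradient_L2[OF is_weak_gradient_test[OF \<eta>(1)]]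
  have g: "grad (\<lambda>x. \<eta> n (\<sigma> x)) = (\<lambda>x. A (grad (\<eta> n) (\<sigma> x)))" for n
    by (rule ext) (rule test_\<sigma>(2)[OF \<eta>(1)])
  have 1: "(\<lambda>x. \<eta> n (\<sigma> x)) \<in> h10_space \<Omega>" "is_weak_gradient \<Omega> (\<lambda>x. \<eta> n (\<sigma> x)) (\<lambda>x. A (grad (\<eta> n) (\<sigma> x)))" for n
    using test_h10[OF test_\<sigma>(1)[OF \<eta>(1)]] is_weak_gradient_test[OF test_\<sigma>(1)[OF \<eta>(1)], of n]
    by (simp_all only: g)
  have 2: "(\<lambda>n. l2norm \<mu> (\<lambda>x. \<eta> n (\<sigma> x) - u (\<sigma> x))) \<longlonglongrightarrow> 0"
    using \<eta>(2) by (simp add: l2norm_\<sigma>[OF L2_diff[OF test_L2[OF \<eta>(1)] uL]])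
  have 3: "(\<lambda>n. l2norm \<mu> (\<lambda>x. A (grad (\<eta> n) (\<sigma> x)) - A (G (\<sigma> x)))) \<longlonglongrightarrow> 0"
    using \<eta>(3) by (simp add: l2norm_A\<sigma>_diff[OF gL GL])
  show "(\<lambda>x. u (\<sigma> x)) \<in> h10_space \<Omega>" "is_weak_gradient \<Omega> (\<lambda>x. u (\<sigma> x)) (\<lambda>x. A (G (\<sigma> x)))"
    using h10_limit[of "\<lambda>n x. \<eta> n (\<sigma> x)" "\<lambda>n x. A (grad (\<eta> n) (\<sigma> x))", OF 1 L2_\<sigma>[OF uL] L2_A\<sigma>[OF GL] 2 3]
    by auto
qed

text \<open>Twice the antisymmetric component of \<open>u\<close>. Without the factor 1/2 it is the
  very difference whose sign decides which of the two values is the larger.\<close>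

definition odd_part :: "(real^'n \<Rightarrow> real) \<Rightarrow> real^'n \<Rightarrow> real" where
  "odd_part u x = u x - u (\<sigma> x)"

text \<open>The gradient of \<open>odd_part u\<close> when \<open>G\<close> is that of
  \<open>u\<close>, since the reflected function has the gradient
  \<open>A (G (\<sigma> x))\<close>.\<close>

definition odd_gradient :: "(real^'n \<Rightarrow> real^'n) \<Rightarrow> real^'n \<Rightarrow> real^'n" where
  "odd_gradient G x = G x - A (G (\<sigma> x))"

lemma h10_odd_part:
  assumes u: "u \<in> h10_space \<Omega>" and G: "is_weak_gradient \<Omega> u G"
  shows "odd_part u \<in> h10_space \<Omega>" "is_weak_gradient \<Omega> (odd_part u) (odd_gradient G)"
proof -
  note s = h10_\<sigma>[OF u G]
  show "odd_part u \<in> h10_space \<Omega>"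
    using h10_lincomb[OF u s(1), of 1 "-1"] by (simp add: odd_part_def[abs_def])
  show "is_weak_gradient \<Omega> (odd_part u) (odd_gradient G)"
    using is_weak_gradient_lincomb[OF h1_space_L2[OF h10_h1[OF u]]
        h1_space_L2[OF h10_h1[OF s(1)]] G s(2), of 1 "-1"]
    by (simp add: odd_part_def[abs_def] odd_gradient_def[abs_def])
qed

lemma odd_part_tendsto:
  assumes "\<And>n. un n \<in> L2 \<mu>" "u \<in> L2 \<mu>" "(\<lambda>n. l2norm \<mu> (\<lambda>x. un n x - u x)) \<longlonglongrightarrow> 0"
  shows "(\<lambda>n. l2norm \<mu> (\<lambda>x. odd_part (un n) x - odd_part u x)) \<longlonglongrightarrow> 0"
proof (rule tendsto_sandwich[OF _ _ tendsto_const])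
  show "(\<lambda>n. 2 * l2norm \<mu> (\<lambda>x. un n x - u x)) \<longlonglongrightarrow> 0"
    using tendsto_mult_left[OF assms(3), of 2] by simp
  have "l2norm \<mu> (\<lambda>x. odd_part (un n) x - odd_part u x) \<le> 2 * l2norm \<mu> (\<lambda>x. un n x - u x)" for n
  proof -
    note d = L2_diff[OF assms(1)[of n] assms(2)]
    have "l2norm \<mu> (\<lambda>x. odd_part (un n) x - odd_part u x) =
        l2norm \<mu> (\<lambda>x. (un n x - u x) + (-1) *\<^sub>R (un n (\<sigma> x) - u (\<sigma> x)))"
      by (simp add: odd_part_def algebra_simps)
    also have "\<dots> \<le> l2norm \<mu> (\<lambda>x. un n x - u x) + l2norm \<mu> (\<lambda>x. (-1) *\<^sub>R (un n (\<sigma> x) - u (\<sigma> x)))"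
      by (intro l2norm_triangle d L2_scaleR L2_\<sigma>[OF d])
    also have "l2norm \<mu> (\<lambda>x. (-1) *\<^sub>R (un n (\<sigma> x) - u (\<sigma> x))) = l2norm \<mu> (\<lambda>x. un n x - u x)"
      unfolding l2norm_scaleR using l2norm_\<sigma>[OF d] by simp
    finally show ?thesis by simp
  qed
  then show "\<forall>\<^sub>F n in sequentially. l2norm \<mu> (\<lambda>x. odd_part (un n) x - odd_part u x) \<le> 2 * l2norm \<mu> (\<lambda>x. un n x - u x)"
    by simp
qed simp

lemma odd_gradient_tendsto:
  assumes "\<And>n. Gn n \<in> L2 \<mu>" "G \<in> L2 \<mu>" "(\<lambda>n. l2norm \<mu> (\<lambda>x. Gn n x - G x)) \<longlonglongrightarrow> 0"
  shows "(\<lambda>n. l2norm \<mu> (\<lambda>x. odd_gradient (Gn n) x - odd_gradient G x)) \<longlonglongrightarrow> 0"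
proof (rule tendsto_sandwich[OF _ _ tendsto_const])
  show "(\<lambda>n. 2 * l2norm \<mu> (\<lambda>x. Gn n x - G x)) \<longlonglongrightarrow> 0"
    using tendsto_mult_left[OF assms(3), of 2] by simp
  have "l2norm \<mu> (\<lambda>x. odd_gradient (Gn n) x - odd_gradient G x) \<le> 2 * l2norm \<mu> (\<lambda>x. Gn n x - G x)" for n
  proof -
    note L = assms(1)[of n] assms(2)
    have "l2norm \<mu> (\<lambda>x. odd_gradient (Gn n) x - odd_gradient G x) =
        l2norm \<mu> (\<lambda>x. (Gn n x - G x) + (-1) *\<^sub>R (A (Gn n (\<sigma> x)) - A (G (\<sigma> x))))"
      by (simp add: odd_gradient_def algebra_simps)
    also have "\<dots> \<le> l2norm \<mu> (\<lambda>x. Gn n x - G x) + l2norm \<mu> (\<lambda>x. (-1) *\<^sub>R (A (Gn n (\<sigma> x)) - A (G (\<sigma> x))))"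
      by (intro l2norm_triangle L2_diff L2_scaleR L2_A\<sigma> L)
    also have "l2norm \<mu> (\<lambda>x. (-1) *\<^sub>R (A (Gn n (\<sigma> x)) - A (G (\<sigma> x)))) = l2norm \<mu> (\<lambda>x. Gn n x - G x)"
      unfolding l2norm_scaleR using l2norm_A\<sigma>_diff[OF L] by simp
    finally show ?thesis by simp
  qed
  then show "\<forall>\<^sub>F n in sequentially. l2norm \<mu> (\<lambda>x. odd_gradient (Gn n) x - odd_gradient G x) \<le> 2 * l2norm \<mu> (\<lambda>x. Gn n x - G x)"
    by simp
qed simp

lemma odd_part_fixed: "a \<bullet> x = b \<Longrightarrow> odd_part u x = 0"
  by (simp add: odd_part_def \<sigma>_fixed)

text \<open>The sign \<open>S\<close> may jump across the reflecting hyperplane, where odd functions vanish.\<close>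

lemma h10_signed_comp_smooth:
  assumes u: "u \<in> h10_space \<Omega>" and G: "is_weak_gradient \<Omega> u G"
    and S: "\<And>x. \<bar>S x\<bar> = 1" "S \<in> borel_measurable \<mu>" "\<And>x. a \<bullet> x \<noteq> b \<Longrightarrow> \<exists>U. open U \<and> x \<in> U \<and> (\<forall>y\<in>U. S y = S x)"
    and f: "smooth_real f" "\<And>t. (f has_real_derivative f' t) (at t)" "continuous_on UNIV f'" "\<And>t. \<bar>f' t\<bar> \<le> 1"
    and \<delta>: "\<delta> > 0" "\<And>t. \<bar>t\<bar> < \<delta> \<Longrightarrow> f t = 0"
  shows "(\<lambda>x. S x * f (odd_part u x)) \<in> h10_space \<Omega>"
    "is_weak_gradient \<Omega> (\<lambda>x. S x * f (odd_part u x)) (\<lambda>x. (S x * f' (odd_part u x)) *\<^sub>R odd_gradient G x)"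
proof -
  obtain \<eta> where \<eta>: "\<And>k. \<eta> k \<in> test_functions \<Omega>" "(\<lambda>k. l2norm \<mu> (\<lambda>x. \<eta> k x - u x)) \<longlonglongrightarrow> 0"
    "(\<lambda>k. l2norm \<mu> (\<lambda>x. grad (\<eta> k) x - G x)) \<longlonglongrightarrow> 0" using h10_test_sequence[OF u G] by blast
  have uL: "u \<in> L2 \<mu>" by (rule h1_space_L2[OF h10_h1[OF u]])
  note w = h10_odd_part[OF u G]
  have wL: "odd_part u \<in> L2 \<mu>" by (rule h1_space_L2[OF h10_h1[OF w(1)]])
  have GwL: "odd_gradient G \<in> L2 \<mu>" by (rule weak_gradient_L2[OF w(2)])
  \<comment> \<open>Test functions for \<open>u\<close> are antisymmetrized, rather than
    \<open>odd_part u\<close> being approximated directly, so that the approximants vanish exactly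
    on the hyperplane where \<open>S\<close> may jump.\<close>
  define \<zeta> where "\<zeta> k = odd_part (\<eta> k)" for k
  have \<zeta>: "\<zeta> k \<in> test_functions \<Omega>" for k
    using test_function_add[OF \<eta>(1) test_function_cmult[OF test_\<sigma>(1)[OF \<eta>(1)], of "-1"], of k k]
    by (simp add: \<zeta>_def odd_part_def[abs_def])
  have grad_\<zeta>: "grad (\<zeta> k) = odd_gradient (grad (\<eta> k))" for k
  proof
    fix x
    have "grad (\<zeta> k) x = grad (\<eta> k) x - grad (\<lambda>x. \<eta> k (\<sigma> x)) x"
      using partial_deriv_linear[OF \<eta>(1) test_\<sigma>(1)[OF \<eta>(1)], of _ 1 k "-1" k x]
      by (simp add: \<zeta>_def odd_part_def[abs_def] grad_def vec_eq_iff)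
    then show "grad (\<zeta> k) x = odd_gradient (grad (\<eta> k)) x" by (simp add: odd_gradient_def test_\<sigma>(2)[OF \<eta>(1)])
  qed
  have \<zeta>L: "\<zeta> k \<in> L2 \<mu>" for k by (rule test_L2[OF \<zeta>])
  have gL: "grad (\<eta> k) \<in> L2 \<mu>" "grad (\<zeta> k) \<in> L2 \<mu>" for k
    using weak_gradient_L2[OF is_weak_gradient_test[OF \<eta>(1)]]
      weak_gradient_L2[OF is_weak_gradient_test[OF \<zeta>]] by auto
  have \<zeta>_lim: "(\<lambda>k. l2norm \<mu> (\<lambda>x. \<zeta> k x - odd_part u x)) \<longlonglongrightarrow> 0"
    unfolding \<zeta>_def by (rule odd_part_tendsto[OF test_L2[OF \<eta>(1)] uL \<eta>(2)])
  have grad_lim: "(\<lambda>k. l2norm \<mu> (\<lambda>x. grad (\<zeta> k) x - odd_gradient G x)) \<longlonglongrightarrow> 0"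
    unfolding grad_\<zeta> by (rule odd_gradient_tendsto[OF gL(1) weak_gradient_L2[OF G] \<eta>(3)])
  have S\<zeta>: "\<exists>U. open U \<and> x \<in> U \<and> (\<forall>y\<in>U. S y = S x)" if "\<zeta> k x \<noteq> 0" for k x
    using that S(3)[of x] odd_part_fixed[of x "\<eta> k"] by (auto simp: \<zeta>_def)
  note test = test_function_signed_comp[OF \<zeta> f(1,2) \<delta> S\<zeta>]
  have f_lip: "\<bar>f s - f t\<bar> \<le> \<bar>s - t\<bar>" for s t
  proof -
    have "norm (f s - f t) \<le> 1 * norm (s - t)"
      by (rule field_differentiable_bound[of UNIV f f']) (use f in auto)
    then show ?thesis by simp
  qed
  have f_meas: "f \<in> borel_measurable borel" "f' \<in> borel_measurable borel"
    using f(2,3) by (auto intro!: borel_measurable_continuous_onI continuous_at_imp_continuous_on intro: DERIV_isCont)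
  have f0: "f 0 = 0" using \<delta> by simp
  have fw_meas: "(\<lambda>x. S x * f (v x)) \<in> borel_measurable \<mu>" if "v \<in> L2 \<mu>" for v
    using S(2) measurable_compose[OF L2_measurable[OF that] f_meas(1)] by measurable
  have fwL: "(\<lambda>x. S x * f (odd_part u x)) \<in> L2 \<mu>"
    by (rule L2_bound[OF wL fw_meas[OF wL], of 1])
      (use f_lip[of _ 0] f0 S(1) in \<open>auto simp: abs_mult\<close>)
  have GfL: "(\<lambda>x. (S x * f' (odd_part u x)) *\<^sub>R odd_gradient G x) \<in> L2 \<mu>"
  proof (rule L2_bound[OF GwL, of _ 1])
    show "(\<lambda>x. (S x * f' (odd_part u x)) *\<^sub>R odd_gradient G x) \<in> borel_measurable \<mu>"
      using S(2) measurable_compose[OF L2_measurable[OF wL] f_meas(2)] L2_measurable[OF GwL] by measurable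
  qed (use f(4) S(1) in \<open>auto simp: abs_mult mult_left_le_one_le\<close>)
  have lim1: "(\<lambda>k. l2norm \<mu> (\<lambda>x. S x * f (\<zeta> k x) - S x * f (odd_part u x))) \<longlonglongrightarrow> 0"
  proof (rule tendsto_sandwich[OF _ _ tendsto_const \<zeta>_lim]; intro always_eventually allI)
    fix k
    show "l2norm \<mu> (\<lambda>x. S x * f (\<zeta> k x) - S x * f (odd_part u x)) \<le> l2norm \<mu> (\<lambda>x. \<zeta> k x - odd_part u x)"
    proof (rule l2norm_mono[OF L2_diff[OF \<zeta>L wL]])
      show "(\<lambda>x. S x * f (\<zeta> k x) - S x * f (odd_part u x)) \<in> borel_measurable \<mu>"
        using fw_meas[OF \<zeta>L] fw_meas[OF wL] by (rule borel_measurable_diff)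
    qed (use f_lip S(1) in \<open>auto simp: abs_mult right_diff_distrib[symmetric]\<close>)
  qed simp
  have lim2: "(\<lambda>k. l2norm \<mu> (\<lambda>x. (S x * f' (\<zeta> k x)) *\<^sub>R grad (\<zeta> k) x - (S x * f' (odd_part u x)) *\<^sub>R odd_gradient G x)) \<longlonglongrightarrow> 0"
  proof -
    \<comment> \<open>The factor \<open>S\<close> has modulus 1 and drops out of the norm; what
      remains is a continuous multiplier \<open>f'\<close> applied to convergent gradients.\<close>
    have "(\<lambda>k. l2norm \<mu> (\<lambda>x. f' (\<zeta> k x) *\<^sub>R grad (\<zeta> k) x - f' (odd_part u x) *\<^sub>R odd_gradient G x)) \<longlonglongrightarrow> 0"
      using f(3) by (intro l2norm_multiplier_tendsto gL GwL grad_lim \<zeta>L wL \<zeta>_lim f_meas(2) f(4))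
        (auto simp: continuous_on_eq_continuous_at)
    moreover have "l2norm \<mu> (\<lambda>x. (S x * f' (\<zeta> k x)) *\<^sub>R grad (\<zeta> k) x - (S x * f' (odd_part u x)) *\<^sub>R odd_gradient G x) =
        l2norm \<mu> (\<lambda>x. f' (\<zeta> k x) *\<^sub>R grad (\<zeta> k) x - f' (odd_part u x) *\<^sub>R odd_gradient G x)" for k
    proof -
      have "norm ((S x * f' (\<zeta> k x)) *\<^sub>R grad (\<zeta> k) x - (S x * f' (odd_part u x)) *\<^sub>R odd_gradient G x) =
          norm (S x *\<^sub>R (f' (\<zeta> k x) *\<^sub>R grad (\<zeta> k) x - f' (odd_part u x) *\<^sub>R odd_gradient G x))" for x
        by (simp add: scaleR_diff_right)
      then show ?thesis by (simp add: l2norm_def S(1) del: scaleR_diff_right)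
    qed
    ultimately show ?thesis by simp
  qed
  have W: "is_weak_gradient \<Omega> (\<lambda>x. S x * f (\<zeta> k x)) (\<lambda>x. (S x * f' (\<zeta> k x)) *\<^sub>R grad (\<zeta> k) x)" for k
    using is_weak_gradient_test[OF test(1)[of k]] ext[of "grad (\<lambda>x. S x * f (\<zeta> k x))", OF test(2)] by simp
  show "(\<lambda>x. S x * f (odd_part u x)) \<in> h10_space \<Omega>"
    "is_weak_gradient \<Omega> (\<lambda>x. S x * f (odd_part u x)) (\<lambda>x. (S x * f' (odd_part u x)) *\<^sub>R odd_gradient G x)"
    using h10_limit[of "\<lambda>k x. S x * f (\<zeta> k x)" "\<lambda>k x. (S x * f' (\<zeta> k x)) *\<^sub>R grad (\<zeta> k) x",
        OF test_h10[OF test(1)] W fwL GfL lim1 lim2] by auto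
qed

text \<open>Here \<open>u\<close> is fixed and the smooth \<open>f k\<close> tend to a limit
  \<open>F\<close> that may have a kink. The bounds \<open>\<bar>t\<bar>\<close> and 1 dominate
  values and gradients, so pointwise convergence is enough.\<close>

lemma h10_signed_comp:
  assumes u: "u \<in> h10_space \<Omega>" and G: "is_weak_gradient \<Omega> u G"
    and S: "\<And>x. \<bar>S x\<bar> = 1" "S \<in> borel_measurable \<mu>" "\<And>x. a \<bullet> x \<noteq> b \<Longrightarrow> \<exists>U. open U \<and> x \<in> U \<and> (\<forall>y\<in>U. S y = S x)"
    and f: "\<And>k. smooth_real (f k)" "\<And>k t. (f k has_real_derivative f' k t) (at t)"
      "\<And>k. continuous_on UNIV (f' k)" "\<And>k t. \<bar>f' k t\<bar> \<le> 1" "\<And>k t. \<bar>f k t\<bar> \<le> \<bar>t\<bar>"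
    and \<delta>: "\<And>k. \<delta> k > 0" "\<And>k t. \<bar>t\<bar> < \<delta> k \<Longrightarrow> f k t = 0"
    and lim: "\<And>t. (\<lambda>k. f k t) \<longlonglongrightarrow> F t" "\<And>t. (\<lambda>k. f' k t) \<longlonglongrightarrow> \<theta> t"
  shows "(\<lambda>x. S x * F (odd_part u x)) \<in> h10_space \<Omega>"
    "is_weak_gradient \<Omega> (\<lambda>x. S x * F (odd_part u x)) (\<lambda>x. (S x * \<theta> (odd_part u x)) *\<^sub>R odd_gradient G x)"
proof -
  note w = h10_odd_part[OF u G]
  have wL: "odd_part u \<in> L2 \<mu>" by (rule h1_space_L2[OF h10_h1[OF w(1)]])
  have GwL: "odd_gradient G \<in> L2 \<mu>" by (rule weak_gradient_L2[OF w(2)])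
  note k = h10_signed_comp_smooth[OF u G S f(1,2,3,4) \<delta>]
  have fkL: "(\<lambda>x. S x * f k (odd_part u x)) \<in> L2 \<mu>" for k
    by (rule h1_space_L2[OF h10_h1[OF k(1)]])
  have gkL: "(\<lambda>x. (S x * f' k (odd_part u x)) *\<^sub>R odd_gradient G x) \<in> L2 \<mu>" for k
    by (rule weak_gradient_L2[OF k(2)])
  have F: "\<bar>F t\<bar> \<le> \<bar>t\<bar>" and \<theta>: "\<bar>\<theta> t\<bar> \<le> 1" for t
    using LIMSEQ_le_const2[OF tendsto_rabs[OF lim(1)[of t]], of "\<bar>t\<bar>"] f(5)
      LIMSEQ_le_const2[OF tendsto_rabs[OF lim(2)[of t]], of 1] f(4) by auto
  have lim1: "(\<lambda>k. S x * f k (odd_part u x)) \<longlonglongrightarrow> S x * F (odd_part u x)" for x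
    by (intro tendsto_mult tendsto_const lim)
  have lim2: "(\<lambda>k. (S x * f' k (odd_part u x)) *\<^sub>R odd_gradient G x) \<longlonglongrightarrow> (S x * \<theta> (odd_part u x)) *\<^sub>R odd_gradient G x" for x
    by (intro tendsto_scaleR tendsto_mult tendsto_const lim)
  have Fm: "(\<lambda>x. S x * F (odd_part u x)) \<in> borel_measurable \<mu>"
    by (rule borel_measurable_LIMSEQ_metric[OF L2_measurable[OF fkL] lim1])
  have \<theta>m: "(\<lambda>x. (S x * \<theta> (odd_part u x)) *\<^sub>R odd_gradient G x) \<in> borel_measurable \<mu>"
    by (rule borel_measurable_LIMSEQ_metric[OF L2_measurable[OF gkL] lim2])
  have FL: "(\<lambda>x. S x * F (odd_part u x)) \<in> L2 \<mu>"
    by (rule L2_bound[OF wL Fm, of 1]) (use F S(1) in \<open>auto simp: abs_mult\<close>)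
  have \<theta>L: "(\<lambda>x. (S x * \<theta> (odd_part u x)) *\<^sub>R odd_gradient G x) \<in> L2 \<mu>"
    by (rule L2_bound[OF GwL \<theta>m, of 1]) (use \<theta> S(1) in \<open>auto simp: abs_mult mult_left_le_one_le\<close>)
  have c1: "(\<lambda>k. l2norm \<mu> (\<lambda>x. S x * f k (odd_part u x) - S x * F (odd_part u x))) \<longlonglongrightarrow> 0"
  proof (rule l2norm_dominated_convergence[where K=2, OF L2_measurable[OF fkL] Fm wL])
    fix k show "AE x in \<mu>. norm (S x * f k (odd_part u x) - S x * F (odd_part u x)) \<le> 2 * norm (odd_part u x)"
    proof (intro always_eventually allI)
      fix x
      have "\<bar>f k (odd_part u x) - F (odd_part u x)\<bar> \<le> 2 * \<bar>odd_part u x\<bar>"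
        using f(5)[of k "odd_part u x"] F[of "odd_part u x"] by linarith
      then show "norm (S x * f k (odd_part u x) - S x * F (odd_part u x)) \<le> 2 * norm (odd_part u x)"
        using S(1)[of x] by (simp add: right_diff_distrib[symmetric] abs_mult)
    qed
  qed (use lim1 in auto)
  have c2: "(\<lambda>k. l2norm \<mu> (\<lambda>x. (S x * f' k (odd_part u x)) *\<^sub>R odd_gradient G x - (S x * \<theta> (odd_part u x)) *\<^sub>R odd_gradient G x)) \<longlonglongrightarrow> 0"
  proof (rule l2norm_dominated_convergence[where K=2, OF L2_measurable[OF gkL] \<theta>m GwL])
    fix k show "AE x in \<mu>. norm ((S x * f' k (odd_part u x)) *\<^sub>R odd_gradient G x - (S x * \<theta> (odd_part u x)) *\<^sub>R odd_gradient G x) \<le> 2 * norm (odd_gradient G x)"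
    proof (intro always_eventually allI)
      fix x
      have "\<bar>f' k (odd_part u x) - \<theta> (odd_part u x)\<bar> \<le> 2"
        using f(4)[of k "odd_part u x"] \<theta>[of "odd_part u x"] by linarith
      then have "\<bar>S x * f' k (odd_part u x) - S x * \<theta> (odd_part u x)\<bar> \<le> 2"
        using S(1)[of x] by (simp add: right_diff_distrib[symmetric] abs_mult)
      then show "norm ((S x * f' k (odd_part u x)) *\<^sub>R odd_gradient G x - (S x * \<theta> (odd_part u x)) *\<^sub>R odd_gradient G x) \<le> 2 * norm (odd_gradient G x)"
        by (simp add: scaleR_diff_left[symmetric] mult_right_mono)
    qed
  qed (use lim2 in auto)
  show "(\<lambda>x. S x * F (odd_part u x)) \<in> h10_space \<Omega>"
    "is_weak_gradient \<Omega> (\<lambda>x. S x * F (odd_part u x)) (\<lambda>x. (S x * \<theta> (odd_part u x)) *\<^sub>R odd_gradient G x)"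
    using h10_limit[of "\<lambda>k x. S x * f k (odd_part u x)" "\<lambda>k x. (S x * f' k (odd_part u x)) *\<^sub>R odd_gradient G x",
        OF k FL \<theta>L c1 c2] by auto
qed

text \<open>The sign \<open>c\<close> combines positive and negative part into the absolute value
  (\<open>c = 1\<close>) or the identity (\<open>c = - 1\<close>); the former enters the
  polarization, the latter yields the vanishing of gradients on zero sets. At each \<open>t\<close>
  at most one of the two terms is nonzero, which keeps the bounds \<open>\<bar>t\<bar>\<close> and
  1.\<close>

lemma h10_signed_pos_neg:
  fixes c :: real
  defines "F \<equiv> \<lambda>t. max 0 t + c * max 0 (- t)"
    and "\<theta> \<equiv> \<lambda>t::real. (if t > 0 then 1 else 0) - c * (if - t > 0 then 1 else 0)"
  assumes u: "u \<in> h10_space \<Omega>" and G: "is_weak_gradient \<Omega> u G"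
    and S: "\<And>x. \<bar>S x\<bar> = 1" "S \<in> borel_measurable \<mu>"
      "\<And>x. a \<bullet> x \<noteq> b \<Longrightarrow> \<exists>U. open U \<and> x \<in> U \<and> (\<forall>y\<in>U. S y = S x)"
    and c: "\<bar>c\<bar> = 1"
  shows "(\<lambda>x. S x * F (odd_part u x)) \<in> h10_space \<Omega>"
    "is_weak_gradient \<Omega> (\<lambda>x. S x * F (odd_part u x)) (\<lambda>x. (S x * \<theta> (odd_part u x)) *\<^sub>R odd_gradient G x)"
proof -
  define f where "f k t = smooth_pos k t + c * smooth_pos k (- t)" for k t
  define f' where "f' k t = smooth_pos' k t - c * smooth_pos' k (- t)" for k t
  have neg0: "smooth_pos k t = 0" "smooth_pos' k t = 0" if "t \<le> 1 / real (Suc k)" for k t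
    using smooth_pos_eq_0[OF that] by auto
  have neg: "smooth_pos k t = 0" "smooth_pos' k t = 0" if "t \<le> 0" for k t
    using neg0[of t k] order_trans[OF that, of "1 / real (Suc k)"] by simp_all
  have 1: "smooth_real (f k)" for k
    using smooth_real_add[OF smooth_real_smooth_pos smooth_real_affine[OF smooth_real_smooth_pos, of c k "-1" 0], of k]
    by (simp add: f_def[abs_def])
  have 2: "(f k has_real_derivative f' k t) (at t)" for k t
  proof -
    have "((\<lambda>t. - t) has_real_derivative - 1) (at t)" by (auto intro!: derivative_eq_intros)
    from DERIV_add[OF smooth_pos_derivative[of k t]
        DERIV_cmult[OF DERIV_chain2[where g="\<lambda>t. - t", OF smooth_pos_derivative[of k "- t"] this], of c]]
    show ?thesis by (simp add: f_def[abs_def] f'_def)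
  qed
  have flat_cont: "continuous_on UNIV (flat d m)" if "d > 0" for d m
    using flat_has_derivative[OF that] by (auto intro!: continuous_at_imp_continuous_on DERIV_isCont)
  have cont': "continuous_on UNIV (smooth_pos' k)" for k
    unfolding smooth_pos'_def[abs_def]
    by (intro continuous_on_add continuous_on_mult continuous_on_const
        continuous_on_compose2[OF flat_cont] continuous_on_diff continuous_on_id) auto
  have 3: "continuous_on UNIV (f' k)" for k
    unfolding f'_def[abs_def]
    by (intro continuous_on_diff continuous_on_mult continuous_on_const cont'
        continuous_on_compose2[OF cont', of UNIV uminus] continuous_on_minus continuous_on_id) auto
  have 4: "\<bar>f' k t\<bar> \<le> 1" for k t
    using smooth_pos'_bounds[of k t] smooth_pos'_bounds[of k "- t"] neg(2)[of t k] neg(2)[of "- t" k] c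
    by (cases "t \<le> 0") (auto simp: f'_def abs_mult)
  have 5: "\<bar>f k t\<bar> \<le> \<bar>t\<bar>" for k t
    using smooth_pos_bounds[of k t] smooth_pos_bounds[of k "- t"] neg(1)[of t k] neg(1)[of "- t" k] c
    by (cases "t \<le> 0") (auto simp: f_def abs_mult)
  have 6: "f k t = 0" if "\<bar>t\<bar> < 1 / real (Suc k)" for k t
  proof -
    have "t \<le> 1 / real (Suc k)" "- t \<le> 1 / real (Suc k)" using that by linarith+
    then show ?thesis using neg0(1) by (simp add: f_def)
  qed
  have 7: "(\<lambda>k. f k t) \<longlonglongrightarrow> F t" "(\<lambda>k. f' k t) \<longlonglongrightarrow> \<theta> t" for t
    unfolding f_def f'_def F_def \<theta>_def
    by (intro tendsto_add tendsto_diff tendsto_mult tendsto_const smooth_pos_tendsto smooth_pos'_tendsto)+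
  show "(\<lambda>x. S x * F (odd_part u x)) \<in> h10_space \<Omega>"
    "is_weak_gradient \<Omega> (\<lambda>x. S x * F (odd_part u x)) (\<lambda>x. (S x * \<theta> (odd_part u x)) *\<^sub>R odd_gradient G x)"
    using h10_signed_comp[where \<delta>="\<lambda>k. 1 / real (Suc k)", OF u G S 1 2 3 4 5 _ 6 7] by simp_all
qed

text \<open>Taking \<open>c = - 1\<close> above recovers \<open>odd_part u\<close> itself with a gradient that is zero where
  \<open>odd_part u\<close> is; compare with the uniqueness of the weak gradient.\<close>

lemma odd_gradient_zero_AE:
  assumes u: "u \<in> h10_space \<Omega>" and G: "is_weak_gradient \<Omega> u G"
  shows "AE x in \<mu>. odd_part u x = 0 \<longrightarrow> odd_gradient G x = 0"
proof -
  have "max 0 t + - 1 * max 0 (- t) = t" for t :: real by simp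
  then have "is_weak_gradient \<Omega> (odd_part u)
      (\<lambda>x. ((if odd_part u x > 0 then 1 else 0) + (if odd_part u x < 0 then 1 else 0)) *\<^sub>R odd_gradient G x)"
    using h10_signed_pos_neg(2)[OF u G, of "\<lambda>_. 1" "-1"] by auto
  from weak_gradient_unique[OF this h10_odd_part(2)[OF u G]]
  show ?thesis by eventually_elim auto
qed

section \<open>The polarization and its continuity\<close>

definition side :: "real^'n \<Rightarrow> real" where
  "side x = (if a \<bullet> x \<le> b then 1 else - 1)"

lemma side: "\<bar>side x\<bar> = 1" "side \<in> borel_measurable \<mu>"
  "a \<bullet> x \<noteq> b \<Longrightarrow> \<exists>U. open U \<and> x \<in> U \<and> (\<forall>y\<in>U. side y = side x)"
proof -
  show "\<bar>side x\<bar> = 1" by (simp add: side_def)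
  have "{x. a \<bullet> x \<le> b} \<in> sets borel" by (simp add: closed_halfspace_le borel_closed)
  then have "side \<in> borel_measurable borel" unfolding side_def[abs_def] by (intro measurable_If) auto
  then show "side \<in> borel_measurable \<mu>"
    by (simp add: measurable_completion measurable_restrict_space1 measurable_lborel1)
  assume "a \<bullet> x \<noteq> b"
  then consider "a \<bullet> x < b" | "a \<bullet> x > b" by linarith
  then show "\<exists>U. open U \<and> x \<in> U \<and> (\<forall>y\<in>U. side y = side x)"
  proof cases
    case 1
    then show ?thesis by (intro exI[of _ "{y. a \<bullet> y < b}"]) (auto simp: open_halfspace_lt side_def)
  next
    case 2
    then show ?thesis by (intro exI[of _ "{y. a \<bullet> y > b}"]) (auto simp: open_halfspace_gt side_def)
  qed
qed

text \<open>Maximum and minimum of two numbers are their mean plus or minus half their distance, and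
  the mean of \<open>u x\<close> and its reflected value is
  \<open>u x - odd_part u x / 2\<close>.\<close>

lemma polarization_eq:
  "polarization {x. a \<bullet> x \<le> b} u x = u x + (1/2) * (side x * \<bar>odd_part u x\<bar> - odd_part u x)"
  by (simp add: polarization_def odd_part_def side_def \<sigma>_def max_def min_def field_simps)

definition signed_gradient :: "(real^'n \<Rightarrow> real) \<Rightarrow> (real^'n \<Rightarrow> real^'n) \<Rightarrow> real^'n \<Rightarrow> real^'n" where
  "signed_gradient u G x = (side x * sgn (odd_part u x)) *\<^sub>R odd_gradient G x"

lemma h10_signed_abs:
  assumes u: "u \<in> h10_space \<Omega>" and G: "is_weak_gradient \<Omega> u G"
  shows "(\<lambda>x. side x * \<bar>odd_part u x\<bar>) \<in> h10_space \<Omega>"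
    "is_weak_gradient \<Omega> (\<lambda>x. side x * \<bar>odd_part u x\<bar>) (signed_gradient u G)"
proof -
  have "max 0 t + 1 * max 0 (- t) = \<bar>t\<bar>" for t :: real by simp
  moreover have "(if t > 0 then 1 else 0) - 1 * (if - t > 0 then 1 else 0) = sgn t" for t :: real
    by (simp add: sgn_real_def)
  ultimately show "(\<lambda>x. side x * \<bar>odd_part u x\<bar>) \<in> h10_space \<Omega>"
    "is_weak_gradient \<Omega> (\<lambda>x. side x * \<bar>odd_part u x\<bar>) (signed_gradient u G)"
    using h10_signed_pos_neg[OF u G side, of 1] unfolding signed_gradient_def[abs_def] by simp_all
qed

lemma h10_polarization:
  assumes u: "u \<in> h10_space \<Omega>" and G: "is_weak_gradient \<Omega> u G"
  shows "polarization {x. a \<bullet> x \<le> b} u \<in> h10_space \<Omega>"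
    "is_weak_gradient \<Omega> (polarization {x. a \<bullet> x \<le> b} u)
       (\<lambda>x. G x + (1/2) *\<^sub>R (signed_gradient u G x - odd_gradient G x))"
proof -
  note w = h10_odd_part[OF u G] and T = h10_signed_abs[OF u G]
  note L = h1_space_L2[OF h10_h1]
  have eq: "polarization {x. a \<bullet> x \<le> b} u =
      (\<lambda>x. 1 * u x + (1/2) * (1 * (side x * \<bar>odd_part u x\<bar>) + (-1) * odd_part u x))"
    by (rule ext) (simp add: polarization_eq)
  note d = h10_lincomb[OF T(1) w(1), of 1 "-1"]
  note dW = is_weak_gradient_lincomb[OF L[OF T(1)] L[OF w(1)] T(2) w(2), of 1 "-1"]
  show "polarization {x. a \<bullet> x \<le> b} u \<in> h10_space \<Omega>"
    unfolding eq by (rule h10_lincomb[OF u d])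
  show "is_weak_gradient \<Omega> (polarization {x. a \<bullet> x \<le> b} u)
       (\<lambda>x. G x + (1/2) *\<^sub>R (signed_gradient u G x - odd_gradient G x))"
    unfolding eq using is_weak_gradient_lincomb[OF L[OF u] L[OF d] G dW, of 1 "1/2"] by simp
qed

text \<open>The values depend on \<open>u\<close> in a Lipschitz way, the gradients only
  continuously: \<open>sgn\<close> jumps at 0, which the multiplier lemma tolerates because
  \<open>odd_gradient G\<close> vanishes almost everywhere on the zero set of
  \<open>odd_part u\<close>.\<close>

lemma signed_abs_tendsto:
  assumes un: "\<And>n. un n \<in> h10_space \<Omega>" "\<And>n. is_weak_gradient \<Omega> (un n) (Gn n)"
    and u: "u \<in> h10_space \<Omega>" "is_weak_gradient \<Omega> u G"
    and limu: "(\<lambda>n. l2norm \<mu> (\<lambda>x. un n x - u x)) \<longlonglongrightarrow> 0"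
    and limG: "(\<lambda>n. l2norm \<mu> (\<lambda>x. Gn n x - G x)) \<longlonglongrightarrow> 0"
  shows "(\<lambda>n. l2norm \<mu> (\<lambda>x. side x * \<bar>odd_part (un n) x\<bar> - side x * \<bar>odd_part u x\<bar>)) \<longlonglongrightarrow> 0"
    "(\<lambda>n. l2norm \<mu> (\<lambda>x. signed_gradient (un n) (Gn n) x - signed_gradient u G x)) \<longlonglongrightarrow> 0"
proof -
  note L = h1_space_L2[OF h10_h1]
  note wn = h10_odd_part[OF un] and w = h10_odd_part[OF u]
  note limw = odd_part_tendsto[of un, OF L[OF un(1)] L[OF u(1)] limu]
  note limGw = odd_gradient_tendsto[of Gn, OF weak_gradient_L2[OF un(2)] weak_gradient_L2[OF u(2)] limG]
  show "(\<lambda>n. l2norm \<mu> (\<lambda>x. side x * \<bar>odd_part (un n) x\<bar> - side x * \<bar>odd_part u x\<bar>)) \<longlonglongrightarrow> 0"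
  proof (rule tendsto_sandwich[OF _ _ tendsto_const limw]; intro always_eventually allI)
    fix n
    show "l2norm \<mu> (\<lambda>x. side x * \<bar>odd_part (un n) x\<bar> - side x * \<bar>odd_part u x\<bar>)
        \<le> l2norm \<mu> (\<lambda>x. odd_part (un n) x - odd_part u x)"
    proof (rule l2norm_mono[OF L2_diff[OF L[OF wn(1)] L[OF w(1)]]])
      show "(\<lambda>x. side x * \<bar>odd_part (un n) x\<bar> - side x * \<bar>odd_part u x\<bar>) \<in> borel_measurable \<mu>"
        by (rule L2_measurable[OF L2_diff[OF L[OF h10_signed_abs(1)[OF un]] L[OF h10_signed_abs(1)[OF u]]]])
    qed (use side(1) in \<open>auto simp: abs_mult right_diff_distrib[symmetric]\<close>)
  qed simp
  have sgn_meas: "(sgn :: real \<Rightarrow> real) \<in> borel_measurable borel" by measurable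
  have "(\<lambda>n. l2norm \<mu> (\<lambda>x. sgn (odd_part (un n) x) *\<^sub>R odd_gradient (Gn n) x
      - sgn (odd_part u x) *\<^sub>R odd_gradient G x)) \<longlonglongrightarrow> 0"
  proof (rule l2norm_multiplier_tendsto[where \<theta>=sgn and w="odd_part u" and wn="\<lambda>n. odd_part (un n)"
        and G="odd_gradient G" and Gn="\<lambda>n. odd_gradient (Gn n)"])
    show "AE x in \<mu>. isCont sgn (odd_part u x) \<or> odd_gradient G x = 0"
      using odd_gradient_zero_AE[OF u] by eventually_elim (auto intro: isCont_sgn)
  qed (use weak_gradient_L2[OF wn(2)] weak_gradient_L2[OF w(2)] limGw L[OF wn(1)] L[OF w(1)] limw
      sgn_meas in \<open>auto simp: abs_sgn_eq\<close>)
  moreover have "l2norm \<mu> (\<lambda>x. signed_gradient (un n) (Gn n) x - signed_gradient u G x) =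
      l2norm \<mu> (\<lambda>x. sgn (odd_part (un n) x) *\<^sub>R odd_gradient (Gn n) x
      - sgn (odd_part u x) *\<^sub>R odd_gradient G x)" for n
  proof -
    have "norm (signed_gradient (un n) (Gn n) x - signed_gradient u G x) =
        norm (side x *\<^sub>R (sgn (odd_part (un n) x) *\<^sub>R odd_gradient (Gn n) x
      - sgn (odd_part u x) *\<^sub>R odd_gradient G x))" for x
      by (simp add: signed_gradient_def scaleR_diff_right)
    then show ?thesis by (simp add: l2norm_def side(1) del: scaleR_diff_right)
  qed
  ultimately show "(\<lambda>n. l2norm \<mu> (\<lambda>x. signed_gradient (un n) (Gn n) x - signed_gradient u G x)) \<longlonglongrightarrow> 0"
    by simp
qed

lemma polarization_tendsto:
  assumes un: "\<And>n. un n \<in> h10_space \<Omega>" and u: "u \<in> h10_space \<Omega>"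
    and lim: "(\<lambda>n. h1_norm \<Omega> (un n - u)) \<longlonglongrightarrow> 0"
  shows "(\<lambda>n. h1_norm \<Omega> (polarization {x. a \<bullet> x \<le> b} (un n) - polarization {x. a \<bullet> x \<le> b} u)) \<longlonglongrightarrow> 0"
proof -
  define Gn where "Gn n = weak_gradient \<Omega> (un n)" for n
  define G where "G = weak_gradient \<Omega> u"
  have Wn: "is_weak_gradient \<Omega> (un n) (Gn n)" for n
    unfolding Gn_def by (rule h1_space_weak_gradient[OF h10_h1[OF un]])
  have W: "is_weak_gradient \<Omega> u G" unfolding G_def by (rule h1_space_weak_gradient[OF h10_h1[OF u]])
  note L = h1_space_L2[OF h10_h1] note GL = weak_gradient_L2
  have lims: "(\<lambda>n. l2norm \<mu> (\<lambda>x. un n x - u x)) \<longlonglongrightarrow> 0"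
    "(\<lambda>n. l2norm \<mu> (\<lambda>x. Gn n x - G x)) \<longlonglongrightarrow> 0"
    using h1_norm_diff_tendsto_iff[of un u Gn G, OF L[OF un] L[OF u] Wn W] lim by auto
  note T = signed_abs_tendsto[of un Gn, OF un Wn u W lims]
  note o = odd_part_tendsto[of un, OF L[OF un] L[OF u] lims(1)] odd_gradient_tendsto[of Gn, OF GL[OF Wn] GL[OF W] lims(2)]
  note Pn = h10_polarization[OF un Wn] and P = h10_polarization[OF u W]
  have 1: "(\<lambda>n. l2norm \<mu> (\<lambda>x. polarization {x. a \<bullet> x \<le> b} (un n) x - polarization {x. a \<bullet> x \<le> b} u x)) \<longlonglongrightarrow> 0"
    using l2norm_lincomb_tendsto[OF L[OF un] L[OF u] L[OF h10_signed_abs(1)[OF un Wn]] L[OF h10_signed_abs(1)[OF u W]]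
        L[OF h10_odd_part(1)[OF un Wn]] L[OF h10_odd_part(1)[OF u W]] lims(1) T(1) o(1)]
    unfolding polarization_eq by simp
  have 2: "(\<lambda>n. l2norm \<mu> (\<lambda>x. (Gn n x + (1/2) *\<^sub>R (signed_gradient (un n) (Gn n) x - odd_gradient (Gn n) x)) -
      (G x + (1/2) *\<^sub>R (signed_gradient u G x - odd_gradient G x)))) \<longlonglongrightarrow> 0"
    by (rule l2norm_lincomb_tendsto[OF GL[OF Wn] GL[OF W] GL[OF h10_signed_abs(2)[OF un Wn]] GL[OF h10_signed_abs(2)[OF u W]]
        GL[OF h10_odd_part(2)[OF un Wn]] GL[OF h10_odd_part(2)[OF u W]] lims(2) T(2) o(2)])
  show ?thesis
    using h1_norm_diff_tendsto_iff[of "\<lambda>n. polarization {x. a \<bullet> x \<le> b} (un n)",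
        OF L[OF Pn(1)] L[OF P(1)] Pn(2) P(2)] 1 2 by blast
qed

end

end

section \<open>Two critical points at the mountain pass level\<close>

lemma liminf_eq_0:
  fixes X :: "nat \<Rightarrow> real"
  assumes nonneg: "\<And>n. 0 \<le> X n" and small: "\<And>e N. e > 0 \<Longrightarrow> \<exists>n\<ge>N. X n < e"
  shows "liminf (\<lambda>n. ereal (X n)) = 0"
proof (rule antisym)
  show "0 \<le> liminf (\<lambda>n. ereal (X n))" by (rule Liminf_bounded) (use nonneg in auto)
  show "liminf (\<lambda>n. ereal (X n)) \<le> 0"
  proof (rule ccontr)
    assume "\<not> ?thesis"
    then have "0 < liminf (\<lambda>n. ereal (X n))" by simp
    then obtain e where e: "0 < ereal e" "ereal e < liminf (\<lambda>n. ereal (X n))"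
      using ereal_dense2 by blast
    have "\<forall>\<^sub>F n in sequentially. ereal e < ereal (X n)" using e(2) by (rule less_LiminfD)
    then obtain N where "\<And>n. n \<ge> N \<Longrightarrow> e < X n" by (auto simp: eventually_sequentially)
    moreover obtain n where "n \<ge> N" "X n < e" using small[of e N] e(1) by auto
    ultimately show False by fastforce
  qed
qed

section \<open>The dual norm and the functional on H^1_0\<close>

lemma hm1_bound:
  assumes L: "L \<in> hm1_space \<Omega>" and h: "h \<in> h10_space \<Omega>" and \<Omega>: "open \<Omega>"
  shows "\<bar>L h\<bar> \<le> hm1_norm \<Omega> L * h1_norm \<Omega> h"
proof -
  obtain C where C: "\<And>u. u \<in> h10_space \<Omega> \<Longrightarrow> \<bar>L u\<bar> \<le> C * h1_norm \<Omega> u"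
    using L unfolding hm1_space_def by blast
  have scale: "L (\<lambda>x. a * h x) = a * L h" for a
  proof -
    have "L (\<lambda>x. a * h x + 0 * h x) = a * L h + 0 * L h"
      using L h unfolding hm1_space_def by blast
    then show ?thesis by simp
  qed
  have bdd: "bdd_above ((\<lambda>h. \<bar>L h\<bar>) ` {h \<in> h10_space \<Omega>. h1_norm \<Omega> h \<le> 1})"
  proof (rule bdd_aboveI2)
    fix k assume k: "k \<in> {h \<in> h10_space \<Omega>. h1_norm \<Omega> h \<le> 1}"
    have "\<bar>L k\<bar> \<le> C * h1_norm \<Omega> k" using C k by auto
    also have "\<dots> \<le> \<bar>C\<bar> * 1" using k h1_norm_nonneg[OF \<Omega>, of k] by (intro mult_mono) auto
    finally show "\<bar>L k\<bar> \<le> \<bar>C\<bar>" by simp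
  qed
  show ?thesis
  \<comment> \<open>A function of norm zero cannot be normalized; there the bound with the constant
    \<open>C\<close> already gives \<open>L h = 0\<close>.\<close>
  proof (cases "h1_norm \<Omega> h = 0")
    case True then show ?thesis using C[OF h] by simp
  next
    case False
    then have pos: "h1_norm \<Omega> h > 0" using h1_norm_nonneg[OF \<Omega>, of h] by simp
    define k where "k = (\<lambda>x. (1 / h1_norm \<Omega> h) * h x)"
    have "k \<in> h10_space \<Omega>" using h10_lincomb[OF \<Omega> h h, of "1 / h1_norm \<Omega> h" 0] by (simp add: k_def)
    moreover have "h1_norm \<Omega> k = 1"
      using pos unfolding k_def h1_norm_scale[OF \<Omega> h10_h1[OF \<Omega> h]] by simp
    ultimately have "\<bar>L k\<bar> \<le> hm1_norm \<Omega> L"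
      unfolding hm1_norm_def by (intro cSUP_upper bdd) auto
    moreover have "\<bar>L k\<bar> = \<bar>L h\<bar> / h1_norm \<Omega> h" using pos unfolding k_def scale by (simp add: abs_mult)
    ultimately show ?thesis using pos by (simp add: field_simps)
  qed
qed

text \<open>The zero function lies in the unit ball, so the supremum is over a nonempty set and is
  nonnegative. Both bounds together squeeze the dual norms of almost critical points to
  zero.\<close>

lemma hm1_norm_le:
  assumes \<Omega>: "open \<Omega>" and C: "0 \<le> C" "\<And>h. h \<in> h10_space \<Omega> \<Longrightarrow> \<bar>L h\<bar> \<le> C * h1_norm \<Omega> h"
  shows "0 \<le> hm1_norm \<Omega> L" "hm1_norm \<Omega> L \<le> C"
proof -
  have le: "\<bar>L h\<bar> \<le> C" if "h \<in> {h \<in> h10_space \<Omega>. h1_norm \<Omega> h \<le> 1}" for h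
    using C(2)[of h] that C(1) mult_left_mono[of "h1_norm \<Omega> h" 1 C] by auto
  have 0: "(\<lambda>x. 0) \<in> {h \<in> h10_space \<Omega>. h1_norm \<Omega> h \<le> 1}"
    using zero_h10[OF \<Omega>] h1_norm_scale[OF \<Omega> h10_h1[OF \<Omega> zero_h10[OF \<Omega>]], of 0] by simp
  show "hm1_norm \<Omega> L \<le> C" unfolding hm1_norm_def by (rule cSUP_least) (use 0 le in auto)
  have "\<bar>L (\<lambda>x. 0)\<bar> \<le> hm1_norm \<Omega> L"
    unfolding hm1_norm_def by (rule cSUP_upper[OF 0]) (use le in \<open>auto intro!: bdd_aboveI2\<close>)
  then show "0 \<le> hm1_norm \<Omega> L" by linarith
qed

lemma hm1_space_diff:
  assumes "L \<in> hm1_space \<Omega>" "K \<in> hm1_space \<Omega>"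
  shows "L - K \<in> hm1_space \<Omega>"
proof -
  obtain C where C: "\<And>u. u \<in> h10_space \<Omega> \<Longrightarrow> \<bar>L u\<bar> \<le> C * h1_norm \<Omega> u"
    using assms(1) unfolding hm1_space_def by blast
  obtain B where B: "\<And>u. u \<in> h10_space \<Omega> \<Longrightarrow> \<bar>K u\<bar> \<le> B * h1_norm \<Omega> u"
    using assms(2) unfolding hm1_space_def by blast
  have "\<bar>(L - K) u\<bar> \<le> (C + B) * h1_norm \<Omega> u" if "u \<in> h10_space \<Omega>" for u
    using C[OF that] B[OF that] by (simp add: distrib_right)
  moreover have "(L - K) (\<lambda>x. a * u x + b * v x) = a * (L - K) u + b * (L - K) v"
    if "u \<in> h10_space \<Omega>" "v \<in> h10_space \<Omega>" for u v a b
  proof -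
    have "L (\<lambda>x. a * u x + b * v x) = a * L u + b * L v" "K (\<lambda>x. a * u x + b * v x) = a * K u + b * K v"
      using assms that unfolding hm1_space_def by blast+
    then show ?thesis by (simp add: algebra_simps)
  qed
  ultimately show ?thesis unfolding hm1_space_def by blast
qed

text \<open>The abstract setting expresses continuity of the derivative by \<open>\<bar>\<phi>' v h
  - \<phi>' u h\<bar> \<le> e * h1_norm \<Omega> h\<close> for all \<open>h\<close>. Thus the
  supremum behind the dual norm is handled only here and when the Palais-Smale condition is
  invoked.\<close>

lemma C1_functional_h10:
  assumes \<Omega>: "open \<Omega>" and C1: "C1_on_h10 \<Omega> \<phi> \<phi>'"
  shows "C1_functional (\<lambda>c u x. c * u x) (h10_space \<Omega>) (h1_norm \<Omega>) \<phi> \<phi>'"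
proof -
  interpret complete_seminormed_subspace "\<lambda>c u x. c * u x" "h10_space \<Omega>" "h1_norm \<Omega>"
    by (rule h10_complete_seminormed_subspace[OF \<Omega>])
  have der: "has_h10_derivative \<Omega> \<phi> (\<phi>' u) u" if "u \<in> h10_space \<Omega>" for u
    using C1 that by (simp add: C1_on_h10_def)
  then have dual: "\<phi>' u \<in> hm1_space \<Omega>" if "u \<in> h10_space \<Omega>" for u
    using that by (simp add: has_h10_derivative_def)
  show ?thesis
  proof unfold_locales
    fix u h k :: "real^'a \<Rightarrow> real" and a b :: real
    assume "u \<in> h10_space \<Omega>" "h \<in> h10_space \<Omega>" "k \<in> h10_space \<Omega>"
    then show "\<phi>' u ((\<lambda>x. a * h x) + (\<lambda>x. b * k x)) = a * \<phi>' u h + b * \<phi>' u k"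
      using dual[of u] by (simp add: hm1_space_def plus_fun_def)
  next
    fix u :: "real^'a \<Rightarrow> real" assume u: "u \<in> h10_space \<Omega>"
    then show "\<exists>C. \<forall>h\<in>h10_space \<Omega>. \<bar>\<phi>' u h\<bar> \<le> C * h1_norm \<Omega> h"
      using dual[of u] by (simp add: hm1_space_def)
    fix e :: real assume e: "e > 0"
    show "\<exists>d>0. \<forall>v\<in>h10_space \<Omega>. h1_norm \<Omega> (v - u) < d \<longrightarrow>
        \<bar>\<phi> v - \<phi> u - \<phi>' u (v - u)\<bar> \<le> e * h1_norm \<Omega> (v - u)"
      using der[OF u] e by (simp add: has_h10_derivative_def)
    obtain d where d: "d > 0" "\<And>v. v \<in> h10_space \<Omega> \<Longrightarrow> h1_norm \<Omega> (v - u) < d \<Longrightarrow> hm1_norm \<Omega> (\<phi>' v - \<phi>' u) < e"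
      using C1 u e unfolding C1_on_h10_def by blast
    have "\<bar>\<phi>' v h - \<phi>' u h\<bar> \<le> e * h1_norm \<Omega> h"
      if v: "v \<in> h10_space \<Omega>" "h1_norm \<Omega> (v - u) < d" and h: "h \<in> h10_space \<Omega>" for v h
    proof -
      have "\<bar>(\<phi>' v - \<phi>' u) h\<bar> \<le> hm1_norm \<Omega> (\<phi>' v - \<phi>' u) * h1_norm \<Omega> h"
        by (rule hm1_bound[OF hm1_space_diff[OF dual[OF v(1)] dual[OF u]] h \<Omega>])
      also have "\<dots> \<le> e * h1_norm \<Omega> h"
        using d(2)[OF v] h1_norm_nonneg[OF \<Omega>] by (intro mult_right_mono) auto
      finally show ?thesis by simp
    qed
    then show "\<exists>d>0. \<forall>v\<in>h10_space \<Omega>. h1_norm \<Omega> (v - u) < d \<longrightarrow>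
        (\<forall>h\<in>h10_space \<Omega>. \<bar>\<phi>' v h - \<phi>' u h\<bar> \<le> e * h1_norm \<Omega> h)"
      using d(1) by blast
  qed
qed

theorem proposition3p1:
  fixes \<Omega> H :: "(real^'n::finite) set"
    and \<phi> :: "(real^'n \<Rightarrow> real) \<Rightarrow> real"
    and \<phi>' :: "(real^'n \<Rightarrow> real) \<Rightarrow> (real^'n \<Rightarrow> real) \<Rightarrow> real"
    and \<gamma> :: "nat \<Rightarrow> real \<Rightarrow> real^'n \<Rightarrow> real"
  assumes "open \<Omega>"
    and "C1_on_h10 \<Omega> \<phi> \<phi>'"
    and "strict_local_min_at_0 \<Omega> \<phi>"
    and "\<not> global_min_at_0 \<Omega> \<phi>"
    and "palais_smale \<Omega> \<phi> \<phi>'"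
    and "closed_half_space H"
    and "reflect H ` \<Omega> = \<Omega>"
    and "\<And>u. u \<in> h10_space \<Omega> \<Longrightarrow> \<phi> (polarization H u) \<le> \<phi> u"
    and "\<And>n. \<gamma> n \<in> mp_paths \<Omega> \<phi>"
    and "limsup (\<lambda>n. ereal (SUP t\<in>{0..1}. \<phi> (\<gamma> n t))) \<le> ereal (mp_level \<Omega> \<phi>)"
  shows "\<exists>u\<in>h10_space \<Omega>.
           \<phi> u = mp_level \<Omega> \<phi> \<and> \<phi> (polarization H u) = mp_level \<Omega> \<phi> \<and>
           (\<forall>h\<in>h10_space \<Omega>. \<phi>' u h = 0) \<and>
           (\<forall>h\<in>h10_space \<Omega>. \<phi>' (polarization H u) h = 0) \<and>
           liminf (\<lambda>n. ereal (h1_dist_set \<Omega> u (\<gamma> n ` {0..1}))) = 0"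
proof -
  let ?p = "h1_norm \<Omega>" and ?V = "h10_space \<Omega>"
  define c where "c = mp_level \<Omega> \<phi>"
  define pol where "pol = polarization H"
  interpret C1_functional "\<lambda>c u x. c * u x" ?V ?p \<phi> \<phi>'
    by (rule C1_functional_h10[OF assms(1,2)])
  obtain a b where a: "a \<noteq> 0" and H: "H = {x. a \<bullet> x \<le> b}"
    using assms(6) by (auto simp: closed_half_space_def)
  have reflect_\<Omega>: "reflect {x. a \<bullet> x \<le> b} x \<in> \<Omega>" if "x \<in> \<Omega>" for x
    using assms(7) that unfolding H by blast
  have pol_V: "pol u \<in> ?V" if u: "u \<in> ?V" for u
    unfolding pol_def H
    by (rule h10_polarization(1)[OF assms(1) a reflect_\<Omega> u h1_space_weak_gradient[OF assms(1) h10_h1[OF assms(1) u]]])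
  have pol_tendsto: "(\<lambda>n. ?p (pol (un n) - pol u)) \<longlonglongrightarrow> 0"
    if "\<And>n. un n \<in> ?V" "u \<in> ?V" "(\<lambda>n. ?p (un n - u)) \<longlonglongrightarrow> 0" for un u
    unfolding pol_def H by (rule polarization_tendsto[OF assms(1) a reflect_\<Omega> that])
  have pol_0: "pol 0 = 0" by (simp add: pol_def polarization_def fun_eq_iff zero_fun_def)
  have \<phi>_pol: "\<phi> (pol u) \<le> \<phi> u" if "u \<in> ?V" for u using assms(8)[OF that] by (simp add: pol_def)
  \<comment> \<open>Vanishing almost everywhere at the start is the same as having seminorm zero
    there, which turns admissible paths into paths of the abstract setting.\<close>
  have mp_iff: "\<beta> \<in> mp_paths \<Omega> \<phi> \<longleftrightarrow> path_in \<beta> \<and> ?p (\<beta> 0) = 0 \<and> \<phi> (\<beta> 1) < 0" for \<beta>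
  proof -
    have "(AE x in lebesgue_on \<Omega>. \<beta> 0 x = 0) \<longleftrightarrow> ?p (\<beta> 0) = 0" if \<beta>0: "\<beta> 0 \<in> ?V"
    proof
      assume "?p (\<beta> 0) = 0"
      then show "AE x in lebesgue_on \<Omega>. \<beta> 0 x = 0" by (rule h1_norm_eq_0_AE[OF assms(1) h10_h1[OF assms(1) \<beta>0]])
    next
      assume "AE x in lebesgue_on \<Omega>. \<beta> 0 x = 0"
      then have "?p (\<beta> 0 - (\<lambda>x. 0)) = 0"
        by (intro h10_cong_AE(3)[OF assms(1) zero_h10[OF assms(1)] is_weak_gradient_test[OF assms(1) zero_test_function]]
            L2_measurable[OF h1_space_L2[OF assms(1) h10_h1[OF assms(1) \<beta>0]]])
      then show "?p (\<beta> 0) = 0" by (simp add: fun_diff_def)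
    qed
    then show ?thesis unfolding mp_paths_def path_in_def by (auto simp: Ball_def)
  qed
  have \<gamma>: "path_in (\<gamma> n)" "?p (\<gamma> n 0) = 0" "\<phi> (\<gamma> n 1) < 0" for n using assms(9) by (simp_all add: mp_iff)
  have bdd: "bdd_above ((\<lambda>t. \<phi> (\<beta> t)) ` {0..1})" if "path_in \<beta>" for \<beta>
  proof -
    have "compact ((\<lambda>t. \<phi> (\<beta> t)) ` {0..1})"
      using \<phi>_path_continuous[OF that] by (intro compact_continuous_image) auto
    then show ?thesis by (intro bounded_imp_bdd_above compact_imp_bounded)
  qed
  have V0: "\<beta> 0 \<in> ?V" if "path_in \<beta>" for \<beta> using that by (auto intro: path_in_V[of \<beta>])
  have \<phi>_start: "\<phi> (\<beta> 0) = \<phi> 0" if "path_in \<beta>" "?p (\<beta> 0) = 0" for \<beta>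
    using that V0 by (intro \<phi>_cong) auto
  have sup_ge: "\<phi> 0 \<le> (SUP t\<in>{0..1}. \<phi> (\<beta> t))" if "\<beta> \<in> mp_paths \<Omega> \<phi>" for \<beta>
    using cSUP_upper[OF _ bdd, of 0 \<beta>] that \<phi>_start[of \<beta>] by (simp add: mp_iff)
  have bdd_level: "bdd_below ((\<lambda>\<beta>. SUP t\<in>{0..1}. \<phi> (\<beta> t)) ` mp_paths \<Omega> \<phi>)"
    by (rule bdd_belowI2) (rule sup_ge)
  have c_le: "c \<le> (SUP t\<in>{0..1}. \<phi> (\<beta> t))" if "\<beta> \<in> mp_paths \<Omega> \<phi>" for \<beta>
    unfolding c_def mp_level_def by (rule cINF_lower[OF bdd_level that])
  have c_ge: "\<phi> 0 \<le> c"
    unfolding c_def mp_level_def by (rule cINF_greatest) (use assms(9) sup_ge in auto)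
  have dist_nonneg: "0 \<le> h1_dist_set \<Omega> u (\<gamma> n ` {0..1})" for u n
    unfolding h1_dist_set_def by (rule cINF_greatest) (use h1_norm_nonneg[OF assms(1)] in auto)
  have dist_le: "h1_dist_set \<Omega> u (\<gamma> n ` {0..1}) \<le> ?p (u - \<gamma> n t)" if "t \<in> {0..1}" for u n t
    unfolding h1_dist_set_def
    by (rule cINF_lower) (use that h1_norm_nonneg[OF assms(1)] in \<open>auto intro!: bdd_belowI2\<close>)
  show ?thesis
  proof (cases "c = \<phi> 0")
    case True
    obtain r where r: "r > 0" "\<And>v. v \<in> ?V \<Longrightarrow> 0 < ?p v \<Longrightarrow> ?p v < r \<Longrightarrow> \<phi> 0 < \<phi> v"
      using assms(3) by (auto simp: strict_local_min_at_0_def zero_fun_def)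
    have "\<phi> 0 \<le> \<phi> v" if v: "v \<in> ?V" "?p v < r" for v
    proof (cases "?p v = 0")
      case True then show ?thesis using \<phi>_cong[of 0 v] v by simp
    next
      case False
      then show ?thesis using r(2)[OF v(1) _ v(2)] h1_norm_nonneg[OF assms(1), of v] by simp
    qed
    then have D0: "\<phi>' 0 h = 0" if "h \<in> ?V" for h using local_min_D_eq_0[OF r(1) _ that] by blast
    \<comment> \<open>Every path starts at a representative of 0, so the distance is zero for each
      \<open>n\<close>, not merely in the limit inferior.\<close>
    have "h1_dist_set \<Omega> 0 (\<gamma> n ` {0..1}) = 0" for n
      using dist_le[of 0 0 n] dist_nonneg[of 0 n] p_minus[OF V0[OF \<gamma>(1)], of n] \<gamma>(2)[of n] by simp
    then show ?thesis
      using True D0 pol_0 unfolding c_def pol_def by (intro bexI[of _ 0]) (auto simp: zero_ereal_def[symmetric] Liminf_const)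
  next
    case False
    then have gap: "\<phi> 0 < c" using c_ge by simp
    \<comment> \<open>The witness \<open>y\<close> is the deformed point. It is recorded because
      \<open>w\<close> is close to \<open>pol y\<close>, while closeness of \<open>y\<close> to
      \<open>\<gamma> n t\<close> yields no explicit estimate between their polarizations.\<close>
    have near: "\<exists>t\<in>{0..1}. \<exists>v\<in>?V. \<exists>y\<in>?V. \<exists>w\<in>?V.
        ?p (v - \<gamma> n t) < 3 * e \<and> c - e\<^sup>2 \<le> \<phi> v \<and> \<phi> v \<le> c + e\<^sup>2 \<and> (\<forall>h\<in>?V. \<bar>\<phi>' v h\<bar> \<le> 3 * e * ?p h) \<and>
        ?p (y - \<gamma> n t) \<le> 2 * e \<and>
        ?p (w - pol y) < 3 * e \<and> c - e\<^sup>2 \<le> \<phi> w \<and> \<phi> w \<le> c + e\<^sup>2 \<and> (\<forall>h\<in>?V. \<bar>\<phi>' w h\<bar> \<le> 3 * e * ?p h)"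
      if e: "e > 0" "\<phi> 0 < c - e\<^sup>2" and n: "(SUP t\<in>{0..1}. \<phi> (\<gamma> n t)) \<le> c + e\<^sup>2" for e n
    proof -
      have \<gamma>_le: "\<phi> (\<gamma> n t) \<le> c + e\<^sup>2" if "t \<in> {0..1}" for t
        using cSUP_upper[OF that bdd[OF \<gamma>(1)], of n] n by simp
      obtain \<beta> where \<beta>: "path_in \<beta>" "?p (\<beta> 0 - \<gamma> n 0) = 0"
        and \<beta>t: "\<And>t. t \<in> {0..1} \<Longrightarrow> \<phi> (\<beta> t) \<le> \<phi> (\<gamma> n t) \<and> ?p (\<beta> t - \<gamma> n t) \<le> 2 * e \<and>
          (\<phi> (\<beta> t) \<le> c - e\<^sup>2 \<or> (\<exists>v\<in>?V. ?p (v - \<gamma> n t) < 3 * e \<and> c - e\<^sup>2 \<le> \<phi> v \<and> \<phi> v \<le> c + e\<^sup>2 \<and>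
            (\<forall>h\<in>?V. \<bar>\<phi>' v h\<bar> \<le> 3 * e * ?p h)))"
        using path_deformation[OF \<gamma>(1) e(1) \<gamma>_le] \<phi>_start[OF \<gamma>(1,2)] e(2) by auto
      note \<beta>V = path_in_V[OF \<beta>(1)]
      have \<beta>0: "?p (\<beta> 0) = 0"
        using p_diff_triangle[OF V0[OF \<beta>(1)] V0[OF \<gamma>(1)] V_0, of n] \<beta>(2) \<gamma>(2)[of n] p_nonneg[OF V0[OF \<beta>(1)]] by simp
      define \<alpha> where "\<alpha> t = pol (\<beta> t)" for t
      have \<alpha>: "path_in \<alpha>"
        unfolding path_in_def
      proof (intro conjI ballI)
        fix t :: real assume t: "t \<in> {0..1}"
        show "\<alpha> t \<in> ?V" unfolding \<alpha>_def by (rule pol_V[OF \<beta>V[OF t]])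
        show "((\<lambda>s. ?p (\<alpha> s - \<alpha> t)) \<longlongrightarrow> 0) (at t within {0..1})"
          \<comment> \<open>Continuity of the polarization is known for sequences, hence the
            sequential form of the limit.\<close>
          unfolding tendsto_at_iff_sequentially
        proof (intro allI impI)
          fix X :: "nat \<Rightarrow> real" assume X: "\<forall>i. X i \<in> {0..1} - {t}" "X \<longlonglongrightarrow> t"
          have "((\<lambda>s. ?p (\<beta> s - \<beta> t)) \<longlongrightarrow> 0) (at t within {0..1})" using \<beta>(1) t by (simp add: path_in_def)
          then have "(\<lambda>i. ?p (\<beta> (X i) - \<beta> t)) \<longlonglongrightarrow> 0"
            unfolding tendsto_at_iff_sequentially using X by (auto simp: o_def)
          then show "((\<lambda>s. ?p (\<alpha> s - \<alpha> t)) \<circ> X) \<longlonglongrightarrow> 0"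
            unfolding o_def \<alpha>_def using X(1) t by (intro pol_tendsto \<beta>V) auto
        qed
      qed
      have \<alpha>0: "?p (\<alpha> 0) = 0"
      proof -
        have "(\<lambda>n::nat. ?p (pol (\<beta> 0) - pol 0)) \<longlonglongrightarrow> 0"
          by (rule pol_tendsto) (use V0[OF \<beta>(1)] \<beta>0 in auto)
        then show ?thesis by (simp add: LIMSEQ_const_iff \<alpha>_def pol_0)
      qed
      have \<alpha>_le: "\<phi> (\<alpha> t) \<le> \<phi> (\<beta> t)" if "t \<in> {0..1}" for t
        unfolding \<alpha>_def by (rule \<phi>_pol[OF \<beta>V[OF that]])
      have \<alpha>_upper: "\<phi> (\<alpha> t) \<le> c + e\<^sup>2" if "t \<in> {0..1}" for t
        using \<alpha>_le[OF that] \<beta>t[OF that] \<gamma>_le[OF that] by linarith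
      obtain \<delta> where \<delta>: "path_in \<delta>" "?p (\<delta> 0 - \<alpha> 0) = 0"
        and \<delta>t: "\<And>t. t \<in> {0..1} \<Longrightarrow> \<phi> (\<delta> t) \<le> \<phi> (\<alpha> t) \<and> ?p (\<delta> t - \<alpha> t) \<le> 2 * e \<and>
          (\<phi> (\<delta> t) \<le> c - e\<^sup>2 \<or> (\<exists>v\<in>?V. ?p (v - \<alpha> t) < 3 * e \<and> c - e\<^sup>2 \<le> \<phi> v \<and> \<phi> v \<le> c + e\<^sup>2 \<and>
            (\<forall>h\<in>?V. \<bar>\<phi>' v h\<bar> \<le> 3 * e * ?p h)))"
        using path_deformation[OF \<alpha> e(1) \<alpha>_upper] \<phi>_start[OF \<alpha> \<alpha>0] e(2) by auto
      have \<delta>0: "?p (\<delta> 0) = 0"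
        using p_diff_triangle[OF V0[OF \<delta>(1)] V0[OF \<alpha>] V_0] \<delta>(2) \<alpha>0 p_nonneg[OF V0[OF \<delta>(1)]] by simp
      \<comment> \<open>None of the three modifications raises \<open>\<phi>\<close> at any
        parameter, so the endpoint keeps its negative level and the last path is admissible.\<close>
      have "\<phi> (\<delta> 1) < 0"
        using \<delta>t[of 1] \<alpha>_le[of 1] \<beta>t[of 1] \<gamma>(3)[of n] by force
      then have "\<delta> \<in> mp_paths \<Omega> \<phi>" using \<delta>(1) \<delta>0 by (simp add: mp_iff)
      then have c\<delta>: "c \<le> (SUP t\<in>{0..1}. \<phi> (\<delta> t))" by (rule c_le)
      have "\<exists>t\<in>{0..1}. c - e\<^sup>2 < \<phi> (\<delta> t)"
      proof (rule ccontr)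
        assume "\<not> ?thesis"
        then have "(SUP t\<in>{0..1}. \<phi> (\<delta> t)) \<le> c - e\<^sup>2" by (intro cSUP_least) (auto simp: not_less)
        moreover have "e\<^sup>2 > 0" using e(1) by simp
        ultimately show False using c\<delta> by linarith
      qed
      then obtain t where t: "t \<in> {0..1}" "c - e\<^sup>2 < \<phi> (\<delta> t)" by blast
      have "c - e\<^sup>2 < \<phi> (\<beta> t)" using t(2) \<delta>t[OF t(1)] \<alpha>_le[OF t(1)] by linarith
      then obtain v where "v \<in> ?V" "?p (v - \<gamma> n t) < 3 * e" "c - e\<^sup>2 \<le> \<phi> v" "\<phi> v \<le> c + e\<^sup>2"
          "\<forall>h\<in>?V. \<bar>\<phi>' v h\<bar> \<le> 3 * e * ?p h"
        using \<beta>t[OF t(1)] by force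
      moreover obtain w where "w \<in> ?V" "?p (w - \<alpha> t) < 3 * e" "c - e\<^sup>2 \<le> \<phi> w" "\<phi> w \<le> c + e\<^sup>2"
          "\<forall>h\<in>?V. \<bar>\<phi>' w h\<bar> \<le> 3 * e * ?p h"
        using \<delta>t[OF t(1)] t(2) by force
      moreover have "\<beta> t \<in> ?V" "?p (\<beta> t - \<gamma> n t) \<le> 2 * e" using \<beta>V[OF t(1)] \<beta>t[OF t(1)] by auto
      ultimately show ?thesis using t(1) unfolding \<alpha>_def by blast
    qed
    \<comment> \<open>The bound by 1 gives \<open>(e k)\<^sup>2 \<le> d\<close>, and
      \<open>d < c - \<phi> 0\<close> then keeps the starting level below every floor
      \<open>c - (e k)\<^sup>2\<close>, as \<open>path_deformation\<close> requires.\<close>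
    define d where "d = min 1 ((c - \<phi> 0) / 2)"
    have d: "d > 0" "d \<le> 1" "d < c - \<phi> 0" using gap by (simp_all add: d_def min_def)
    define e where "e k = d * inverse (real (Suc k))" for k
    have e: "e k > 0" "e k \<le> d" for k
      using d(1) by (auto simp: e_def field_simps)
    have e2: "\<phi> 0 < c - (e k)\<^sup>2" for k
    proof -
      have "(e k)\<^sup>2 \<le> d * 1" unfolding power2_eq_square using e[of k] d by (intro mult_mono) auto
      then show ?thesis using d(3) by simp
    qed
    have e_lim: "e \<longlonglongrightarrow> 0"
      unfolding e_def[abs_def] by (rule tendsto_mult_right_zero[OF LIMSEQ_inverse_real_of_nat])
    \<comment> \<open>Indices beyond \<open>k\<close> are demanded so that the limit inferior at the
      end is tested along arbitrarily late paths.\<close>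
    have "\<exists>n\<ge>k. (SUP t\<in>{0..1}. \<phi> (\<gamma> n t)) \<le> c + (e k)\<^sup>2" for k
    proof -
      have "(e k)\<^sup>2 > 0" using e(1)[of k] by simp
      then have "limsup (\<lambda>n. ereal (SUP t\<in>{0..1}. \<phi> (\<gamma> n t))) < ereal (c + (e k)\<^sup>2)"
        using assms(10) unfolding c_def[symmetric] by (rule_tac order_le_less_trans) auto
      then have "\<forall>\<^sub>F n in sequentially. ereal (SUP t\<in>{0..1}. \<phi> (\<gamma> n t)) < ereal (c + (e k)\<^sup>2)"
        by (rule Limsup_lessD)
      then obtain N where "\<And>n. n \<ge> N \<Longrightarrow> (SUP t\<in>{0..1}. \<phi> (\<gamma> n t)) < c + (e k)\<^sup>2"
        by (auto simp: eventually_sequentially)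
      then show ?thesis by (intro exI[of _ "max k N"]) (auto intro: less_imp_le)
    qed
    then obtain N where N: "\<And>k. N k \<ge> k" "\<And>k. (SUP t\<in>{0..1}. \<phi> (\<gamma> (N k) t)) \<le> c + (e k)\<^sup>2" by metis
    have "\<forall>k. \<exists>t v y w. t \<in> {0..1} \<and> v \<in> ?V \<and> y \<in> ?V \<and> w \<in> ?V \<and>
        ?p (v - \<gamma> (N k) t) < 3 * e k \<and> c - (e k)\<^sup>2 \<le> \<phi> v \<and> \<phi> v \<le> c + (e k)\<^sup>2 \<and> (\<forall>h\<in>?V. \<bar>\<phi>' v h\<bar> \<le> 3 * e k * ?p h) \<and>
        ?p (y - \<gamma> (N k) t) \<le> 2 * e k \<and>
        ?p (w - pol y) < 3 * e k \<and> c - (e k)\<^sup>2 \<le> \<phi> w \<and> \<phi> w \<le> c + (e k)\<^sup>2 \<and> (\<forall>h\<in>?V. \<bar>\<phi>' w h\<bar> \<le> 3 * e k * ?p h)"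
      using near[OF e(1) e2 N(2)] by blast
    then obtain t v y w where tvyw: "\<And>k. t k \<in> {0..1} \<and> v k \<in> ?V \<and> y k \<in> ?V \<and> w k \<in> ?V \<and>
        ?p (v k - \<gamma> (N k) (t k)) < 3 * e k \<and> c - (e k)\<^sup>2 \<le> \<phi> (v k) \<and> \<phi> (v k) \<le> c + (e k)\<^sup>2 \<and>
        (\<forall>h\<in>?V. \<bar>\<phi>' (v k) h\<bar> \<le> 3 * e k * ?p h) \<and>
        ?p (y k - \<gamma> (N k) (t k)) \<le> 2 * e k \<and>
        ?p (w k - pol (y k)) < 3 * e k \<and> c - (e k)\<^sup>2 \<le> \<phi> (w k) \<and> \<phi> (w k) \<le> c + (e k)\<^sup>2 \<and>
        (\<forall>h\<in>?V. \<bar>\<phi>' (w k) h\<bar> \<le> 3 * e k * ?p h)"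
      by metis
    have c_lim: "(\<lambda>k. \<phi> (x k)) \<longlonglongrightarrow> c" if "\<And>k. c - (e k)\<^sup>2 \<le> \<phi> (x k)" "\<And>k. \<phi> (x k) \<le> c + (e k)\<^sup>2" for x
    proof (rule tendsto_sandwich)
      show "(\<lambda>k. c - (e k)\<^sup>2) \<longlonglongrightarrow> c" "(\<lambda>k. c + (e k)\<^sup>2) \<longlonglongrightarrow> c"
        using tendsto_diff[OF tendsto_const tendsto_power[OF e_lim, of 2], of c]
          tendsto_add[OF tendsto_const tendsto_power[OF e_lim, of 2], of c] by simp_all
    qed (use that in auto)
    have \<phi>v: "(\<lambda>k. \<phi> (v k)) \<longlonglongrightarrow> c" and \<phi>w: "(\<lambda>k. \<phi> (w k)) \<longlonglongrightarrow> c"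
      using tvyw by (auto intro!: c_lim)
    \<comment> \<open>The Palais-Smale condition is invoked for \<open>v\<close> only. The limit of
      \<open>w\<close> comes from \<open>y\<close> having the same limit as \<open>v\<close> along
      the subsequence and from continuity of the polarization at \<open>u\<close>, which identifies
      it as \<open>pol u\<close>.\<close>
    have "(\<lambda>k. hm1_norm \<Omega> (\<phi>' (v k))) \<longlonglongrightarrow> 0"
    proof (rule tendsto_sandwich[OF _ _ tendsto_const])
      show "(\<lambda>k. 3 * e k) \<longlonglongrightarrow> 0" by (rule tendsto_mult_right_zero[OF e_lim])
      have "0 \<le> 3 * e k" "\<And>h. h \<in> ?V \<Longrightarrow> \<bar>\<phi>' (v k) h\<bar> \<le> 3 * e k * ?p h" for k
        using e(1)[of k] tvyw[of k] by auto
      note bound = hm1_norm_le[OF assms(1) this]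
      show "\<forall>\<^sub>F k in sequentially. 0 \<le> hm1_norm \<Omega> (\<phi>' (v k))"
        by (intro always_eventually allI) (rule bound(1))
      show "\<forall>\<^sub>F k in sequentially. hm1_norm \<Omega> (\<phi>' (v k)) \<le> 3 * e k"
        by (intro always_eventually allI) (rule bound(2))
    qed
    then obtain r u where r: "strict_mono r" and u: "u \<in> ?V" and vu: "(\<lambda>k. ?p (v (r k) - u)) \<longlonglongrightarrow> 0"
      using assms(5) \<phi>v tvyw unfolding palais_smale_def convergent_def by metis
    have r_ge: "k \<le> r k" for k by (rule seq_suble[OF r])
    have er: "(\<lambda>k. e (r k)) \<longlonglongrightarrow> 0" using LIMSEQ_subseq_LIMSEQ[OF e_lim r] by (simp add: o_def)
    have three_er: "(\<lambda>k. 3 * e (r k)) \<longlonglongrightarrow> 0" by (rule tendsto_mult_right_zero[OF er])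
    define g where "g k = \<gamma> (N (r k)) (t (r k))" for k
    have gV: "g k \<in> ?V" for k unfolding g_def using tvyw by (intro path_in_V[OF \<gamma>(1)]) blast
    have vV: "v k \<in> ?V" and yV: "y k \<in> ?V" and wV: "w k \<in> ?V" for k using tvyw[of k] by auto
    have gu: "(\<lambda>k. ?p (u - g k)) \<longlonglongrightarrow> 0"
    proof (rule tendsto_sandwich[OF _ _ tendsto_const tendsto_add_zero[OF vu three_er]]; intro always_eventually allI)
      fix k
      show "0 \<le> ?p (u - g k)" using u gV by simp
      have "?p (v (r k) - g k) < 3 * e (r k)" using tvyw[of "r k"] by (simp add: g_def)
      then show "?p (u - g k) \<le> ?p (v (r k) - u) + 3 * e (r k)"
        using p_diff_triangle[OF u vV[of "r k"] gV[of k]] p_diff_commute[OF u vV, of "r k"] by simp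
    qed
    have yu: "(\<lambda>k. ?p (y (r k) - u)) \<longlonglongrightarrow> 0"
    proof (rule tendsto_sandwich[OF _ _ tendsto_const tendsto_add_zero[OF gu three_er]]; intro always_eventually allI)
      fix k
      show "0 \<le> ?p (y (r k) - u)" using u yV by simp
      have "?p (y (r k) - g k) \<le> 2 * e (r k)" using tvyw[of "r k"] by (simp add: g_def)
      then show "?p (y (r k) - u) \<le> ?p (u - g k) + 3 * e (r k)"
        using p_diff_triangle[OF yV[of "r k"] gV[of k] u] p_diff_commute[OF u gV, of k] e(1)[of "r k"] by simp
    qed
    have wu: "(\<lambda>k. ?p (w (r k) - pol u)) \<longlonglongrightarrow> 0"
    proof (rule tendsto_sandwich[OF _ _ tendsto_const tendsto_add_zero[OF pol_tendsto[OF yV u yu] three_er]];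
        intro always_eventually allI)
      fix k
      show "0 \<le> ?p (w (r k) - pol u)" using pol_V[OF u] wV by simp
      have "?p (w (r k) - pol (y (r k))) < 3 * e (r k)" using tvyw[of "r k"] by simp
      then show "?p (w (r k) - pol u) \<le> ?p (pol (y (r k)) - pol u) + 3 * e (r k)"
        using p_diff_triangle[OF wV[of "r k"] pol_V[OF yV[of "r k"]] pol_V[OF u]] by simp
    qed
    have "\<phi> u = c"
      using LIMSEQ_unique[OF \<phi>_tendsto[OF vu vV u]] LIMSEQ_subseq_LIMSEQ[OF \<phi>v r] by (simp add: o_def)
    moreover have "\<phi> (pol u) = c"
      using LIMSEQ_unique[OF \<phi>_tendsto[OF wu wV pol_V[OF u]]] LIMSEQ_subseq_LIMSEQ[OF \<phi>w r] by (simp add: o_def)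
    moreover have "\<phi>' u h = 0" if "h \<in> ?V" for h
      by (rule D_eq_0_limit[OF vu vV u that _ three_er]) (use tvyw that in blast)
    moreover have "\<phi>' (pol u) h = 0" if "h \<in> ?V" for h
      by (rule D_eq_0_limit[OF wu wV pol_V[OF u] that _ three_er]) (use tvyw that in blast)
    moreover have "liminf (\<lambda>n. ereal (h1_dist_set \<Omega> u (\<gamma> n ` {0..1}))) = 0"
    proof (rule liminf_eq_0[OF dist_nonneg])
      fix \<epsilon> :: real and M :: nat assume "\<epsilon> > 0"
      with gu have "\<forall>\<^sub>F k in sequentially. ?p (u - g k) < \<epsilon>" by (rule order_tendstoD(2))
      then obtain K where K: "\<And>k. k \<ge> K \<Longrightarrow> ?p (u - g k) < \<epsilon>" by (auto simp: eventually_sequentially)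
      define k where "k = max K M"
      have "M \<le> k" by (simp add: k_def)
      also note r_ge[of k]
      also note N(1)[of "r k"]
      finally have "M \<le> N (r k)" .
      moreover have "h1_dist_set \<Omega> u (\<gamma> (N (r k)) ` {0..1}) < \<epsilon>"
        using dist_le[of "t (r k)" u "N (r k)"] K[of k] tvyw[of "r k"] by (simp add: g_def k_def)
      ultimately show "\<exists>n\<ge>M. h1_dist_set \<Omega> u (\<gamma> n ` {0..1}) < \<epsilon>" by blast
    qed
    ultimately show ?thesis using u unfolding c_def pol_def by blast
  qed
qed

end
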